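(* Let $\Omega\subseteq\mathbb{R}^n$ be open and bounded, let $a(\lambda):=\int_0^\lambda\frac{ds}{1+|s|}=\operatorname{sgn}(\lambda)\ln(1+|\lambda|)$ for $\lambda\in\mathbb{R}$, and let $f\colon\Omega\to\mathbb{R}$ be locally Lipschitz. Then the comparison principle holds for the equation $$\sum_{i=1}^n a\big(\lambda_i(\mathcal{H}w)\big)=f(x)\qquad\text{in }\Omega.$$
   Context: $\mathcal{S}^n$ is the space of real symmetric $n\times n$ matrices; $\lambda_1(X)\le\dots\le\lambda_n(X)$ are the eigenvalues of $X\in\mathcal{S}^n$; $\mathcal{H}w$ is the Hessian matrix of $w$. Write $F(X,x):=\sum_{i=1}^n a(\lambda_i(X))-f(x)$, so that the equation is $F(\mathcal{H}w,x)=0$. Viscosity solutions: $v\in USC(\overline\Omega)$ is a viscosity subsolution of $F(\mathcal{H}w,x)=0$ in $\Omega$ if, whenever $x_0\in\Omega$ and $\phi$ is a $C^2$ function near $x_0$ with $\phi(x_0)=v(x_0)$ and $\phi\ge v$ near $x_0$, then $F(\mathcal{H}\phi(x_0),x_0)\ge0$. $u\in LSC(\overline\Omega)$ is a viscosity supersolution if, whenever $\phi$ is $C^2$ near $x_0\in\Omega$ with $\phi(x_0)=u(x_0)$ and $\phi\le u$ near $x_0$, then $F(\mathcal{H}\phi(x_0),x_0)\le0$. ($USC$, $LSC$: real-valued upper/lower semicontinuous functions.) The comparison principle holds for the equation in $\Omega$ if: whenever $v\in USC(\overline\Omega)$ is a viscosity subsolution and $u\in LSC(\overline\Omega)$ is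 a viscosity supersolution in $\Omega$ with $v\le u$ on $\partial\Omega$, then $v\le u$ in $\Omega$. *)

theory Defs
  imports
    "HOL-Analysis.Analysis"
    "HOL-Computational_Algebra.Computational_Algebra"
begin

section \<open>Eigenvalues of symmetric matrices\<close>

text \<open>The characteristic polynomial \<open>det (t I - X)\<close>, as a determinant over the ring of real
  polynomials in \<open>t\<close>.\<close>
definition charpoly :: "real ^ 'n ^ 'n \<Rightarrow> real poly" where
  "charpoly X = det (\<chi> i j. (if i = j then [:0, 1:] else 0) - [:X $ i $ j:])"

text \<open>\<open>eigval k X\<close> is the \<open>k\<close>-th smallest eigenvalue, counted with multiplicity and indexed by
  \<open>k = 1, \<dots>, n\<close>.  It is meaningful only for symmetric \<open>X\<close>, whose characteristic polynomial
  has exactly \<open>n\<close> real roots counted with multiplicity.  Below it is only ever applied to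
  Hessians of \<open>C\<^sup>2\<close> functions.\<close>
definition eigval :: "nat \<Rightarrow> real ^ 'n ^ 'n \<Rightarrow> real" where
  "eigval k X = sorted_list_of_multiset (proots (charpoly X)) ! (k - 1)"


section \<open>Functions of class \<open>C\<^sup>2\<close> and the Hessian\<close>

definition partial_derivative :: "'n \<Rightarrow> (real ^ 'n \<Rightarrow> real) \<Rightarrow> real ^ 'n \<Rightarrow> real" where
  "partial_derivative i \<phi> x = frechet_derivative \<phi> (at x) (axis i 1)"

definition C2_on :: "(real ^ 'n) set \<Rightarrow> (real ^ 'n \<Rightarrow> real) \<Rightarrow> bool" where
  "C2_on U \<phi> \<longleftrightarrow>
     (\<forall>x\<in>U. \<phi> differentiable (at x)) \<and>
     (\<forall>i. \<forall>x\<in>U. partial_derivative i \<phi> differentiable (at x)) \<and>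
     (\<forall>i j. continuous_on U (partial_derivative i (partial_derivative j \<phi>)))"

definition C2_near :: "real ^ 'n \<Rightarrow> (real ^ 'n \<Rightarrow> real) \<Rightarrow> bool" where
  "C2_near x\<^sub>0 \<phi> \<longleftrightarrow> (\<exists>U. open U \<and> x\<^sub>0 \<in> U \<and> C2_on U \<phi>)"

definition hessian :: "(real ^ 'n \<Rightarrow> real) \<Rightarrow> real ^ 'n \<Rightarrow> real ^ 'n ^ 'n" where
  "hessian \<phi> x = (\<chi> i j. partial_derivative i (partial_derivative j \<phi>) x)"


section \<open>Viscosity solutions and the comparison principle\<close>

definition usc_on :: "'a::topological_space set \<Rightarrow> ('a \<Rightarrow> real) \<Rightarrow> bool" where
  "usc_on S v \<longleftrightarrow> (\<forall>x\<in>S. \<forall>c. v x < c \<longrightarrow> (\<forall>\<^sub>F y in at x within S. v y < c))"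

definition lsc_on :: "'a::topological_space set \<Rightarrow> ('a \<Rightarrow> real) \<Rightarrow> bool" where
  "lsc_on S u \<longleftrightarrow> (\<forall>x\<in>S. \<forall>c. c < u x \<longrightarrow> (\<forall>\<^sub>F y in at x within S. c < u y))"

text \<open>Functions on \<open>\<Omega>\<close> or its closure are represented by total functions.  Their values outside are
  irrelevant: \<open>\<Omega>\<close> is always open, so that the neighbourhoods of \<open>x\<^sub>0 \<in> \<Omega>\<close> below may be taken
  inside \<open>\<Omega>\<close>.\<close>

definition viscosity_subsolution ::
  "(real ^ 'n ^ 'n \<Rightarrow> real ^ 'n \<Rightarrow> real) \<Rightarrow> (real ^ 'n) set \<Rightarrow> (real ^ 'n \<Rightarrow> real) \<Rightarrow> bool" where
  "viscosity_subsolution F \<Omega> v \<longleftrightarrow>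
     usc_on (closure \<Omega>) v \<and>
     (\<forall>x\<^sub>0\<in>\<Omega>. \<forall>\<phi>. C2_near x\<^sub>0 \<phi> \<and> \<phi> x\<^sub>0 = v x\<^sub>0 \<and> (\<forall>\<^sub>F x in nhds x\<^sub>0. \<phi> x \<ge> v x)
        \<longrightarrow> F (hessian \<phi> x\<^sub>0) x\<^sub>0 \<ge> 0)"

definition viscosity_supersolution ::
  "(real ^ 'n ^ 'n \<Rightarrow> real ^ 'n \<Rightarrow> real) \<Rightarrow> (real ^ 'n) set \<Rightarrow> (real ^ 'n \<Rightarrow> real) \<Rightarrow> bool" where
  "viscosity_supersolution F \<Omega> u \<longleftrightarrow>
     lsc_on (closure \<Omega>) u \<and>
     (\<forall>x\<^sub>0\<in>\<Omega>. \<forall>\<phi>. C2_near x\<^sub>0 \<phi> \<and> \<phi> x\<^sub>0 = u x\<^sub>0 \<and> (\<forall>\<^sub>F x in nhds x\<^sub>0. \<phi> x \<le> u x)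
        \<longrightarrow> F (hessian \<phi> x\<^sub>0) x\<^sub>0 \<le> 0)"

definition comparison_principle ::
  "(real ^ 'n ^ 'n \<Rightarrow> real ^ 'n \<Rightarrow> real) \<Rightarrow> (real ^ 'n) set \<Rightarrow> bool" where
  "comparison_principle F \<Omega> \<longleftrightarrow>
     (\<forall>v u. viscosity_subsolution F \<Omega> v \<and> viscosity_supersolution F \<Omega> u \<and>
        (\<forall>x\<in>frontier \<Omega>. v x \<le> u x) \<longrightarrow> (\<forall>x\<in>\<Omega>. v x \<le> u x))"


section \<open>The equation\<close>

definition a_fun :: "real \<Rightarrow> real" where
  "a_fun l = (LBINT s=0..l. 1 / (1 + \<bar>s\<bar>))"

lemma a_fun_eq: "a_fun l = sgn l * ln (1 + \<bar>l\<bar>)"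
proof (cases "l \<ge> 0")
  case True
  have "(LBINT s=0..l. 1 / (1 + \<bar>s\<bar>)) = ln (1 + l) - ln (1 + 0)"
    unfolding zero_ereal_def
  proof (rule interval_integral_FTC_finite)
    show "continuous_on {min 0 l..max 0 l} (\<lambda>s. 1 / (1 + \<bar>s\<bar>))"
      by (intro continuous_intros) (auto simp: add_nonneg_eq_0_iff)
  next
    fix x :: real assume "min 0 l \<le> x"
    then have "x \<ge> 0" using True by simp
    then have "((\<lambda>s. ln (1 + s)) has_real_derivative 1 / (1 + \<bar>x\<bar>)) (at x within {min 0 l..max 0 l})"
      by (auto intro!: derivative_eq_intros)
    then show "((\<lambda>s. ln (1 + s)) has_vector_derivative 1 / (1 + \<bar>x\<bar>))
        (at x within {min 0 l..max 0 l})"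
      by (simp add: has_real_derivative_iff_has_vector_derivative)
  qed
  then show ?thesis using True by (auto simp: a_fun_def sgn_if)
next
  case False
  have "(LBINT s=0..l. 1 / (1 + \<bar>s\<bar>)) = - ln (1 - l) - (- ln (1 - 0))"
    unfolding zero_ereal_def
  proof (rule interval_integral_FTC_finite)
    show "continuous_on {min 0 l..max 0 l} (\<lambda>s. 1 / (1 + \<bar>s\<bar>))"
      by (intro continuous_intros) (auto simp: add_nonneg_eq_0_iff)
  next
    fix x :: real assume "x \<le> max 0 l"
    then have "x \<le> 0" using False by simp
    then have "((\<lambda>s. - ln (1 - s)) has_real_derivative 1 / (1 + \<bar>x\<bar>)) (at x within {min 0 l..max 0 l})"
      by (auto intro!: derivative_eq_intros)
    then show "((\<lambda>s. - ln (1 - s)) has_vector_derivative 1 / (1 + \<bar>x\<bar>))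
        (at x within {min 0 l..max 0 l})"
      by (simp add: has_real_derivative_iff_has_vector_derivative)
  qed
  then show ?thesis using False by (auto simp: a_fun_def sgn_if)
qed

definition F_eq :: "(real ^ 'n \<Rightarrow> real) \<Rightarrow> real ^ 'n ^ 'n \<Rightarrow> real ^ 'n \<Rightarrow> real" where
  "F_eq f X x = (\<Sum>i = 1..CARD('n). a_fun (eigval i X)) - f x"

text \<open>The library's \<^const>\<open>local_lipschitz\<close> is about families of functions; a single function is a
  constant family, indexed here by the reals.\<close>
definition locally_lipschitz :: "'a::metric_space set \<Rightarrow> ('a \<Rightarrow> real) \<Rightarrow> bool" where
  "locally_lipschitz \<Omega> f \<longleftrightarrow> local_lipschitz (UNIV :: real set) \<Omega> (\<lambda>_. f)"

lemma locally_lipschitz_iff: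
  "locally_lipschitz \<Omega> f \<longleftrightarrow> (\<forall>x\<in>\<Omega>. \<exists>r>0. \<exists>L. L-lipschitz_on (cball x r \<inter> \<Omega>) f)"
proof -
  have "\<exists>t. t \<in> cball s r" if "r > 0" for s r :: real
    using that by (intro exI[of _ s]) simp
  then show ?thesis
    unfolding locally_lipschitz_def local_lipschitz_def by simp meson
qed

end

theory Submission
  imports Defs
begin

text \<open>Suppose that \<open>v - u\<close> has a positive maximum in \<open>\<Omega>\<close>.  A small quadratic term makes \<open>v\<close> a strict
  subsolution \<open>g\<close>.  Let \<open>V\<close> be a Lasry--Lions regularisation of \<open>g\<close>, which has a Lipschitz gradient, and let \<open>U\<close> be an
  inf-convolution of \<open>u\<close>, both with parameter \<open>\<alpha>\<close>.  Where \<open>V - U - p \<bullet> x\<close> is maximal, \<open>p\<close> is a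
  Lipschitz function of \<open>x\<close>; as \<open>p\<close> fills a ball, Rademacher's theorem provides a maximum point \<open>x\<close>
  where \<open>V\<close> has a second-order expansion with some Hessian \<open>A\<close>.  This one expansion tests \<open>u\<close> with
  Hessian \<open>A\<close> at a point \<open>z'\<close>, and \<open>g\<close> with Hessian at most \<open>A - A\<^sup>2 / (6 \<alpha>)\<close> at a point \<open>z\<close>.
  Since \<open>A\<close> is of size \<open>\<alpha>\<close> and \<open>a'(s) = 1 / (1 + |s|)\<close>, the left-hand sides of the equation differ by at
  least \<open>c / \<surd>\<alpha>\<close>: eigenvalues up to \<open>\<surd>\<alpha>\<close> in modulus gain from the strictness, larger ones from the
  quadratic term.  But \<open>|f z - f z'| \<le> L |z - z'| = o(1 / \<surd>\<alpha>)\<close>.\<close>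

section \<open>Diagonalisation of symmetric matrices\<close>

text \<open>\<open>a'\<close> decays like 1 / |s|, while Hessians at parameter \<alpha> reach size
  \<alpha>, so a strictness \<eta> alone would gain only about \<eta> / \<alpha>. The penalty yields
  \<alpha> |z - z'|^2 -> 0 and no more, which leaves an error of o(1 / sqrt \<alpha>) in
  \<open>f\<close>. A bare ordering of the two Hessians is therefore too weak, and the term
  \<open>A\<^sup>2 / (6 \<alpha>)\<close> has to survive. The gains \<eta> / |s| and |s| / \<alpha>
  balance at |s| = sqrt \<alpha>, exactly the scale of that error.

  A sup-convolution is only semiconvex, and its second-order expansion would require Alexandrov's
  theorem; a further inf-convolution gives a Lipschitz gradient, for which Rademacher's theorem
  suffices. The two openings are \<alpha> and 3 \<alpha>. Since 1 / \<alpha> - 1 / (3 \<alpha>) = 1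
  / (3/2 \<alpha>), \<open>V\<close> dominates the sup-convolution of \<open>g\<close> with opening
  3/2 \<alpha>, and it equals that sup-convolution at contact points provided \<open>u\<close> is
  regularised with the same opening.\<close>

lemma selfadjoint_eigenvector_exists:
  fixes T :: "'a::euclidean_space \<Rightarrow> 'a"
  assumes "linear T" and sa: "\<And>x y. T x \<bullet> y = x \<bullet> T y"
    and S: "subspace S" "\<And>x. x \<in> S \<Longrightarrow> T x \<in> S" "y \<in> S" "y \<noteq> 0"
  shows "\<exists>b\<in>S. norm b = 1 \<and> (\<exists>m. T b = m *\<^sub>R b)"
proof -
  let ?K = "sphere 0 1 \<inter> S"
  have "compact ?K" by (intro compact_Int_closed closed_subspace S) auto
  moreover have "(1 / norm y) *\<^sub>R y \<in> ?K" using S by (auto intro: subspace_scale)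
  then have "?K \<noteq> {}" by blast
  moreover have "continuous_on ?K (\<lambda>x. T x \<bullet> x)"
    by (intro continuous_intros linear_continuous_on linear_conv_bounded_linear[THEN iffD1] assms)
  ultimately have "\<exists>b\<in>?K. \<forall>x\<in>?K. T x \<bullet> x \<le> T b \<bullet> b"
    by (rule continuous_attains_sup)
  then obtain b where b: "b \<in> ?K" "\<And>x. x \<in> ?K \<Longrightarrow> T x \<bullet> x \<le> T b \<bullet> b" by blast
  define m where "m = T b \<bullet> b"
  \<comment> \<open>On \<open>S\<close> this form is nonnegative and it vanishes at
    \<open>b\<close>; its gradient there is 2 \<open>r\<close>, which therefore has to be 0.\<close>
  define Q where "Q x = m * (x \<bullet> x) - T x \<bullet> x" for x
  have bb: "b \<in> S" "norm b = 1" using b by auto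
  have Q0: "Q x \<ge> 0" if "x \<in> S" for x
  proof (cases "x = 0")
    case True
    then show ?thesis by (simp add: Q_def)
  next
    case False
    let ?x = "(1 / norm x) *\<^sub>R x"
    have "?x \<in> ?K" using that False S by (auto intro: subspace_scale)
    from b(2)[OF this] have "(T x \<bullet> x) / (norm x)\<^sup>2 \<le> m"
      by (simp add: m_def linear_cmul[OF \<open>linear T\<close>] power2_eq_square)
    then show ?thesis using False by (simp add: Q_def field_simps dot_square_norm)
  qed
  define r where "r = m *\<^sub>R b - T b"
  have rS: "r \<in> S" unfolding r_def using bb S by (intro subspace_diff subspace_scale) auto
  have Qb: "Q b = 0" using bb by (simp add: Q_def m_def dot_square_norm)
  have exp: "Q (b + t *\<^sub>R r) = 2 * t * (r \<bullet> r) + t\<^sup>2 * Q r" for t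
  proof -
    have "Q (b + t *\<^sub>R r) = Q b + 2 * t * (m * (b \<bullet> r) - T b \<bullet> r) + t\<^sup>2 * Q r"
      using sa[of r b] by (simp add: Q_def linear_add[OF \<open>linear T\<close>] linear_cmul[OF \<open>linear T\<close>] inner_add
          algebra_simps power2_eq_square inner_commute[of b r] inner_commute[of "T b" r])
    also have "m * (b \<bullet> r) - T b \<bullet> r = r \<bullet> r" by (simp add: r_def inner_diff_left)
    finally show ?thesis using Qb by simp
  qed
  have "r = 0"
  proof (rule ccontr)
    assume "r \<noteq> 0"
    then have rr: "r \<bullet> r > 0" by simp
    \<comment> \<open>For negative \<open>t\<close> the linear term decreases \<open>Q\<close>, and
      |t| \<open>Q r\<close> \<le> |r|^2 prevents the quadratic term from making up for it. The 1
      guards against \<open>Q r\<close> = 0.\<close>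
    define t where "t = - (r \<bullet> r) / (Q r + 1)"
    have Qr: "Q r \<ge> 0" by (rule Q0[OF rS])
    have "b + t *\<^sub>R r \<in> S" using bb rS S by (intro subspace_add subspace_scale) auto
    then have "0 \<le> Q (b + t *\<^sub>R r)" by (rule Q0)
    then have "0 \<le> t * (2 * (r \<bullet> r) + t * Q r)"
      by (simp add: exp algebra_simps power2_eq_square)
    moreover have "t < 0" using rr Qr by (simp add: t_def divide_neg_pos)
    moreover have "t * Q r \<ge> - (r \<bullet> r)" using rr Qr by (simp add: t_def field_simps)
    ultimately show False using rr by (smt (verit) mult_neg_pos)
  qed
  then have "T b = m *\<^sub>R b" by (simp add: r_def)
  then show ?thesis using bb by blast
qed

text \<open>The index type is the coordinate type \<open>'n\<close>, so the number of vectors equals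
  the dimension and spanning is automatic.\<close>

definition orthonormal_frame :: "('n \<Rightarrow> real ^ 'n) \<Rightarrow> bool" where
  "orthonormal_frame b \<longleftrightarrow> (\<forall>i j. b i \<bullet> b j = (if i = j then 1 else 0))"

lemma orthonormal_frame_expand:
  fixes b :: "'n \<Rightarrow> real ^ 'n"
  assumes "orthonormal_frame b"
  shows "(\<Sum>i\<in>UNIV. (h \<bullet> b i) *\<^sub>R b i) = h"
proof -
  have b: "b i \<bullet> b j = (if i = j then 1 else 0)" for i j using assms by (simp add: orthonormal_frame_def)
  have inj: "inj b" by (rule injI) (metis b zero_neq_one)
  have nrm: "norm (b i) = 1" for i using b[of i i] by (simp add: norm_eq_1)
  have ort: "pairwise orthogonal (range b)"
    by (auto simp: pairwise_def orthogonal_def b)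
  have "independent (range b)"
    by (rule pairwise_orthogonal_independent[OF ort]) (use nrm in \<open>metis imageE norm_zero zero_neq_one\<close>)
  moreover have "card (range b) = DIM(real ^ 'n)" using card_image[OF inj] by simp
  ultimately have "span (range b) = UNIV"
    using card_ge_dim_independent[of "range b" UNIV] by auto
  then have "(\<Sum>v\<in>range b. (h \<bullet> v) *\<^sub>R v) = h"
    by (intro orthonormal_basis_expand[OF ort]) (use nrm in auto)
  then show ?thesis using sum.reindex[OF inj, of "\<lambda>v. (h \<bullet> v) *\<^sub>R v"] by simp
qed

lemma orthonormal_frame_inner:
  fixes b :: "'n \<Rightarrow> real ^ 'n"
  assumes "orthonormal_frame b"
  shows "h \<bullet> k = (\<Sum>i\<in>UNIV. (h \<bullet> b i) * (k \<bullet> b i))"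
proof -
  have "h \<bullet> k = h \<bullet> (\<Sum>i\<in>UNIV. (k \<bullet> b i) *\<^sub>R b i)" by (simp add: orthonormal_frame_expand[OF assms])
  then show ?thesis by (simp add: inner_sum_right mult.commute)
qed

text \<open>An orthonormal set of eigenvectors of maximal cardinality must span: its orthogonal
  complement is invariant under \<open>T\<close>, and if nonzero would contain one more
  eigenvector.\<close>

theorem selfadjoint_orthonormal_eigenframe:
  fixes T :: "real ^ 'n \<Rightarrow> real ^ 'n"
  assumes T: "linear T" and sa: "\<And>x y. T x \<bullet> y = x \<bullet> T y"
  obtains b s where "orthonormal_frame b" "\<And>i. T (b i) = s i *\<^sub>R b i"
proof -
  define P where "P B \<longleftrightarrow> pairwise orthogonal B \<and> (\<forall>b\<in>B. norm b = 1 \<and> (\<exists>m. T b = m *\<^sub>R b))" for B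
  have indep: "independent B" if "P B" for B
    by (rule pairwise_orthogonal_independent) (use that in \<open>auto simp: P_def\<close>)
  have bd: "card B < DIM(real ^ 'n) + 1" if "P B" for B
    using independent_bound_general[OF indep[OF that]] dim_subset_UNIV[of B] by simp
  have "P {}" by (simp add: P_def)
  then obtain B where B: "P B" "\<And>C. P C \<Longrightarrow> card C \<le> card B"
    using ex_has_greatest_nat[of P "{}" card "DIM(real ^ 'n) + 1"] bd by (metis less_imp_le)
  have fin: "finite B" using independent_bound_general[OF indep[OF B(1)]] by simp
  have spanB: "span B = UNIV"
  proof (rule ccontr)
    assume "span B \<noteq> UNIV"
    then obtain a where a: "a \<noteq> 0" "\<forall>x\<in>span B. a \<bullet> x = 0" using span_not_UNIV_orthogonal by blast
    define S where "S = {y. \<forall>b\<in>B. y \<bullet> b = 0}"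
    have "\<exists>e\<in>S. norm e = 1 \<and> (\<exists>m. T e = m *\<^sub>R e)"
    proof (rule selfadjoint_eigenvector_exists[OF T sa])
      show "subspace S" by (auto simp: S_def subspace_def inner_add_left)
      show "T x \<in> S" if "x \<in> S" for x
        unfolding S_def
      proof (clarify)
        fix b assume "b \<in> B"
        then obtain m where "T b = m *\<^sub>R b" using B(1) by (auto simp: P_def)
        then show "T x \<bullet> b = 0" using that \<open>b \<in> B\<close> by (simp add: sa S_def)
      qed
      show "a \<in> S" using a(2) span_base by (auto simp: S_def)
    qed fact
    then obtain e where e: "e \<in> S" "norm e = 1" "\<exists>m. T e = m *\<^sub>R e" by blast
    have "e \<notin> B" using e by (auto simp: S_def)
    moreover have "P (insert e B)"
      using B(1) e by (auto simp: P_def pairwise_insert S_def orthogonal_def inner_commute)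
    ultimately show False using B(2)[of "insert e B"] fin by simp
  qed
  have "card B = CARD('n)"
    using dim_eq_card_independent[OF indep[OF B(1)]] spanB dim_span[of B] by simp
  then obtain b where b: "bij_betw b (UNIV :: 'n set) B"
    using finite_same_card_bij[of "UNIV :: 'n set" B] fin by auto
  then have bB: "b i \<in> B" for i by (auto simp: bij_betw_def)
  have "orthonormal_frame b"
    unfolding orthonormal_frame_def
  proof (intro allI)
    fix i j
    show "b i \<bullet> b j = (if i = j then 1 else 0)"
    proof (cases "i = j")
      case True
      then show ?thesis using B(1) bB[of j] by (auto simp: P_def norm_eq_1)
    next
      case False
      then have "b i \<noteq> b j" using b by (auto simp: bij_betw_def inj_def)
      then show ?thesis using B(1) bB False by (auto simp: P_def pairwise_def orthogonal_def)
    qed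
  qed
  moreover have "\<exists>m. T (b i) = m *\<^sub>R b i" for i using B(1) bB[of i] by (auto simp: P_def)
  then obtain s where "\<And>i. T (b i) = s i *\<^sub>R b i" by metis
  ultimately show thesis using that by blast
qed

section \<open>Matrices with a prescribed eigenframe, and their quadratic functions\<close>

definition frame_matrix :: "('n \<Rightarrow> real ^ 'n) \<Rightarrow> ('n \<Rightarrow> real) \<Rightarrow> real ^ 'n ^ 'n" where
  "frame_matrix b d = (\<chi> j k. \<Sum>i\<in>UNIV. d i * (b i $ j * b i $ k))"

text \<open>With the frame vectors as the rows of \<open>Q\<close>, the matrix t I - X factors over
  the polynomial ring as the transpose of \<open>Q\<close>, times a diagonal \<open>D\<close>, times
  \<open>Q\<close>. Orthonormality cancels the outer factors in the determinant.\<close>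

lemma charpoly_frame_matrix:
  fixes b :: "'n \<Rightarrow> real ^ 'n"
  assumes "orthonormal_frame b"
  shows "charpoly (frame_matrix b d) = (\<Prod>i\<in>UNIV. [:- d i, 1:])"
proof -
  define Q :: "real poly ^ 'n ^ 'n" where "Q = (\<chi> i j. [:vec_nth (b i) j:])"
  define D :: "real poly ^ 'n ^ 'n" where "D = (\<chi> i j. if i = j then [:- d i, 1:] else 0)"
  have const_sum: "(\<Sum>i\<in>A. [:f i:]) = [:\<Sum>i\<in>A. f i:]" for A and f :: "'n \<Rightarrow> real"
    by (induction A rule: infinite_finite_induct) auto
  have row: "(\<Sum>j\<in>UNIV. b i $ j * b l $ j) = (if i = l then 1 else 0)" for i l
    using assms unfolding orthonormal_frame_def inner_vec_def by simp
  \<comment> \<open>Orthonormal rows are the hypothesis; orthonormal columns come from expanding a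
    coordinate vector in the frame.\<close>
  have col: "(\<Sum>i\<in>UNIV. b i $ j * b i $ k) = (if j = k then 1 else 0)" for j k
  proof -
    have "(\<Sum>i\<in>UNIV. (axis k 1 \<bullet> b i) *\<^sub>R b i) $ j = axis k 1 $ j"
      by (simp add: orthonormal_frame_expand[OF assms])
    then have "(\<Sum>i\<in>UNIV. b i $ j * b i $ k) = axis k 1 $ j"
      by (simp add: inner_axis' mult.commute)
    then show ?thesis by (auto simp: axis_def)
  qed
  have QQ: "Q ** Finite_Cartesian_Product.transpose Q = mat 1"
    by (simp add: vec_eq_iff matrix_matrix_mult_def Finite_Cartesian_Product.transpose_def Q_def mat_def const_sum row one_pCons)
  have entry: "(Finite_Cartesian_Product.transpose Q ** (D ** Q)) $ j $ k =
       (if j = k then [:0, 1:] else 0) - [:vec_nth (vec_nth (frame_matrix b d) j) k:]" for j k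
  proof -
    have "(D ** Q) $ i $ k = [:- d i, 1:] * [:vec_nth (b i) k:]" for i
    proof -
      have "(D ** Q) $ i $ k = (\<Sum>l\<in>UNIV. if i = l then [:- d i, 1:] * [:vec_nth (b i) k:] else 0)"
        unfolding matrix_matrix_mult_def by (simp only: D_def Q_def vec_lambda_beta, rule sum.cong) auto
      then show ?thesis by simp
    qed
    moreover have "(Finite_Cartesian_Product.transpose Q ** (D ** Q)) $ j $ k =
        (\<Sum>i\<in>UNIV. Finite_Cartesian_Product.transpose Q $ j $ i * (D ** Q) $ i $ k)"
      unfolding matrix_matrix_mult_def by simp
    moreover have "Finite_Cartesian_Product.transpose Q $ j $ i = [:vec_nth (b i) j:]" for i
      by (simp add: Finite_Cartesian_Product.transpose_def Q_def)
    ultimately have "(Finite_Cartesian_Product.transpose Q ** (D ** Q)) $ j $ k =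
      (\<Sum>i\<in>UNIV. [:vec_nth (b i) j:] * ([:- d i, 1:] * [:vec_nth (b i) k:]))"
      by simp
    also have "\<dots> = (\<Sum>i\<in>UNIV. [:0, 1:] * [:b i $ j * b i $ k:] - [:d i * (b i $ j * b i $ k):])"
      by (rule sum.cong) (auto simp: mult_ac)
    also have "\<dots> = [:0, 1:] * [:\<Sum>i\<in>UNIV. b i $ j * b i $ k:] - [:\<Sum>i\<in>UNIV. d i * (b i $ j * b i $ k):]"
      by (simp only: sum_subtractf const_sum flip: sum_distrib_left)
    also have "\<dots> = (if j = k then [:0, 1:] else 0) - [:vec_nth (vec_nth (frame_matrix b d) j) k:]"
      by (simp add: col frame_matrix_def)
    finally show ?thesis .
  qed
  have "charpoly (frame_matrix b d) = det (Finite_Cartesian_Product.transpose Q ** (D ** Q))"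
    unfolding charpoly_def
    by (rule arg_cong[where f = det]) (simp only: vec_eq_iff vec_lambda_beta entry, simp)
  also have "\<dots> = det (Q ** Finite_Cartesian_Product.transpose Q) * det D"
    by (simp add: det_mul mult_ac)
  also have "\<dots> = det D" by (simp add: QQ)
  also have "\<dots> = (\<Prod>i\<in>UNIV. [:- d i, 1:])"
    by (subst det_diagonal) (auto simp: D_def)
  finally show ?thesis .
qed

text \<open>Sorting is irrelevant to a symmetric sum: the sorted list of roots and the family
  \<open>d\<close> have the same multiset. The equation can thus be evaluated on eigenvalues in any
  order.\<close>

lemma sum_eigval_frame_matrix:
  fixes b :: "'n \<Rightarrow> real ^ 'n" and a :: "real \<Rightarrow> real"
  assumes "orthonormal_frame b"
  shows "(\<Sum>k = 1..CARD('n). a (eigval k (frame_matrix b d))) = (\<Sum>i\<in>UNIV. a (d i))"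
proof -
  define M where "M = image_mset d (mset_set (UNIV :: 'n set))"
  define xs where "xs = sorted_list_of_multiset M"
  have "proots (charpoly (frame_matrix b d)) = (\<Sum>i\<in>UNIV. proots [:- d i, 1:])"
    unfolding charpoly_frame_matrix[OF assms] by (rule proots_prod) simp
  also have "\<dots> = (\<Sum>i\<in>UNIV. {#d i#})" by simp
  also have "\<dots> = M" unfolding M_def by (simp add: sum_unfold_sum_mset)
  finally have ev: "eigval k (frame_matrix b d) = xs ! (k - 1)" for k
    by (simp add: eigval_def xs_def)
  have ms: "mset xs = M" by (simp add: xs_def)
  then have len: "length xs = CARD('n)" by (metis M_def size_image_mset size_mset size_mset_set)
  have "(\<Sum>k = 1..CARD('n). a (eigval k (frame_matrix b d))) = (\<Sum>k<CARD('n). a (xs ! k))"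
    unfolding ev by (rule sum.reindex_bij_witness[of _ Suc "\<lambda>k. k - 1"]) auto
  also have "\<dots> = sum_list (map a xs)" by (simp add: sum_list_sum_nth len atLeast0LessThan)
  also have "\<dots> = \<Sum>\<^sub># (image_mset a M)" by (metis ms mset_map sum_mset_sum_list)
  also have "\<dots> = (\<Sum>i\<in>UNIV. a (d i))" by (simp add: M_def sum_unfold_sum_mset image_mset.compositionality o_def)
  finally show ?thesis .
qed

text \<open>All test functions of the proof have this form: value \<open>c\<close> and gradient
  \<open>l\<close> at \<open>z\<close>, Hessian \<open>frame_matrix b d\<close>.\<close>

definition frame_quadratic ::
    "real \<Rightarrow> real ^ 'n \<Rightarrow> ('n \<Rightarrow> real ^ 'n) \<Rightarrow> ('n \<Rightarrow> real) \<Rightarrow> real ^ 'n \<Rightarrow> real ^ 'n \<Rightarrow> real" where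
  "frame_quadratic c l b d z y = c + l \<bullet> (y - z) + (\<Sum>i\<in>UNIV. d i * ((y - z) \<bullet> b i)\<^sup>2) / 2"

lemma frame_quadratic_derivative:
  "(frame_quadratic c l b d z has_derivative
     (\<lambda>h. l \<bullet> h + (\<Sum>i\<in>UNIV. d i * ((y - z) \<bullet> b i) * (h \<bullet> b i)))) (at y)"
  unfolding frame_quadratic_def[abs_def]
  by (rule derivative_eq_intros refl | simp)+
    (auto simp: fun_eq_iff sum_divide_distrib intro!: sum.cong)

lemma partial_derivative_eqI: "(\<phi> has_derivative D) (at x) \<Longrightarrow> partial_derivative j \<phi> x = D (axis j 1)"
  unfolding partial_derivative_def using frechet_derivative_at by metis

lemma partial_derivative_frame_quadratic:
  "partial_derivative j (frame_quadratic c l b d z) = (\<lambda>y. l $ j + (\<Sum>i\<in>UNIV. d i * ((y - z) \<bullet> b i) * b i $ j))"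
  by (rule ext) (subst partial_derivative_eqI[OF frame_quadratic_derivative], simp add: inner_axis inner_axis')

lemma partial_derivative_frame_quadratic_derivative:
  "(partial_derivative j (frame_quadratic c l b d z) has_derivative
      (\<lambda>h. \<Sum>i\<in>UNIV. d i * (h \<bullet> b i) * b i $ j)) (at y)"
  unfolding partial_derivative_frame_quadratic
  by (rule derivative_eq_intros refl | simp)+

lemma partial_derivative2_frame_quadratic:
  "partial_derivative k (partial_derivative j (frame_quadratic c l b d z)) = (\<lambda>y. \<Sum>i\<in>UNIV. d i * (b i $ k * b i $ j))"
  by (rule ext)
    (subst partial_derivative_eqI[OF partial_derivative_frame_quadratic_derivative], simp add: inner_axis' mult.assoc)

lemma C2_near_frame_quadratic: "C2_near x (frame_quadratic c l b d z)"
  unfolding C2_near_def C2_on_def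
proof (intro exI[of _ UNIV] conjI ballI allI)
  show "frame_quadratic c l b d z differentiable (at y)" for y
    using frame_quadratic_derivative by (rule differentiableI)
  show "partial_derivative j (frame_quadratic c l b d z) differentiable (at y)" for j y
    using partial_derivative_frame_quadratic_derivative by (rule differentiableI)
  show "continuous_on UNIV (partial_derivative k (partial_derivative j (frame_quadratic c l b d z)))" for k j
    unfolding partial_derivative2_frame_quadratic by (rule continuous_on_const)
qed auto

lemma hessian_frame_quadratic: "hessian (frame_quadratic c l b d z) x = frame_matrix b d"
  by (simp add: hessian_def frame_matrix_def partial_derivative2_frame_quadratic)

lemma F_eq_frame_quadratic:
  assumes "orthonormal_frame b"
  shows "F_eq f (hessian (frame_quadratic c l b d z) x) y = (\<Sum>i\<in>UNIV. a_fun (d i)) - f y"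
  by (simp only: F_eq_def hessian_frame_quadratic sum_eigval_frame_matrix[OF assms])

section \<open>Differentiability of Lipschitz functions along lines\<close>

lemma emeasure_disjoint_Union_le:
  assumes "countable C" "disjoint_family_on I C"
    and "\<And>i. i \<in> C \<Longrightarrow> I i \<in> sets M" "\<And>i. i \<in> C \<Longrightarrow> I i \<in> sets N"
    and le: "\<And>i. i \<in> C \<Longrightarrow> c * emeasure M (I i) \<le> d * emeasure N (I i)"
  shows "c * emeasure M (\<Union>i\<in>C. I i) \<le> d * emeasure N (\<Union>i\<in>C. I i)"
proof -
  have "c * emeasure M (\<Union>i\<in>C. I i) = (\<integral>\<^sup>+i. c * emeasure M (I i) \<partial>count_space C)"
    using assms by (subst emeasure_UN_countable) (auto simp: nn_integral_cmult)
  also have "\<dots> \<le> (\<integral>\<^sup>+i. d * emeasure N (I i) \<partial>count_space C)"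
    by (intro nn_integral_mono) (use le in auto)
  also have "\<dots> = d * emeasure N (\<Union>i\<in>C. I i)"
    using assms by (subst emeasure_UN_countable) (auto simp: nn_integral_cmult)
  finally show ?thesis .
qed

lemma Vitali_covering_intervals:
  fixes E U :: "real set" and P :: "real \<Rightarrow> real \<Rightarrow> bool"
  assumes "open U" "E \<subseteq> U"
    and fine: "\<And>x d. x \<in> E \<Longrightarrow> d > 0 \<Longrightarrow> \<exists>a b. a < b \<and> a \<le> x \<and> x \<le> b \<and> b - a < d \<and> P a b"
  obtains C where "countable C" "\<And>a b. (a, b) \<in> C \<Longrightarrow> a < b \<and> {a..b} \<subseteq> U \<and> P a b"
    "disjoint_family_on (\<lambda>i. {fst i..snd i}) C" "negligible (E - (\<Union>i\<in>C. {fst i..snd i}))"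
proof -
  define K where "K = {i. fst i < snd i \<and> {fst i..snd i} \<subseteq> U \<and> P (fst i) (snd i)}"
  define c where "c = (\<lambda>i::real \<times> real. (fst i + snd i) / 2)"
  define r where "r = (\<lambda>i::real \<times> real. (snd i - fst i) / 2)"
  have cb: "cball (c i) (r i) = {fst i..snd i}" for i
    by (auto simp: c_def r_def cball_eq_atLeastAtMost field_simps)
  have r: "i \<in> K \<Longrightarrow> 0 < r i" for i by (auto simp: K_def r_def)
  have *: "\<exists>i. i \<in> K \<and> x \<in> cball (c i) (r i) \<and> r i < d" if "x \<in> E" "0 < d" for x d
  proof -
    have "x \<in> U" using that assms by auto
    then obtain e where e: "e > 0" "ball x e \<subseteq> U" using \<open>open U\<close> open_contains_ball by blast
    obtain a b where ab: "a < b" "a \<le> x" "x \<le> b" "b - a < min d e" "P a b"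
      using fine[OF \<open>x \<in> E\<close>, of "min d e"] \<open>0 < d\<close> e by auto
    have "{a..b} \<subseteq> ball x e" using ab by (auto simp: dist_real_def)
    then have "(a, b) \<in> K" using ab e by (auto simp: K_def)
    moreover have "r (a, b) < d" using ab by (auto simp: r_def)
    moreover have "x \<in> cball (c (a, b)) (r (a, b))" using ab unfolding cb by auto
    ultimately show ?thesis by blast
  qed
  obtain C where C: "countable C" "C \<subseteq> K"
     "pairwise (\<lambda>i j. disjnt (cball (c i) (r i)) (cball (c j) (r j))) C"
     "negligible(E - (\<Union>i \<in> C. cball (c i) (r i)))"
    using Vitali_covering_theorem_cballs[of K r E c, OF r *] by blast
  show thesis
  proof (rule that[of C])
    show "a < b \<and> {a..b} \<subseteq> U \<and> P a b" if "(a, b) \<in> C" for a b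
      using C(2) that unfolding K_def by (metis (mono_tags, lifting) fst_conv mem_Collect_eq snd_conv subsetD)
    show "disjoint_family_on (\<lambda>i. {fst i..snd i}) C"
      using C(3) unfolding cb by (auto simp: disjoint_family_on_def pairwise_def disjnt_def)
    show "negligible (E - (\<Union>i\<in>C. {fst i..snd i}))" using C(4) unfolding cb .
  qed (rule C(1))
qed

text \<open>For \<open>p < q\<close> these are points where the directional derivative fails to
  exist. For bounded quotients, countably many rational pairs detect every failure, so it is enough
  to treat one pair at a time.\<close>

definition oscillation_set :: "('a::real_normed_vector \<Rightarrow> real) \<Rightarrow> 'a \<Rightarrow> real \<Rightarrow> real \<Rightarrow> 'a set" where
  "oscillation_set g u p q =
     {x. (\<exists>\<^sub>F h in at 0. (g (x + h *\<^sub>R u) - g x) / h < p) \<and>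
         (\<exists>\<^sub>F h in at 0. (g (x + h *\<^sub>R u) - g x) / h > q)}"

lemma frequently_at_0_iff:
  fixes P :: "real \<Rightarrow> bool"
  shows "(\<exists>\<^sub>F h in at 0. P h) \<longleftrightarrow> (\<forall>n::nat. \<exists>h. h \<noteq> 0 \<and> \<bar>h\<bar> < 1 / Suc n \<and> P h)"
proof
  assume *: "\<exists>\<^sub>F h in at 0. P h"
  show "\<forall>n::nat. \<exists>h. h \<noteq> 0 \<and> \<bar>h\<bar> < 1 / Suc n \<and> P h"
  proof (rule ccontr)
    assume "\<not> ?thesis"
    then obtain n :: nat where n: "\<And>h. h \<noteq> 0 \<Longrightarrow> \<bar>h\<bar> < 1 / Suc n \<Longrightarrow> \<not> P h" by blast
    have "\<forall>\<^sub>F h in at 0. \<not> P h"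
      unfolding eventually_at using n by (intro exI[of _ "1 / Suc n"]) (auto simp: dist_real_def)
    with * show False by (simp add: frequently_def)
  qed
next
  assume *: "\<forall>n::nat. \<exists>h. h \<noteq> 0 \<and> \<bar>h\<bar> < 1 / Suc n \<and> P h"
  show "\<exists>\<^sub>F h in at 0. P h"
    unfolding frequently_def eventually_at
  proof
    assume "\<exists>d>0. \<forall>h\<in>UNIV. h \<noteq> 0 \<and> dist h 0 < d \<longrightarrow> \<not> P h"
    then obtain d where d: "d > 0" "\<And>h. h \<noteq> 0 \<Longrightarrow> \<bar>h\<bar> < d \<Longrightarrow> \<not> P h"
      by (auto simp: dist_real_def)
    obtain n :: nat where "1 / Suc n < d" using d(1) by (metis nat_approx_posE)
    then show False using * d(2) by (meson order.strict_trans)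
  qed
qed

text \<open>With radii 1 / (n + 1) the set is a countable intersection of open sets; the unions over
  uncountably many \<open>h\<close> are harmless, since each member is open.\<close>

lemma oscillation_set_borel:
  fixes g :: "'a::real_normed_vector \<Rightarrow> real"
  assumes "continuous_on UNIV g"
  shows "oscillation_set g u p q \<in> sets borel"
proof -
  define A where "A h = {x. (g (x + h *\<^sub>R u) - g x) / h < p}" for h
  define B where "B h = {x. (g (x + h *\<^sub>R u) - g x) / h > q}" for h
  have ct: "continuous_on UNIV (\<lambda>x. (g (x + h *\<^sub>R u) - g x) / h)" if "h \<noteq> 0" for h
    by (intro continuous_intros continuous_on_compose2[OF assms]) (use that in auto)
  have "open (A h)" "open (B h)" if "h \<noteq> 0" for h
    unfolding A_def B_def by (intro open_Collect_less ct that continuous_intros)+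
  then have "open (\<Union>h\<in>{h. h \<noteq> 0 \<and> \<bar>h\<bar> < 1 / Suc n}. A h)" "open (\<Union>h\<in>{h. h \<noteq> 0 \<and> \<bar>h\<bar> < 1 / Suc n}. B h)" for n
    by auto
  then have "(\<Inter>n. \<Union>h\<in>{h. h \<noteq> 0 \<and> \<bar>h\<bar> < 1 / Suc n}. A h) \<inter> (\<Inter>n. \<Union>h\<in>{h. h \<noteq> 0 \<and> \<bar>h\<bar> < 1 / Suc n}. B h) \<in> sets borel"
    by auto
  also have "(\<Inter>n. \<Union>h\<in>{h. h \<noteq> 0 \<and> \<bar>h\<bar> < 1 / Suc n}. A h) \<inter> (\<Inter>n. \<Union>h\<in>{h. h \<noteq> 0 \<and> \<bar>h\<bar> < 1 / Suc n}. B h)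
      = oscillation_set g u p q"
    unfolding oscillation_set_def frequently_at_0_iff A_def B_def by auto
  finally show ?thesis .
qed

lemma frequently_slope_interval:
  fixes g :: "real \<Rightarrow> real"
  assumes fr: "\<exists>\<^sub>F h in at 0. P ((g (x + h) - g x) / h)" and "d > 0"
  shows "\<exists>a b. a < b \<and> a \<le> x \<and> x \<le> b \<and> b - a < d \<and> P ((g b - g a) / (b - a))"
proof -
  have "\<forall>\<^sub>F h in at 0. h \<noteq> 0 \<and> \<bar>h\<bar> < d"
    unfolding eventually_at using \<open>d > 0\<close> by (intro exI[of _ d]) (auto simp: dist_real_def)
  with fr have "\<exists>\<^sub>F h in at 0. P ((g (x + h) - g x) / h) \<and> h \<noteq> 0 \<and> \<bar>h\<bar> < d"
    using frequently_eventually_frequently by fastforce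
  then obtain h where h: "P ((g (x + h) - g x) / h)" "h \<noteq> 0" "\<bar>h\<bar> < d"
    using frequently_ex by blast
  show ?thesis
  proof (cases "h > 0")
    case True
    then show ?thesis using h by (intro exI[of _ x] exI[of _ "x + h"]) auto
  next
    case False
    have "(g x - g (x + h)) / (x - (x + h)) = (g (x + h) - g x) / h"
      using h(2) by (simp add: field_simps)
    then show ?thesis using h False by (intro exI[of _ "x + h"] exI[of _ x]) auto
  qed
qed

text \<open>Vitali's theorem is used twice: the intervals of slope above \<open>q\<close> are taken inside the
  intervals of slope below \<open>p\<close>, and the Stieltjes measure of \<open>g\<close> compares the two families.\<close>
lemma negligible_oscillation_set_mono:
  fixes g :: "real \<Rightarrow> real"
  assumes mono: "\<And>x y. x \<le> y \<Longrightarrow> g x \<le> g y" and cont: "continuous_on UNIV g" and pq: "p < q" "0 \<le> p"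
  shows "negligible (oscillation_set g 1 p q \<inter> {a..b})"
proof -
  define E where "E = oscillation_set g 1 p q \<inter> {a..b}"
  have Eb: "E \<in> sets borel" unfolding E_def using oscillation_set_borel[OF cont] by auto
  have Efin: "emeasure lebesgue E < \<infinity>"
  proof -
    have "emeasure lebesgue E \<le> emeasure lebesgue {a..b}" by (rule emeasure_mono) (auto simp: E_def)
    also have "\<dots> < \<infinity>" by (simp add: emeasure_lborel_Icc_eq)
    finally show ?thesis .
  qed
  have Elm: "E \<in> lmeasurable" using Eb Efin by (simp add: fmeasurable_def)
  define \<mu> where "\<mu> = interval_measure g"
  have sets_\<mu>: "sets \<mu> = sets borel" by (simp add: \<mu>_def)
  have \<mu>I: "emeasure \<mu> {a..b} = ennreal (g b - g a)" if "a \<le> b" for a b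
    unfolding \<mu>_def using that mono cont by (rule emeasure_interval_measure_Icc)
  \<comment> \<open>With \<mu> the Stieltjes measure, the chain is q |E| \<le> \<mu>(JD) \<le>
    \<mu>(JC) \<le> p |JC| \<le> p |U|. Shrinking \<open>U\<close> to \<open>E\<close> gives q |E|
    \<le> p |E| with |E| finite, hence |E| = 0.\<close>
  have key: "ennreal q * emeasure lborel E \<le> ennreal p * emeasure lborel U" if U: "open U" "E \<subseteq> U" for U
  proof -
    obtain C where C: "countable C" "\<And>a b. (a, b) \<in> C \<Longrightarrow> a < b \<and> {a..b} \<subseteq> U \<and> (g b - g a) / (b - a) < p"
      "disjoint_family_on (\<lambda>i. {fst i..snd i}) C" "negligible (E - (\<Union>i\<in>C. {fst i..snd i}))"
    proof (rule Vitali_covering_intervals[of U E "\<lambda>a b. (g b - g a) / (b - a) < p", OF U])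
      fix x d :: real assume "x \<in> E" "d > 0"
      then show "\<exists>a b. a < b \<and> a \<le> x \<and> x \<le> b \<and> b - a < d \<and> (g b - g a) / (b - a) < p"
        by (intro frequently_slope_interval) (auto simp: E_def oscillation_set_def)
    qed blast
    \<comment> \<open>Open intervals allow the second covering to stay inside the first; only
      countably many endpoints are lost.\<close>
    define W where "W = (\<Union>i\<in>C. {fst i<..<snd i})"
    have "open W" "E \<inter> W \<subseteq> W" by (auto simp: W_def)
    then obtain D where D: "countable D" "\<And>a b. (a, b) \<in> D \<Longrightarrow> a < b \<and> {a..b} \<subseteq> W \<and> (g b - g a) / (b - a) > q"
      "disjoint_family_on (\<lambda>i. {fst i..snd i}) D" "negligible (E \<inter> W - (\<Union>i\<in>D. {fst i..snd i}))"
    proof (rule Vitali_covering_intervals[of W "E \<inter> W" "\<lambda>a b. (g b - g a) / (b - a) > q"])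
      fix x d :: real assume "x \<in> E \<inter> W" "d > 0"
      then show "\<exists>a b. a < b \<and> a \<le> x \<and> x \<le> b \<and> b - a < d \<and> (g b - g a) / (b - a) > q"
        by (intro frequently_slope_interval) (auto simp: E_def oscillation_set_def)
    qed blast
    define JC where "JC = (\<Union>i\<in>C. {fst i..snd i})"
    define JD where "JD = (\<Union>i\<in>D. {fst i..snd i})"
    have JCb: "JC \<in> sets borel" and JDb: "JD \<in> sets borel"
      unfolding JC_def JD_def using C(1) D(1) by (auto intro!: sets.countable_UN')
    have "JD \<subseteq> W" unfolding JD_def using D(2) by fastforce
    moreover have "W \<subseteq> JC" by (auto simp: W_def JC_def)
    ultimately have DC: "JD \<subseteq> JC" by auto
    have JU: "JC \<subseteq> U" unfolding JC_def using C(2) by fastforce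
    have "JC - W \<subseteq> fst ` C \<union> snd ` C"
    proof
      fix x assume x: "x \<in> JC - W"
      then obtain i where i: "i \<in> C" "fst i \<le> x" "x \<le> snd i" by (auto simp: JC_def)
      moreover have "\<not> (fst i < x \<and> x < snd i)" using x i(1) by (auto simp: W_def)
      ultimately have "x = fst i \<or> x = snd i" by auto
      then show "x \<in> fst ` C \<union> snd ` C" using i(1) by auto
    qed
    then have "negligible (JC - W)"
      using C(1) by (intro negligible_subset[OF _ \<open>JC - W \<subseteq> _\<close>])
        (simp add: negligible_iff_null_sets null_sets_completionI countable_imp_null_set_lborel)
    then have "negligible ((E - JC) \<union> (JC - W) \<union> (E \<inter> W - JD))"
      using C(4) D(4) by (auto simp: JC_def JD_def)
    then have "negligible (E - JD)" by (rule negligible_subset) auto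
    then have ED: "emeasure lebesgue (E - JD) = 0"
      using negligible_iff_null_sets by blast
    have "emeasure lborel E = emeasure lebesgue E" using Eb by simp
    also have "\<dots> \<le> emeasure lebesgue (JD \<union> (E - JD))" using Eb JDb by (intro emeasure_mono) auto
    also have "\<dots> \<le> emeasure lebesgue JD + emeasure lebesgue (E - JD)"
      using Eb JDb by (intro emeasure_subadditive) auto
    also have "\<dots> = emeasure lborel JD" using ED JDb by simp
    finally have "ennreal q * emeasure lborel E \<le> ennreal q * emeasure lborel JD"
      by (rule mult_left_mono) auto
    also have "\<dots> \<le> 1 * emeasure \<mu> JD"
      unfolding JD_def
    proof (rule emeasure_disjoint_Union_le[OF D(1,3)])
      fix i assume "i \<in> D"
      then have *: "fst i < snd i" "(g (snd i) - g (fst i)) / (snd i - fst i) > q"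
        using D(2)[of "fst i" "snd i"] by auto
      then have "q * (snd i - fst i) \<le> g (snd i) - g (fst i)" by (simp add: field_simps)
      then show "ennreal q * emeasure lborel {fst i..snd i} \<le> 1 * emeasure \<mu> {fst i..snd i}"
        using * pq by (simp add: \<mu>I ennreal_mult[symmetric] ennreal_leI)
    qed (auto simp: sets_\<mu>)
    also have "\<dots> \<le> 1 * emeasure \<mu> JC"
      using DC JCb by (auto intro!: emeasure_mono simp: sets_\<mu>)
    also have "\<dots> \<le> ennreal p * emeasure lborel JC"
      unfolding JC_def
    proof (rule emeasure_disjoint_Union_le[OF C(1,3)])
      fix i assume "i \<in> C"
      then have *: "fst i < snd i" "(g (snd i) - g (fst i)) / (snd i - fst i) < p"
        using C(2)[of "fst i" "snd i"] by auto
      then have "g (snd i) - g (fst i) \<le> p * (snd i - fst i)" by (simp add: field_simps)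
      then show "1 * emeasure \<mu> {fst i..snd i} \<le> ennreal p * emeasure lborel {fst i..snd i}"
        using * pq by (simp add: \<mu>I ennreal_mult[symmetric] ennreal_leI)
    qed (auto simp: sets_\<mu>)
    also have "\<dots> \<le> ennreal p * emeasure lborel U"
      using JU U by (intro mult_left_mono emeasure_mono) auto
    finally show ?thesis .
  qed
  define m where "m = measure lebesgue E"
  have em: "emeasure lborel E = ennreal m"
  proof -
    have "emeasure lborel E = emeasure lebesgue E" using Eb by simp
    also have "\<dots> = ennreal m" using Elm by (simp add: emeasure_eq_measure2 m_def)
    finally show ?thesis .
  qed
  have "q * m \<le> p * (m + e)" if "e > 0" for e
  proof -
    obtain U where U: "open U" "E \<subseteq> U" "U \<in> lmeasurable" "measure lebesgue U < m + e"
    proof -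
      obtain U where U: "open U" "E \<subseteq> U" "U - E \<in> lmeasurable" "emeasure lebesgue (U - E) < ennreal e"
        using sets_lebesgue_outer_open[OF fmeasurableD[OF Elm] \<open>e > 0\<close>] by blast
      have eq: "U = E \<union> (U - E)" using U by auto
      then have "U \<in> lmeasurable" using Elm U(3) fmeasurable.Un by metis
      moreover have "measure lebesgue U \<le> m + measure lebesgue (U - E)"
        unfolding m_def using measure_Un_le[OF fmeasurableD[OF Elm] fmeasurableD[OF U(3)]] eq by simp
      moreover have "measure lebesgue (U - E) < e"
        using U(3,4) \<open>e > 0\<close> by (simp add: emeasure_eq_measure2 ennreal_less_iff)
      ultimately show thesis using U that by force
    qed
    have "emeasure lborel U = ennreal (measure lebesgue U)"
    proof -
      have "emeasure lborel U = emeasure lebesgue U" using U by simp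
      also have "\<dots> = ennreal (measure lebesgue U)" using U by (simp add: emeasure_eq_measure2)
      finally show ?thesis .
    qed
    with key[OF U(1,2)] have "ennreal (q * m) \<le> ennreal (p * measure lebesgue U)"
      using em pq by (simp add: ennreal_mult m_def)
    then have "q * m \<le> p * measure lebesgue U" using pq by (simp add: ennreal_le_iff)
    also have "\<dots> \<le> p * (m + e)" using U pq by (intro mult_left_mono) auto
    finally show ?thesis .
  qed
  then have "(q - p) * m \<le> 0 + e" if "e > 0" for e
  proof -
    \<comment> \<open>The divisor is \<open>p + 1\<close> because \<open>p\<close> may be 0.\<close>
    have "q * m \<le> p * (m + e / (p + 1))" using \<open>\<And>e. e > 0 \<Longrightarrow> q * m \<le> p * (m + e)\<close>[of "e / (p + 1)"] that pq by simp
    moreover have "p * (e / (p + 1)) \<le> e" using pq that by (simp add: field_simps)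
    ultimately show ?thesis by (simp add: algebra_simps)
  qed
  then have "(q - p) * m \<le> 0" by (rule field_le_epsilon)
  then have "m = 0" using pq measure_nonneg[of lebesgue E] by (auto simp: mult_le_0_iff m_def)
  then show ?thesis using Elm unfolding E_def m_def by (simp add: negligible_iff_measure0)
qed

text \<open>Adding \<open>L * x\<close> makes the function monotone and shifts every slope by
  \<open>L\<close>. If the shifted threshold \<open>p + L\<close> is negative the set is empty;
  otherwise the monotone case applies on each bounded interval.\<close>

lemma negligible_oscillation_set_real:
  fixes f :: "real \<Rightarrow> real"
  assumes L: "L-lipschitz_on UNIV f" and "p < q"
  shows "negligible (oscillation_set f 1 p q)"
proof -
  define g where "g x = f x + L * x" for x
  have mono: "g x \<le> g y" if "x \<le> y" for x y
    using lipschitz_onD[OF L, of x y] that by (simp add: g_def dist_real_def algebra_simps abs_le_iff)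
  have cont: "continuous_on UNIV g"
    unfolding g_def by (intro continuous_intros lipschitz_on_continuous_on[OF L])
  have slope: "(g (x + h) - g x) / h = (f (x + h) - f x) / h + L" if "h \<noteq> 0" for x h
    using that by (simp add: g_def field_simps)
  have sub: "oscillation_set f 1 p q \<subseteq> oscillation_set g 1 (p + L) (q + L)"
    unfolding oscillation_set_def
  proof (clarsimp, intro conjI)
    fix x
    have ev: "\<forall>\<^sub>F h in at 0. h \<noteq> (0::real)" by (simp add: eventually_at_filter)
    show "\<exists>\<^sub>F h in at 0. (g (x + h) - g x) / h < p + L" if "\<exists>\<^sub>F h in at 0. (f (x + h) - f x) / h < p"
      by (rule frequently_rev_mp[OF that]) (use ev in eventually_elim, simp add: slope)
    show "\<exists>\<^sub>F h in at 0. q + L < (g (x + h) - g x) / h" if "\<exists>\<^sub>F h in at 0. q < (f (x + h) - f x) / h"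
      by (rule frequently_rev_mp[OF that]) (use ev in eventually_elim, simp add: slope)
  qed
  show ?thesis
  proof (cases "0 \<le> p + L")
    case True
    have "negligible (oscillation_set g 1 (p + L) (q + L) \<inter> {- real n..real n})" for n
      by (rule negligible_oscillation_set_mono) (use mono cont True \<open>p < q\<close> in auto)
    then have "negligible (\<Union>n. oscillation_set g 1 (p + L) (q + L) \<inter> {- real n..real n})"
      by (intro negligible_countable_Union) auto
    then have "negligible (oscillation_set g 1 (p + L) (q + L))"
    proof (rule negligible_subset, intro subsetI)
      fix x assume x: "x \<in> oscillation_set g 1 (p + L) (q + L)"
      obtain n where "\<bar>x\<bar> \<le> real n" using real_arch_simple by blast
      then show "x \<in> (\<Union>n. oscillation_set g 1 (p + L) (q + L) \<inter> {- real n..real n})"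
        using x by (auto simp: abs_le_iff intro!: exI[of _ n])
    qed
    then show ?thesis by (rule negligible_subset) (rule sub)
  next
    case False
    have "(g (x + h) - g x) / h \<ge> 0" for x h
      using mono[of x "x + h"] mono[of "x + h" x] by (cases "h \<ge> 0") (auto simp: divide_nonpos_nonpos)
    then have "oscillation_set g 1 (p + L) (q + L) = {}"
      using False unfolding oscillation_set_def
      by (auto dest!: frequently_ex) (smt (verit))
    then show ?thesis using sub by simp
  qed
qed

text \<open>By translation invariance the measure of \<open>E\<close> is the average over
  \<open>t\<close> in [0, 1] of the measures of E - t u. After Fubini the inner integral runs along
  a line of direction \<open>u\<close>, where the one-dimensional result applies; no coordinates
  adapted to \<open>u\<close> have to be chosen.\<close>

lemma negligible_oscillation_set:
  fixes g :: "'a::euclidean_space \<Rightarrow> real"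
  assumes L: "L-lipschitz_on UNIV g" and "p < q"
  shows "negligible (oscillation_set g u p q)"
proof -
  define E where "E = oscillation_set g u p q"
  have cont: "continuous_on UNIV g" by (rule lipschitz_on_continuous_on[OF L])
  have Eb[measurable]: "E \<in> sets borel" unfolding E_def by (rule oscillation_set_borel[OF cont])
  have line: "negligible {t. x + t *\<^sub>R u \<in> E}" for x
  proof -
    define k where "k t = g (x + t *\<^sub>R u)" for t
    have "(L * norm u)-lipschitz_on UNIV k"
    proof (rule lipschitz_onI)
      fix s t
      have "dist (k s) (k t) \<le> L * dist (x + s *\<^sub>R u) (x + t *\<^sub>R u)"
        unfolding k_def by (rule lipschitz_onD[OF L]) auto
      also have "dist (x + s *\<^sub>R u) (x + t *\<^sub>R u) = norm u * dist s t"
        by (simp add: dist_norm flip: scaleR_left_diff_distrib)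
      finally show "dist (k s) (k t) \<le> L * norm u * dist s t" by simp
    qed (use lipschitz_on_nonneg[OF L] in auto)
    then have "negligible (oscillation_set k 1 p q)"
      by (rule negligible_oscillation_set_real) fact
    moreover have "{t. x + t *\<^sub>R u \<in> E} = oscillation_set k 1 p q"
      by (simp add: E_def oscillation_set_def k_def algebra_simps)
    ultimately show ?thesis by simp
  qed
  define F :: "'a \<Rightarrow> real \<Rightarrow> ennreal"
    where "F x t = indicator E (x + t *\<^sub>R u) * indicator {0..1} t" for x t
  have "emeasure lborel E = (\<integral>\<^sup>+t. emeasure lborel E * indicator {0..1::real} t \<partial>lborel)"
    by (simp add: nn_integral_cmult_indicator)
  also have "\<dots> = (\<integral>\<^sup>+t. (\<integral>\<^sup>+x. F x t \<partial>lborel) \<partial>lborel)"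
  proof (rule nn_integral_cong)
    fix t :: real
    have "(\<integral>\<^sup>+x. F x t \<partial>lborel) = (\<integral>\<^sup>+x. indicator E (t *\<^sub>R u + x) \<partial>lborel) * indicator {0..1} t"
      unfolding F_def by (subst nn_integral_multc) (auto simp: add.commute)
    also have "(\<integral>\<^sup>+x. indicator E (t *\<^sub>R u + x) \<partial>lborel) = (\<integral>\<^sup>+x. indicator E x \<partial>distr lborel borel ((+) (t *\<^sub>R u)))"
      by (subst nn_integral_distr) auto
    also have "\<dots> = emeasure lborel E" by (simp add: lborel_distr_plus)
    finally show "emeasure lborel E * indicator {0..1} t = (\<integral>\<^sup>+x. F x t \<partial>lborel)" by simp
  qed
  also have "\<dots> = (\<integral>\<^sup>+x. (\<integral>\<^sup>+t. F x t \<partial>lborel) \<partial>lborel)"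
    by (rule lborel_pair.Fubini') (unfold F_def, measurable)
  also have "\<dots> = 0"
  proof -
    have "(\<integral>\<^sup>+t. F x t \<partial>lborel) = 0" for x
    proof -
    define A where "A = {t. x + t *\<^sub>R u \<in> E}"
    have Ab: "A \<in> sets borel" unfolding A_def by measurable
    have "(\<integral>\<^sup>+t. F x t \<partial>lborel) \<le> (\<integral>\<^sup>+t. indicator A t \<partial>lborel)"
      by (rule nn_integral_mono) (auto simp: F_def A_def indicator_def)
    also have "\<dots> = emeasure lborel A" using Ab by simp
    also have "\<dots> = emeasure lebesgue A" using Ab by simp
    also have "\<dots> = 0" using line[of x] unfolding A_def negligible_iff_null_sets by blast
    finally show ?thesis by simp
    qed
    then show ?thesis by simp
  qed
  finally have "emeasure lborel E = 0" by simp
  then show ?thesis unfolding E_def[symmetric] negligible_iff_null_sets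
    using Eb by (auto simp: null_sets_def)
qed

section \<open>Rademacher's theorem\<close>

text \<open>The candidate is the lower limit, the supremum of the eventual lower bounds. Two
  rationals \<open>p < q\<close> fit between it and any larger \<open>a\<close>: values below
  \<open>p\<close> recur, so values above \<open>q\<close> cannot.\<close>

lemma convergent_if_no_oscillation:
  fixes \<sigma> :: "'b \<Rightarrow> real"
  assumes F: "F \<noteq> bot" and bd: "\<forall>\<^sub>F h in F. \<bar>\<sigma> h\<bar> \<le> L"
    and no: "\<And>p q. p \<in> \<rat> \<Longrightarrow> q \<in> \<rat> \<Longrightarrow> p < q \<Longrightarrow> \<not> ((\<exists>\<^sub>F h in F. \<sigma> h < p) \<and> (\<exists>\<^sub>F h in F. \<sigma> h > q))"
  shows "\<exists>l. (\<sigma> \<longlongrightarrow> l) F"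
proof -
  define S where "S = {p. \<forall>\<^sub>F h in F. \<sigma> h \<ge> p}"
  have "- L \<in> S" using bd unfolding S_def by (auto elim!: eventually_mono)
  moreover have ub: "p \<le> L" if "p \<in> S" for p
  proof -
    have "\<forall>\<^sub>F h in F. p \<le> L" using bd that unfolding S_def by (auto elim: eventually_elim2)
    then show ?thesis using F by simp
  qed
  ultimately have bdd: "bdd_above S" "S \<noteq> {}" by (auto simp: bdd_above_def)
  define l where "l = Sup S"
  have "(\<sigma> \<longlongrightarrow> l) F"
  proof (rule order_tendstoI)
    fix a assume "a < l"
    then obtain p where "p \<in> S" "a < p" unfolding l_def using bdd by (meson less_cSup_iff)
    then show "\<forall>\<^sub>F h in F. a < \<sigma> h" unfolding S_def by (auto elim!: eventually_mono)
  next
    fix a assume "l < a"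
    then obtain p where p: "p \<in> \<rat>" "l < p" "p < a" using Rats_dense_in_real by blast
    then obtain q where q: "q \<in> \<rat>" "p < q" "q < a" using Rats_dense_in_real by blast
    have "p \<notin> S" using p bdd unfolding l_def by (meson cSup_upper not_le)
    then have "\<exists>\<^sub>F h in F. \<sigma> h < p" by (simp add: S_def not_eventually not_le)
    with no[of p q] p q have "\<not> (\<exists>\<^sub>F h in F. \<sigma> h > q)" by blast
    then have "\<forall>\<^sub>F h in F. \<sigma> h \<le> q" by (simp add: not_frequently not_less)
    then show "\<forall>\<^sub>F h in F. \<sigma> h < a" using q by (auto elim!: eventually_mono)
  qed
  then show ?thesis by blast
qed

section \<open>Directional derivatives and their linearity almost everywhere\<close>

definition quot :: "('a::real_normed_vector \<Rightarrow> real) \<Rightarrow> 'a \<Rightarrow> nat \<Rightarrow> 'a \<Rightarrow> real" where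
  "quot g u n x = (g (x + (1 / Suc n) *\<^sub>R u) - g x) / (1 / Suc n)"

text \<open>Only the steps 1 / (n + 1) enter, because a sequential limit of measurable functions is
  measurable. That the full two-sided limit exists and has this value is recorded by
  \<open>has_dir_deriv\<close>; elsewhere the value is whatever \<open>lim\<close> returns.\<close>

definition dir_deriv :: "('a::real_normed_vector \<Rightarrow> real) \<Rightarrow> 'a \<Rightarrow> 'a \<Rightarrow> real" where
  "dir_deriv g u x = lim (\<lambda>n. quot g u n x)"

definition has_dir_deriv :: "('a::real_normed_vector \<Rightarrow> real) \<Rightarrow> 'a \<Rightarrow> 'a \<Rightarrow> bool" where
  "has_dir_deriv g u x \<longleftrightarrow> ((\<lambda>h. (g (x + h *\<^sub>R u) - g x) / h) \<longlongrightarrow> dir_deriv g u x) (at 0)"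

lemma quot_tendsto:
  assumes "((\<lambda>h. (g (x + h *\<^sub>R u) - g x) / h) \<longlongrightarrow> l) (at 0)"
  shows "(\<lambda>n. quot g u n x) \<longlonglongrightarrow> l"
proof -
  have "filterlim (\<lambda>n. 1 / real (Suc n)) (at 0) sequentially"
    unfolding filterlim_at using LIMSEQ_inverse_real_of_nat by (auto simp: inverse_eq_divide)
  from filterlim_compose[OF assms this] show ?thesis by (simp add: quot_def)
qed

lemma has_dir_derivI:
  assumes "((\<lambda>h. (g (x + h *\<^sub>R u) - g x) / h) \<longlongrightarrow> l) (at 0)"
  shows "has_dir_deriv g u x" "dir_deriv g u x = l"
proof -
  show "dir_deriv g u x = l" unfolding dir_deriv_def by (rule limI) (rule quot_tendsto[OF assms])
  then show "has_dir_deriv g u x" unfolding has_dir_deriv_def using assms by simp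
qed

lemma slope_bound:
  assumes L: "L-lipschitz_on UNIV g"
  shows "\<bar>(g (x + h *\<^sub>R u) - g x) / h\<bar> \<le> L * norm u"
proof (cases "h = 0")
  case True
  then show ?thesis using lipschitz_on_nonneg[OF L] by simp
next
  case False
  have "\<bar>g (x + h *\<^sub>R u) - g x\<bar> \<le> L * (\<bar>h\<bar> * norm u)"
    using lipschitz_onD[OF L, of "x + h *\<^sub>R u" x] by (simp add: dist_real_def dist_norm)
  then show ?thesis using False by (simp add: field_simps)
qed

lemma quot_bound: "L-lipschitz_on UNIV g \<Longrightarrow> \<bar>quot g u n x\<bar> \<le> L * norm u"
  unfolding quot_def by (rule slope_bound)

lemma quot_measurable[measurable]:
  fixes g :: "'a::euclidean_space \<Rightarrow> real"
  assumes [measurable]: "g \<in> borel_measurable borel"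
  shows "quot g u n \<in> borel_measurable borel"
  unfolding quot_def[abs_def] by measurable

lemma dir_deriv_measurable[measurable]:
  fixes g :: "'a::euclidean_space \<Rightarrow> real"
  assumes [measurable]: "g \<in> borel_measurable borel"
  shows "dir_deriv g u \<in> borel_measurable borel"
  unfolding dir_deriv_def[abs_def] by measurable

lemma AE_has_dir_deriv:
  fixes g :: "'a::euclidean_space \<Rightarrow> real"
  assumes L: "L-lipschitz_on UNIV g"
  shows "AE x in lborel. has_dir_deriv g u x"
proof -
  have cont: "continuous_on UNIV g" by (rule lipschitz_on_continuous_on[OF L])
  have AEpq: "AE x in lborel. x \<notin> oscillation_set g u p q" if "p < q" for p q
  proof (rule AE_not_in)
    have b: "oscillation_set g u p q \<in> sets borel" by (rule oscillation_set_borel[OF cont])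
    show "oscillation_set g u p q \<in> null_sets lborel"
      using negligible_oscillation_set[OF L that, of u] b
      unfolding negligible_iff_null_sets null_sets_def by simp
  qed
  have "AE x in lborel. \<forall>p\<in>\<rat>. \<forall>q\<in>\<rat>. p < q \<longrightarrow> x \<notin> oscillation_set g u p q"
    using AEpq by (simp add: AE_ball_countable countable_rat)
  then show ?thesis
  proof eventually_elim
    case (elim x)
    have "\<exists>l. ((\<lambda>h. (g (x + h *\<^sub>R u) - g x) / h) \<longlongrightarrow> l) (at 0)"
    proof (rule convergent_if_no_oscillation[where L = "L * norm u"])
      show "\<not> ((\<exists>\<^sub>F h in at 0. (g (x + h *\<^sub>R u) - g x) / h < p) \<and> (\<exists>\<^sub>F h in at 0. q < (g (x + h *\<^sub>R u) - g x) / h))"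
        if "p \<in> \<rat>" "q \<in> \<rat>" "p < q" for p q
        using elim that unfolding oscillation_set_def by blast
    qed (use slope_bound[OF L] in \<open>auto intro!: always_eventually\<close>)
    then show "has_dir_deriv g u x" using has_dir_derivI by blast
  qed
qed

lemma AE_dir_deriv_scale:
  fixes g :: "'a::euclidean_space \<Rightarrow> real"
  assumes L: "L-lipschitz_on UNIV g"
  shows "AE x in lborel. dir_deriv g (c *\<^sub>R u) x = c * dir_deriv g u x"
  using AE_has_dir_deriv[OF L, of u]
proof eventually_elim
  case (elim x)
  show ?case
  proof (cases "c = 0")
    case True
    have "((\<lambda>h. (g (x + h *\<^sub>R (c *\<^sub>R u)) - g x) / h) \<longlongrightarrow> 0) (at 0)" using True by simp
    from has_dir_derivI(2)[OF this] show ?thesis using True by simp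
  next
    case False
    have "filterlim (\<lambda>h. h * c) (at 0) (at 0)"
      unfolding filterlim_at using False
      by (auto simp: eventually_at_filter intro!: tendsto_eq_intros)
    from filterlim_compose[OF elim[unfolded has_dir_deriv_def] this]
    have "((\<lambda>h. c * ((g (x + (h * c) *\<^sub>R u) - g x) / (h * c))) \<longlongrightarrow> c * dir_deriv g u x) (at 0)"
      by (rule tendsto_mult_left)
    also have "(\<lambda>h. c * ((g (x + (h * c) *\<^sub>R u) - g x) / (h * c))) = (\<lambda>h. (g (x + h *\<^sub>R (c *\<^sub>R u)) - g x) / h)"
      using False by auto
    finally show ?thesis by (rule has_dir_derivI(2))
  qed
qed

text \<open>Adding a multiple of \<open>\<phi>\<close> to the constant density of Lebesgue measure does not change the measure
  of boxes, hence does not change the measure.\<close>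
lemma AE_zero_if_box_integrals_zero:
  fixes \<phi> :: "'a::euclidean_space \<Rightarrow> real"
  assumes [measurable]: "\<phi> \<in> borel_measurable borel" and bd: "AE x in lborel. \<bar>\<phi> x\<bar> \<le> C"
    and zero: "\<And>a b. (LINT x|lborel. indicator (box a b) x * \<phi> x) = 0"
  shows "AE x in lborel. \<phi> x = 0"
proof -
  \<comment> \<open>\<open>D\<close> is positive and exceeds the essential bound of
    \<open>\<phi>\<close>, so 1 + \<open>\<phi>\<close> / \<open>D\<close> is nonnegative almost
    everywhere and can serve as a density.\<close>
  define D where "D = \<bar>C\<bar> + 1"
  have D: "D > 0" by (simp add: D_def)
  have nn: "AE x in lborel. 0 \<le> 1 + \<phi> x / D"
    using bd by eventually_elim (use D in \<open>auto simp: D_def field_simps\<close>)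
  have "lborel = density lborel (\<lambda>x. ennreal (1 + \<phi> x / D))" (is "_ = ?M")
  proof (rule lborel_eqI)
    fix a b :: 'a assume ab: "\<And>i. i \<in> Basis \<Longrightarrow> a \<bullet> i \<le> b \<bullet> i"
    have fin: "emeasure lborel (box a b) < \<infinity>" using ab by (simp add: emeasure_lborel_box_eq)
    have int1: "integrable lborel (\<lambda>x. indicator (box a b) x :: real)"
      using fin by simp
    have int2: "integrable lborel (\<lambda>x. indicator (box a b) x * \<phi> x)"
    proof (rule Bochner_Integration.integrable_bound)
      show "integrable lborel (\<lambda>x. \<bar>C\<bar> * indicator (box a b) x :: real)" using int1 by simp
      show "AE x in lborel. norm (indicator (box a b) x * \<phi> x) \<le> norm (\<bar>C\<bar> * indicator (box a b) x)"
        using bd by eventually_elim (auto simp: indicator_def)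
    qed auto
    have "emeasure ?M (box a b) = (\<integral>\<^sup>+x. ennreal (1 + \<phi> x / D) * indicator (box a b) x \<partial>lborel)"
      by (rule emeasure_density) auto
    also have "\<dots> = (\<integral>\<^sup>+x. ennreal (indicator (box a b) x + (indicator (box a b) x * \<phi> x) / D) \<partial>lborel)"
      by (rule nn_integral_cong) (auto simp: indicator_def)
    also have "\<dots> = ennreal (LINT x|lborel. indicator (box a b) x + (indicator (box a b) x * \<phi> x) / D)"
    proof (rule nn_integral_eq_integral)
      show "integrable lborel (\<lambda>x. indicator (box a b) x + (indicator (box a b) x * \<phi> x) / D)"
        using int1 int2 by auto
      show "AE x in lborel. 0 \<le> indicator (box a b) x + (indicator (box a b) x * \<phi> x) / D"
        using nn by eventually_elim (auto simp: indicator_def)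
    qed
    also have "(LINT x|lborel. indicator (box a b) x + (indicator (box a b) x * \<phi> x) / D) = measure lborel (box a b)"
      using int1 int2 zero[of a b] by (subst Bochner_Integration.integral_add) auto
    also have "ennreal \<dots> = ennreal (prod ((\<bullet>) (b - a)) Basis)"
      using ab by (subst measure_lborel_box_eq) auto
    finally show "emeasure ?M (box a b) = ennreal (prod ((\<bullet>) (b - a)) Basis)" .
  qed simp
  then have "density lborel (\<lambda>x. 1) = ?M" by (simp add: density_1)
  then have "AE x in lborel. 1 = ennreal (1 + \<phi> x / D)"
    by (intro sigma_finite_measure.density_unique[OF sigma_finite_lborel]) auto
  then show ?thesis
  proof eventually_elim
    case (elim x)
    then have "1 + \<phi> x / D = 1" by (metis ennreal_eq_1)
    then show ?case using D by simp
  qed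
qed

lemma AE_dir_deriv_bound:
  fixes g :: "'a::euclidean_space \<Rightarrow> real"
  assumes L: "L-lipschitz_on UNIV g"
  shows "AE x in lborel. \<bar>dir_deriv g u x\<bar> \<le> L * norm u"
  using AE_has_dir_deriv[OF L, of u]
proof eventually_elim
  case (elim x)
  then have "((\<lambda>h. \<bar>(g (x + h *\<^sub>R u) - g x) / h\<bar>) \<longlongrightarrow> \<bar>dir_deriv g u x\<bar>) (at 0)"
    unfolding has_dir_deriv_def by (rule tendsto_rabs)
  then show ?case
    by (rule tendsto_upperbound) (use slope_bound[OF L] in \<open>auto intro!: always_eventually\<close>)
qed

lemma LINT_lborel_translate:
  fixes f :: "'a::euclidean_space \<Rightarrow> real"
  assumes [measurable]: "f \<in> borel_measurable borel"
  shows "(LINT x|lborel. f (t + x)) = (LINT x|lborel. f x)"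
proof -
  have "(LINT x|lborel. f x) = (LINT x|distr lborel borel ((+) t). f x)" by (simp add: lborel_distr_plus)
  also have "\<dots> = (LINT x|lborel. f (t + x))" by (subst integral_distr) auto
  finally show ?thesis by simp
qed

text \<open>Additivity is obtained weakly. An increment along u + v is one along u followed by one
  along v from the translated point, so the defect is a difference of two translates of the quotient
  along v. Integrated over a box, the translation moves onto the indicator of the box, which
  converges off the frontier, a null set.\<close>

lemma AE_dir_deriv_add:
  fixes g :: "'a::euclidean_space \<Rightarrow> real"
  assumes L: "L-lipschitz_on UNIV g"
  shows "AE x in lborel. dir_deriv g (u + v) x = dir_deriv g u x + dir_deriv g v x"
proof -
  have cont: "continuous_on UNIV g" by (rule lipschitz_on_continuous_on[OF L])
  then have [measurable]: "g \<in> borel_measurable borel" by (rule borel_measurable_continuous_onI)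
  define q where "q w n = quot g w n" for w n
  have [measurable]: "q w n \<in> borel_measurable borel" for w n unfolding q_def by measurable
  have qb: "\<bar>q w n x\<bar> \<le> L * norm w" for w n x unfolding q_def by (rule quot_bound[OF L])
  have qlim: "AE x in lborel. (\<lambda>n. q w n x) \<longlonglongrightarrow> dir_deriv g w x" for w
    using AE_has_dir_deriv[OF L, of w] unfolding q_def
    by eventually_elim (auto simp: has_dir_deriv_def intro: quot_tendsto)
  define \<phi> where "\<phi> x = dir_deriv g (u + v) x - dir_deriv g u x - dir_deriv g v x" for x
  have [measurable]: "\<phi> \<in> borel_measurable borel" unfolding \<phi>_def by measurable
  define C where "C = L * norm (u + v) + L * norm u + L * norm v"
  have "AE x in lborel. \<bar>\<phi> x\<bar> \<le> C"
    using AE_dir_deriv_bound[OF L, of "u + v"] AE_dir_deriv_bound[OF L, of u] AE_dir_deriv_bound[OF L, of v]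
    by eventually_elim (auto simp: \<phi>_def C_def)
  moreover have "(LINT x|lborel. indicator (box a b) x * \<phi> x) = 0" for a b
  proof -
    define Q where "Q = box a b"
    have [measurable]: "Q \<in> sets borel" by (simp add: Q_def)
    obtain R where R: "R > 0" "\<And>x. x \<in> Q \<Longrightarrow> norm x \<le> R"
      using bounded_box[of a b] unfolding bounded_pos Q_def by blast
    \<comment> \<open>As \<open>e n\<close> \<le> 1, this ball contains \<open>Q\<close> and all its
      translates by \<open>e n *\<^sub>R u\<close>: a common support for the dominating
      functions.\<close>
    define B where "B = cball (0::'a) (R + norm u)"
    have [measurable]: "B \<in> sets borel" by (simp add: B_def)
    have intB: "integrable lborel (\<lambda>x. c * indicator B x :: real)" for c
      by (rule integrable_mult_right, rule integrable_real_indicator)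
        (auto simp: B_def intro!: emeasure_bounded_finite[unfolded infinity_ennreal_def])
    have QB: "Q \<subseteq> B"
    proof
      fix x assume "x \<in> Q"
      then have "norm x \<le> R" by (rule R)
      then show "x \<in> B" using norm_ge_zero[of u] by (simp add: B_def del: norm_ge_zero)
    qed
    define e where "e n = 1 / real (Suc n)" for n
    have e: "0 < e n" "e n \<le> 1" for n by (auto simp: e_def)
    have elim0: "e \<longlonglongrightarrow> 0" unfolding e_def using LIMSEQ_inverse_real_of_nat by (simp add: inverse_eq_divide)
    have split: "q (u + v) n x = q v n (e n *\<^sub>R u + x) + q u n x" for n x
    proof -
      have 1: "x + e n *\<^sub>R (u + v) = e n *\<^sub>R u + x + e n *\<^sub>R v" by (simp add: algebra_simps)
      have 2: "x + e n *\<^sub>R u = e n *\<^sub>R u + x" by simp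
      show ?thesis unfolding q_def quot_def e_def[symmetric] 1 2 diff_divide_distrib by simp
    qed
    define \<psi> where "\<psi> n x = q (u + v) n x - q u n x - q v n x" for n x
    have [measurable]: "\<psi> n \<in> borel_measurable borel" for n unfolding \<psi>_def by measurable
    have lim1: "(\<lambda>n. LINT x|lborel. indicator Q x * \<psi> n x) \<longlonglongrightarrow> (LINT x|lborel. indicator Q x * \<phi> x)"
    proof (rule integral_dominated_convergence[where w = "\<lambda>x. C * indicator B x"])
      show "AE x in lborel. (\<lambda>n. indicator Q x * \<psi> n x) \<longlonglongrightarrow> indicator Q x * \<phi> x"
        using qlim[of "u + v"] qlim[of u] qlim[of v]
        by eventually_elim (auto simp: \<phi>_def \<psi>_def intro!: tendsto_intros)
      show "AE x in lborel. norm (indicator Q x * \<psi> n x) \<le> C * indicator B x" for n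
      proof (rule AE_I2)
        fix x
        have "\<bar>\<psi> n x\<bar> \<le> C" using qb[of "u + v" n x] qb[of u n x] qb[of v n x] by (simp add: \<psi>_def C_def)
        then show "norm (indicator Q x * \<psi> n x) \<le> C * indicator B x"
          using QB by (auto simp: indicator_def)
      qed
    qed (use intB in auto)
    have int_v: "integrable lborel (\<lambda>x. indicator Q x * q v n x)"
      and int_vt: "integrable lborel (\<lambda>x. indicator Q x * q v n (e n *\<^sub>R u + x))"
      and int_t: "integrable lborel (\<lambda>x. indicator Q (- (e n *\<^sub>R u) + x) * q v n x)" for n
    proof -
      have 1: "integrable lborel f" if [measurable]: "f \<in> borel_measurable borel"
        and "\<And>x. \<bar>f x\<bar> \<le> L * norm v" "\<And>x. x \<notin> B \<Longrightarrow> f x = 0" for f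
      proof (rule Bochner_Integration.integrable_bound[OF intB[of "L * norm v"]])
        have "norm (f x) \<le> norm (L * norm v * indicator B x)" for x
          using that(2)[of x] that(3)[of x] by (cases "x \<in> B") auto
        then show "AE x in lborel. norm (f x) \<le> norm (L * norm v * indicator B x)" by simp
      qed simp
      have nn: "0 \<le> L * norm v" using lipschitz_on_nonneg[OF L] by simp
      show "integrable lborel (\<lambda>x. indicator Q x * q v n x)"
        by (rule 1) (use QB qb nn in \<open>auto simp: indicator_def\<close>)
      show "integrable lborel (\<lambda>x. indicator Q x * q v n (e n *\<^sub>R u + x))"
        by (rule 1) (use QB qb nn in \<open>auto simp: indicator_def\<close>)
      have "- (e n *\<^sub>R u) + x \<notin> Q" if "x \<notin> B" for x
      proof
        assume "- (e n *\<^sub>R u) + x \<in> Q"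
        then have "norm (- (e n *\<^sub>R u) + x) \<le> R" by (rule R)
        moreover have "norm x \<le> norm (- (e n *\<^sub>R u) + x) + norm (e n *\<^sub>R u)"
          by (metis add.commute add_minus_cancel add_uminus_conv_diff minus_add_cancel norm_triangle_ineq)
        moreover have "norm (e n *\<^sub>R u) \<le> norm u" using e[of n] by (simp add: mult_left_le_one_le)
        ultimately show False using that by (simp add: B_def)
      qed
      then show "integrable lborel (\<lambda>x. indicator Q (- (e n *\<^sub>R u) + x) * q v n x)"
        by (intro 1) (use qb nn in \<open>auto simp: indicator_def\<close>)
    qed
    have eq: "(LINT x|lborel. indicator Q x * \<psi> n x) =
        (LINT x|lborel. (indicator Q (- (e n *\<^sub>R u) + x) - indicator Q x) * q v n x)" for n
    proof -
      have "(LINT x|lborel. indicator Q x * \<psi> n x) =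
        (LINT x|lborel. indicator Q x * q v n (e n *\<^sub>R u + x) - indicator Q x * q v n x)"
        by (rule Bochner_Integration.integral_cong) (auto simp: \<psi>_def split algebra_simps)
      also have "\<dots> = (LINT x|lborel. indicator Q x * q v n (e n *\<^sub>R u + x)) - (LINT x|lborel. indicator Q x * q v n x)"
        by (rule Bochner_Integration.integral_diff) (rule int_vt int_v)+
      also have "(LINT x|lborel. indicator Q x * q v n (e n *\<^sub>R u + x)) =
          (LINT x|lborel. indicator Q (- (e n *\<^sub>R u) + x) * q v n x)"
        using LINT_lborel_translate[of "\<lambda>x. indicator Q (- (e n *\<^sub>R u) + x) * q v n x" "e n *\<^sub>R u"]
        by simp
      also have "\<dots> - (LINT x|lborel. indicator Q x * q v n x) =
        (LINT x|lborel. indicator Q (- (e n *\<^sub>R u) + x) * q v n x - indicator Q x * q v n x)"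
        by (rule Bochner_Integration.integral_diff[symmetric]) (rule int_t int_v)+
      finally show ?thesis by (simp add: algebra_simps)
    qed
    have fr: "AE x in lborel. x \<notin> frontier Q"
    proof (rule AE_not_in)
      have "negligible (frontier Q)" unfolding Q_def by (rule negligible_convex_frontier) auto
      then show "frontier Q \<in> null_sets lborel"
        unfolding negligible_iff_null_sets null_sets_def by simp
    qed
    have "(\<lambda>n. LINT x|lborel. (indicator Q (- (e n *\<^sub>R u) + x) - indicator Q x) * q v n x) \<longlonglongrightarrow> (LINT (x::'a)|lborel. 0)"
    proof (rule integral_dominated_convergence[where w = "\<lambda>x. (L * norm v) * indicator B x"])
      show "AE x in lborel. (\<lambda>n. (indicator Q (- (e n *\<^sub>R u) + x) - indicator Q x) * q v n x) \<longlonglongrightarrow> 0"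
        using fr
      proof eventually_elim
        case (elim x)
        have "(\<lambda>n. - (e n *\<^sub>R u) + x) \<longlonglongrightarrow> - (0 *\<^sub>R u) + x" by (intro tendsto_intros elim0)
        then have t: "(\<lambda>n. - (e n *\<^sub>R u) + x) \<longlonglongrightarrow> x" by simp
        have "\<forall>\<^sub>F n in sequentially. (indicator Q (- (e n *\<^sub>R u) + x) :: real) = indicator Q x"
        proof (cases "x \<in> Q")
          case True
          have "open Q" by (simp add: Q_def open_box)
          from topological_tendstoD[OF t this True] show ?thesis
            by eventually_elim (use True in auto)
        next
          case False
          then have "x \<in> - closure Q" using elim by (auto simp: frontier_def Q_def interior_open open_box)
          from topological_tendstoD[OF t open_Compl[OF closed_closure] this] show ?thesis
            by (rule eventually_mono) (use False closure_subset in \<open>auto simp: indicator_def\<close>)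
        qed
        then have "\<forall>\<^sub>F n in sequentially. (indicator Q (- (e n *\<^sub>R u) + x) - indicator Q x) * q v n x = 0"
          by eventually_elim simp
        then show ?case by (rule tendsto_eventually)
      qed
      show "AE x in lborel. norm ((indicator Q (- (e n *\<^sub>R u) + x) - indicator Q x) * q v n x) \<le> (L * norm v) * indicator B x" for n
      proof (rule AE_I2)
        fix x
        have nn: "0 \<le> L * norm v" using lipschitz_on_nonneg[OF L] by simp
        have "x \<in> B" if "- (e n *\<^sub>R u) + x \<in> Q"
        proof -
          have "norm (- (e n *\<^sub>R u) + x) \<le> R" using that by (rule R)
          moreover have "norm x \<le> norm (- (e n *\<^sub>R u) + x) + norm (e n *\<^sub>R u)"
            by (metis add.commute add_minus_cancel add_uminus_conv_diff minus_add_cancel norm_triangle_ineq)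
          moreover have "norm (e n *\<^sub>R u) \<le> norm u" using e[of n] by (simp add: mult_left_le_one_le)
          ultimately show ?thesis by (simp add: B_def)
        qed
        then show "norm ((indicator Q (- (e n *\<^sub>R u) + x) - indicator Q x) * q v n x) \<le> (L * norm v) * indicator B x"
          using qb[of v n x] QB nn by (auto simp: indicator_def)
      qed
    qed (use intB in auto)
    then have "(\<lambda>n. LINT x|lborel. indicator Q x * \<psi> n x) \<longlonglongrightarrow> 0" unfolding eq by simp
    from LIMSEQ_unique[OF lim1 this] show ?thesis unfolding Q_def .
  qed
  ultimately have "AE x in lborel. \<phi> x = 0"
    by (rule AE_zero_if_box_integrals_zero[rotated]) measurable
  then show ?thesis by eventually_elim (simp add: \<phi>_def)
qed

lemma AE_dir_deriv_linear:
  fixes g :: "'a::euclidean_space \<Rightarrow> real"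
  assumes L: "L-lipschitz_on UNIV g"
  shows "AE x in lborel. dir_deriv g u x = (\<Sum>i\<in>Basis. (u \<bullet> i) * dir_deriv g i x)"
proof -
  have "AE x in lborel. dir_deriv g (\<Sum>i\<in>B. c i *\<^sub>R i) x = (\<Sum>i\<in>B. c i * dir_deriv g i x)"
    if "finite B" for B :: "'a set" and c
    using that
  proof (induction B)
    case empty
    show ?case using AE_dir_deriv_scale[OF L, of 0 0] by simp
  next
    case (insert i B)
    from insert.IH AE_dir_deriv_add[OF L, of "c i *\<^sub>R i" "\<Sum>i\<in>B. c i *\<^sub>R i"] AE_dir_deriv_scale[OF L, of "c i" i]
    show ?case by eventually_elim (use insert.hyps in simp)
  qed
  from this[of Basis "\<lambda>i. u \<bullet> i"] show ?thesis by (simp add: euclidean_representation)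
qed

text \<open>Almost every point is good for all directions of a countable dense set at once. By
  compactness finitely many of them form a fine net of the unit sphere, and the Lipschitz bound
  carries the estimate to all other directions uniformly.\<close>

theorem Rademacher_real:
  fixes g :: "'a::euclidean_space \<Rightarrow> real"
  assumes L: "L-lipschitz_on UNIV g"
  shows "AE x in lborel. g differentiable (at x)"
proof -
  obtain D :: "'a set" where D: "countable D" "\<And>X. open X \<Longrightarrow> X \<noteq> {} \<Longrightarrow> \<exists>d\<in>D. d \<in> X"
    using countable_dense_exists[where 'a = 'a] by auto
  have L0: "L \<ge> 0" by (rule lipschitz_on_nonneg[OF L])
  have "AE x in lborel. \<forall>u\<in>D. has_dir_deriv g u x \<and> dir_deriv g u x = (\<Sum>i\<in>Basis. (u \<bullet> i) * dir_deriv g i x)"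
    unfolding AE_ball_countable[OF D(1)]
    using AE_has_dir_deriv[OF L] AE_dir_deriv_linear[OF L] by auto
  then show ?thesis
  proof eventually_elim
    case (elim x)
    define T where "T h = (\<Sum>i\<in>Basis. (h \<bullet> i) * dir_deriv g i x)" for h
    have blT: "bounded_linear T" unfolding T_def
      by (intro bounded_linear_sum bounded_linear_mult_const[OF bounded_linear_inner_left])
    then obtain K where K: "K > 0" "\<And>h. \<bar>T h\<bar> \<le> norm h * K"
      using bounded_linear.pos_bounded[OF blT] by (auto simp: mult.commute)
    have lim: "((\<lambda>h. (g (x + h *\<^sub>R u) - g x) / h) \<longlongrightarrow> T u) (at 0)" if "u \<in> D" for u
    proof -
      have "has_dir_deriv g u x" "dir_deriv g u x = T u" using elim that by (auto simp: T_def)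
      then show ?thesis by (simp add: has_dir_deriv_def)
    qed
    have "(g has_derivative T) (at x)"
      unfolding has_derivative_at_alt
    proof (intro conjI blT allI impI)
      fix e :: real assume e: "e > 0"
      \<comment> \<open>Replacing a direction by one of the net costs \<open>L * e'\<close> in
        \<open>g\<close> and \<open>K * e'\<close> in \<open>T\<close>, together at most e / 2; the
        other half is for the net direction itself.\<close>
      define e' where "e' = e / (2 * (L + K + 1))"
      have e': "e' > 0" using e L0 K by (simp add: e'_def)
      have "sphere 0 1 \<subseteq> (\<Union>d\<in>D. ball d e')"
      proof
        fix w :: 'a
        obtain d where "d \<in> D" "d \<in> ball w e'" using D(2)[of "ball w e'"] e' by auto
        then show "w \<in> (\<Union>d\<in>D. ball d e')" by (auto simp: dist_commute)
      qed
      then obtain F where F: "F \<subseteq> D" "finite F" "sphere 0 1 \<subseteq> (\<Union>d\<in>F. ball d e')"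
        by (rule compactE_image[OF compact_sphere open_ball])
      have "\<forall>d\<in>F. \<forall>\<^sub>F h in at 0. \<bar>(g (x + h *\<^sub>R d) - g x) / h - T d\<bar> < e / 2"
      proof
        fix d assume "d \<in> F"
        then have "\<forall>\<^sub>F h in at 0. dist ((g (x + h *\<^sub>R d) - g x) / h) (T d) < e / 2"
          using F e by (intro tendstoD[OF lim]) auto
        then show "\<forall>\<^sub>F h in at 0. \<bar>(g (x + h *\<^sub>R d) - g x) / h - T d\<bar> < e / 2"
          unfolding dist_real_def .
      qed
      then have "\<forall>\<^sub>F h in at 0. \<forall>d\<in>F. \<bar>(g (x + h *\<^sub>R d) - g x) / h - T d\<bar> < e / 2"
        using F by (simp add: eventually_ball_finite)
      then obtain \<delta> where \<delta>: "\<delta> > 0" "\<And>h d. h \<noteq> 0 \<Longrightarrow> \<bar>h\<bar> < \<delta> \<Longrightarrow> d \<in> F \<Longrightarrow> \<bar>(g (x + h *\<^sub>R d) - g x) / h - T d\<bar> < e / 2"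
        unfolding eventually_at by (auto simp: dist_real_def)
      show "\<exists>d>0. \<forall>y. norm (y - x) < d \<longrightarrow> norm (g y - g x - T (y - x)) \<le> e * norm (y - x)"
      proof (intro exI conjI allI impI)
        show "\<delta> > 0" by fact
        fix y assume y: "norm (y - x) < \<delta>"
        show "norm (g y - g x - T (y - x)) \<le> e * norm (y - x)"
        proof (cases "y = x")
          case True
          then show ?thesis using blT by (simp add: linear_simps)
        next
          case False
          define t where "t = norm (y - x)"
          define w where "w = (1 / t) *\<^sub>R (y - x)"
          have t: "t > 0" "t < \<delta>" using False y by (auto simp: t_def)
          have w: "norm w = 1" "y - x = t *\<^sub>R w" using t by (auto simp: w_def t_def)
          then obtain d where d: "d \<in> F" "norm (d - w) < e'" using F(3) by (force simp: dist_norm)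
          have 1: "\<bar>g y - g (x + t *\<^sub>R d)\<bar> \<le> L * (t * e')"
          proof -
            have "\<bar>g y - g (x + t *\<^sub>R d)\<bar> \<le> L * norm (y - (x + t *\<^sub>R d))"
              using lipschitz_onD[OF L, of y "x + t *\<^sub>R d"] by (simp add: dist_real_def dist_norm)
            also have "y - (x + t *\<^sub>R d) = t *\<^sub>R (w - d)" using w(2) by (simp add: algebra_simps)
            also have "norm \<dots> = t * norm (d - w)" using t by (simp add: norm_minus_commute)
            also have "L * \<dots> \<le> L * (t * e')" using d t L0 by (intro mult_left_mono) auto
            finally show ?thesis .
          qed
          have 2: "\<bar>g (x + t *\<^sub>R d) - g x - t * T d\<bar> \<le> t * (e / 2)"
          proof -
            have "g (x + t *\<^sub>R d) - g x - t * T d = t * ((g (x + t *\<^sub>R d) - g x) / t - T d)"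
              using t by (simp add: field_simps)
            then show ?thesis using \<delta>(2)[of t d] t d by (simp add: abs_mult)
          qed
          have 3: "\<bar>t * T d - T (y - x)\<bar> \<le> t * e' * K"
          proof -
            have "t * T d - T (y - x) = T (t *\<^sub>R (d - w))"
              unfolding w(2) using bounded_linear.linear[OF blT] by (simp add: linear_diff linear_cmul algebra_simps)
            then have "\<bar>t * T d - T (y - x)\<bar> \<le> norm (t *\<^sub>R (d - w)) * K"
              using K(2)[of "t *\<^sub>R (d - w)"] by simp
            also have "\<dots> \<le> t * e' * K" using t d K by (auto intro!: mult_right_mono mult_left_mono)
            finally show ?thesis .
          qed
          have "\<bar>g y - g x - T (y - x)\<bar> \<le> L * (t * e') + t * (e / 2) + t * e' * K" using 1 2 3 by linarith
          also have "\<dots> = t * ((L + K) * e' + e / 2)" by (simp add: algebra_simps)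
          also have "\<dots> \<le> t * e"
          proof -
            have "(L + K) * e' \<le> e / 2" using L0 K e by (simp add: e'_def field_simps)
            then show ?thesis using t by (intro mult_left_mono) auto
          qed
          finally show ?thesis by (simp add: t_def mult.commute)
        qed
      qed
    qed
    then show "g differentiable (at x)" by (auto simp: differentiable_def)
  qed
qed

theorem Rademacher:
  fixes G :: "'a::euclidean_space \<Rightarrow> 'b::euclidean_space"
  assumes L: "L-lipschitz_on UNIV G"
  shows "negligible {x. \<not> G differentiable (at x)}"
proof -
  have "L-lipschitz_on UNIV (\<lambda>x. G x \<bullet> i)" if "i \<in> Basis" for i
  proof (rule lipschitz_onI)
    fix x y
    have "dist (G x \<bullet> i) (G y \<bullet> i) \<le> dist (G x) (G y)"
      using Basis_le_norm[OF that, of "G x - G y"] by (simp add: dist_norm inner_diff_left)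
    also have "\<dots> \<le> L * dist x y" by (rule lipschitz_onD[OF L]) auto
    finally show "dist (G x \<bullet> i) (G y \<bullet> i) \<le> L * dist x y" .
  qed (rule lipschitz_on_nonneg[OF L])
  from Rademacher_real[OF this]
  have "AE x in lborel. \<forall>i\<in>Basis. (\<lambda>x. G x \<bullet> i) differentiable (at x)"
    by (subst AE_finite_all) auto
  then have "AE x in lborel. G differentiable (at x)"
    by eventually_elim (subst differentiable_componentwise_within, simp)
  then have "AE x in lebesgue. G differentiable (at x)" by (rule AE_completion)
  then obtain N where "N \<in> null_sets lebesgue" "{x. \<not> G differentiable (at x)} \<subseteq> N"
    unfolding eventually_ae_filter by auto
  then show ?thesis by (meson negligible_iff_null_sets negligible_subset)
qed

section \<open>Semicontinuous functions and touching paraboloids\<close>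

text \<open>Otherwise every \<open>z\<close> has a strictly better \<open>w z\<close> and a
  neighbourhood on which \<open>g\<close> stays below \<open>g (w z)\<close>. In a finite subcover
  take \<open>z0\<close> with the largest \<open>g (w z0)\<close>: the point \<open>w z0\<close>
  lies in some member \<open>U z1\<close>, so g (w z0) < g (w z1), a contradiction.\<close>

lemma usc_on_attains_sup:
  assumes "compact K" "K \<noteq> {}" "usc_on K g"
  shows "\<exists>z\<in>K. \<forall>w\<in>K. g w \<le> g z"
proof (rule ccontr)
  assume "\<not> ?thesis"
  then have "\<forall>z\<in>K. \<exists>w\<in>K. g z < g w" by (meson not_le)
  then obtain w where w: "\<And>z. z \<in> K \<Longrightarrow> w z \<in> K" "\<And>z. z \<in> K \<Longrightarrow> g z < g (w z)" by metis
  have "\<exists>U. open U \<and> z \<in> U \<and> (\<forall>y\<in>U \<inter> K. g y < g (w z))" if "z \<in> K" for z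
  proof -
    have "\<forall>\<^sub>F y in at z within K. g y < g (w z)"
      using assms(3) w(2)[OF that] that by (auto simp: usc_on_def)
    then obtain U where "open U" "z \<in> U" "\<And>y. y \<in> U \<Longrightarrow> y \<noteq> z \<Longrightarrow> y \<in> K \<Longrightarrow> g y < g (w z)"
      unfolding eventually_at_topological by blast
    then show ?thesis using w(2)[OF that] by (intro exI[of _ U]) auto
  qed
  then obtain U where U: "\<And>z. z \<in> K \<Longrightarrow> open (U z)" "\<And>z. z \<in> K \<Longrightarrow> z \<in> U z"
    "\<And>z y. z \<in> K \<Longrightarrow> y \<in> U z \<Longrightarrow> y \<in> K \<Longrightarrow> g y < g (w z)"
    by (metis IntI)
  have "K \<subseteq> (\<Union>z\<in>K. U z)" using U(2) by blast
  then obtain C where C: "C \<subseteq> K" "finite C" "K \<subseteq> (\<Union>z\<in>C. U z)"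
    using compactE_image[OF assms(1), of K U] U(1) by blast
  have "C \<noteq> {}" using C assms(2) by auto
  then obtain z0 where z0: "z0 \<in> C" "\<And>z. z \<in> C \<Longrightarrow> g (w z) \<le> g (w z0)"
  proof -
    have "Max ((\<lambda>z. g (w z)) ` C) \<in> (\<lambda>z. g (w z)) ` C" using C(2) \<open>C \<noteq> {}\<close> by (intro Max_in) auto
    then obtain z0 where "z0 \<in> C" "Max ((\<lambda>z. g (w z)) ` C) = g (w z0)" by auto
    moreover have "g (w z) \<le> Max ((\<lambda>z. g (w z)) ` C)" if "z \<in> C" for z
      using C(2) that by (intro Max_ge) auto
    ultimately show thesis using that by simp
  qed
  have "w z0 \<in> K" using w(1) z0(1) C(1) by blast
  then obtain z1 where z1: "z1 \<in> C" "w z0 \<in> U z1" using C(3) by blast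
  then have "g (w z0) < g (w z1)" using U(3) C(1) \<open>w z0 \<in> K\<close> by blast
  with z0(2)[OF z1(1)] show False by simp
qed

lemma usc_on_add:
  assumes "usc_on K g" "usc_on K h"
  shows "usc_on K (\<lambda>x. g x + h x)"
  unfolding usc_on_def
proof (intro ballI allI impI)
  fix x c assume x: "x \<in> K" "g x + h x < c"
  define e where "e = (c - (g x + h x)) / 2"
  have e: "e > 0" using x by (simp add: e_def)
  have "\<forall>\<^sub>F y in at x within K. g y < g x + e" using assms(1) x e by (auto simp: usc_on_def)
  moreover have "\<forall>\<^sub>F y in at x within K. h y < h x + e" using assms(2) x e by (auto simp: usc_on_def)
  ultimately show "\<forall>\<^sub>F y in at x within K. g y + h y < c"
  proof eventually_elim
    case (elim y)
    have "g x + e + (h x + e) = c" by (simp add: e_def field_simps)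
    then show ?case using elim by linarith
  qed
qed

lemma usc_on_if_continuous:
  fixes h :: "'a::topological_space \<Rightarrow> real"
  assumes "continuous_on K h"
  shows "usc_on K h"
  using assms by (auto simp: usc_on_def continuous_on_def intro: order_tendstoD)

lemmas usc_on_add_continuous = usc_on_add[OF _ usc_on_if_continuous]

section \<open>Paraboloids touching a function, and second-order expansions\<close>

lemma norm_add_sq:
  fixes x y :: "'a::real_inner"
  shows "(norm (x + y))\<^sup>2 = (norm x)\<^sup>2 + 2 * (x \<bullet> y) + (norm y)\<^sup>2"
  by (simp add: power2_norm_eq_inner inner_add inner_commute)

lemma coercive_attains_inf:
  fixes h :: "'a::euclidean_space \<Rightarrow> real"
  assumes "continuous_on UNIV h" "c > 0" and coerc: "\<And>y. h y \<ge> d + c * (norm (y - x))\<^sup>2"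
  shows "\<exists>y. \<forall>w. h y \<le> h w"
proof -
  \<comment> \<open>Beyond this radius the coercive lower bound is already at least
    \<open>h x\<close>, so a minimum over the ball is global.\<close>
  define r where "r = sqrt (\<bar>h x - d\<bar> / c) "
  have r: "r \<ge> 0" "c * r\<^sup>2 = \<bar>h x - d\<bar>" using \<open>c > 0\<close> by (auto simp: r_def)
  have "\<exists>y\<in>cball x r. \<forall>w\<in>cball x r. h y \<le> h w"
    using r by (intro continuous_attains_inf continuous_on_subset[OF assms(1)]) auto
  then obtain y where y: "\<And>w. w \<in> cball x r \<Longrightarrow> h y \<le> h w" by blast
  have "h y \<le> h w" for w
  proof (cases "w \<in> cball x r")
    case False
    then have "r < norm (w - x)" by (simp add: dist_norm norm_minus_commute)
    then have "c * r\<^sup>2 \<le> c * (norm (w - x))\<^sup>2" using r \<open>c > 0\<close> by (intro mult_left_mono power_mono) auto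
    then have "h x \<le> h w" using coerc[of w] r(2) by linarith
    moreover have "h y \<le> h x" using r by (intro y) auto
    ultimately show ?thesis by simp
  qed (rule y)
  then show ?thesis by blast
qed

text \<open>The point \<open>x\<close> lies between x - t h and x + h. Convexity, with the upper
  bound applied only at x - t h, gives the tangent inequality up to an error of order t, and t tends
  to 0.\<close>

lemma convex_on_lower_tangent:
  fixes k :: "'a::real_inner \<Rightarrow> real"
  assumes cv: "convex_on UNIV k" and up: "\<And>h. k (x + h) \<le> k x + q \<bullet> h + C * (norm h)\<^sup>2"
  shows "k (x + h) \<ge> k x + q \<bullet> h"
proof -
  have *: "k x + q \<bullet> h \<le> k (x + h) + t * (\<bar>C\<bar> * (norm h)\<^sup>2)" if "t > 0" for t
  proof -
    define s where "s = t / (1 + t)"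
    have s: "0 \<le> s" "s \<le> 1" "1 - s = 1 / (1 + t)" using that by (auto simp: s_def field_simps)
    have "(1 - s) *\<^sub>R (x + (- t) *\<^sub>R h) + s *\<^sub>R (x + h) = x + (s - (1 - s) * t) *\<^sub>R h"
      by (simp add: algebra_simps)
    also have "s - (1 - s) * t = 0" using that by (simp add: s(3)) (simp add: s_def)
    finally have "k x \<le> (1 - s) * k (x + (- t) *\<^sub>R h) + s * k (x + h)"
      using convex_onD[OF cv, of s "x + (- t) *\<^sub>R h" "x + h"] s by simp
    then have "(1 + t) * k x \<le> (1 + t) * ((1 - s) * k (x + (- t) *\<^sub>R h) + s * k (x + h))"
      using that by (intro mult_left_mono) auto
    also have "\<dots> = k (x + (- t) *\<^sub>R h) + t * k (x + h)"
    proof -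
      have "(1 + t) * (1 - s) = 1" "(1 + t) * s = t" using that by (auto simp: s(3)) (auto simp: s_def)
      then show ?thesis by (simp only: distrib_left mult.assoc[symmetric] mult_1)
    qed
    also have "\<dots> \<le> k x - t * (q \<bullet> h) + C * (t\<^sup>2 * (norm h)\<^sup>2) + t * k (x + h)"
      using up[of "(- t) *\<^sub>R h"] by (simp add: power_mult_distrib)
    also have "C * (t\<^sup>2 * (norm h)\<^sup>2) \<le> \<bar>C\<bar> * (t\<^sup>2 * (norm h)\<^sup>2)" by (intro mult_right_mono) auto
    finally have "t * (k x + q \<bullet> h) \<le> t * (k (x + h) + t * (\<bar>C\<bar> * (norm h)\<^sup>2))"
      by (simp add: algebra_simps power2_eq_square)
    then show ?thesis using that by simp
  qed
  have "((\<lambda>t. k (x + h) + t * (\<bar>C\<bar> * (norm h)\<^sup>2)) \<longlongrightarrow> k (x + h) + 0 * (\<bar>C\<bar> * (norm h)\<^sup>2)) (at_right 0)"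
    by (intro tendsto_intros)
  then show ?thesis
    by (intro tendsto_lowerbound[of "\<lambda>t. k (x + h) + t * (\<bar>C\<bar> * (norm h)\<^sup>2)"])
      (use * in \<open>auto simp: eventually_at_filter\<close>)
qed

lemma touching_slope_unique:
  fixes \<phi> :: "'a::real_inner \<Rightarrow> real"
  assumes up: "\<And>y. \<phi> y \<le> \<phi> x + p \<bullet> (y - x) + C * (norm (y - x))\<^sup>2"
    and lo: "\<And>y. \<phi> y \<ge> \<phi> x + q \<bullet> (y - x) - D * (norm (y - x))\<^sup>2"
  shows "p = q"
proof (rule ccontr)
  assume "p \<noteq> q"
  define r where "r = p - q"
  have r: "r \<bullet> r > 0" using \<open>p \<noteq> q\<close> by (simp add: r_def)
  \<comment> \<open>A step along q - p gains linearly in \<open>t\<close> and loses quadratically;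
    this \<open>t\<close> makes (C + D) t < 1 whatever the signs of \<open>C\<close> and
    \<open>D\<close>.\<close>
  define t where "t = 1 / (2 * (\<bar>C + D\<bar> + 1))"
  have "0 < \<bar>C + D\<bar> + 1" by (rule add_nonneg_pos) auto
  then have t: "t > 0" unfolding t_def by simp
  have "0 \<le> r \<bullet> (- t *\<^sub>R r) + (C + D) * (norm (- t *\<^sub>R r))\<^sup>2"
    using up[of "x - t *\<^sub>R r"] lo[of "x - t *\<^sub>R r"]
    by (simp add: r_def inner_diff_left algebra_simps)
  also have "\<dots> = t * (r \<bullet> r) * ((C + D) * t - 1)"
    by (simp add: power_mult_distrib power2_norm_eq_inner) (simp add: algebra_simps power2_eq_square)
  finally have "0 \<le> t * (r \<bullet> r) * ((C + D) * t - 1)" .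
  moreover have "0 < t * (r \<bullet> r)" using t r by (rule mult_pos_pos)
  ultimately have "0 \<le> (C + D) * t - 1" by (simp add: zero_le_mult_iff)
  moreover have "(C + D) * t < 1"
  proof -
    have "(C + D) * t \<le> \<bar>C + D\<bar> * t" using t by (intro mult_right_mono) auto
    also have "\<dots> < (\<bar>C + D\<bar> + 1) * t" using t by (intro mult_strict_right_mono) auto
    also have "\<dots> = 1 / 2" using \<open>0 < \<bar>C + D\<bar> + 1\<close> by (simp add: t_def)
    finally show ?thesis by simp
  qed
  ultimately show False by simp
qed

text \<open>Everything is compared at the scale d = |x1 - x2|, at the point x2 + h with |h| = d
  along p2 - p1. The factor 6 is 1 + 4 + 1: the error at x2 + h seen from \<open>x2\<close>, the
  same seen from \<open>x1\<close> at distance up to 2 d, and the error at \<open>x2\<close> seen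
  from \<open>x1\<close>. For x1 = x2 the claim is uniqueness of the slope.\<close>

lemma touching_slope_lipschitz:
  fixes \<phi> :: "'a::real_inner \<Rightarrow> real"
  assumes x: "\<And>y. \<bar>\<phi> y - \<phi> x1 - p1 \<bullet> (y - x1)\<bar> \<le> C * (norm (y - x1))\<^sup>2"
    and y: "\<And>y. \<bar>\<phi> y - \<phi> x2 - p2 \<bullet> (y - x2)\<bar> \<le> C * (norm (y - x2))\<^sup>2"
  shows "norm (p1 - p2) \<le> 6 * C * norm (x1 - x2)"
proof (cases "x1 = x2")
  case True
  have "p1 = p2"
  proof (rule touching_slope_unique)
    show "\<phi> y \<le> \<phi> x1 + p1 \<bullet> (y - x1) + C * (norm (y - x1))\<^sup>2" for y using x[of y] by linarith
    show "\<phi> x1 + p2 \<bullet> (z - x1) - C * (norm (z - x1))\<^sup>2 \<le> \<phi> z" for z using y[of z] True by (simp add: abs_le_iff)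
  qed
  then show ?thesis using True by simp
next
  case False
  define d where "d = norm (x2 - x1)"
  have d: "d > 0" using False by (simp add: d_def)
  have C: "C \<ge> 0" using x[of x2] d abs_ge_zero[of "\<phi> x2 - \<phi> x1 - p1 \<bullet> (x2 - x1)"]
    unfolding d_def[symmetric] by (smt (verit) mult_neg_pos zero_less_power)
  define r where "r = p2 - p1"
  show ?thesis
  proof (cases "r = 0")
    case True
    then show ?thesis using C by (simp add: r_def)
  next
    case False
    define h where "h = (d / norm r) *\<^sub>R r"
    have nh: "norm h = d" using False d by (simp add: h_def)
    have 1: "\<phi> (x2 + h) \<ge> \<phi> x2 + p2 \<bullet> h - C * d\<^sup>2" using y[of "x2 + h"] nh by (simp add: abs_le_iff)
    have "norm (x2 + h - x1) \<le> 2 * d"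
      using norm_triangle_ineq[of "x2 - x1" h] nh by (simp add: d_def algebra_simps)
    then have "(norm (x2 + h - x1))\<^sup>2 \<le> (2 * d)\<^sup>2" by (intro power_mono) auto
    then have "C * (norm (x2 + h - x1))\<^sup>2 \<le> C * (4 * d\<^sup>2)" using C by (intro mult_left_mono) auto
    then have 2: "\<phi> (x2 + h) \<le> \<phi> x1 + p1 \<bullet> (x2 + h - x1) + C * (4 * d\<^sup>2)"
      using x[of "x2 + h"] by linarith
    have 3: "\<phi> x2 \<ge> \<phi> x1 + p1 \<bullet> (x2 - x1) - C * d\<^sup>2" using x[of x2] by (simp add: d_def abs_le_iff)
    have "p1 \<bullet> (x2 + h - x1) = p1 \<bullet> (x2 - x1) + p1 \<bullet> h" by (simp add: inner_diff_right inner_add_right)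
    with 1 2 3 have "r \<bullet> h \<le> 6 * C * d\<^sup>2" by (simp add: r_def inner_diff_left)
    moreover have "r \<bullet> h = norm r * d" using False by (simp add: h_def flip: power2_norm_eq_inner) (simp add: power2_eq_square)
    ultimately have "norm r \<le> 6 * C * d" using d by (simp add: power2_eq_square)
    then show ?thesis by (simp add: r_def d_def norm_minus_commute)
  qed
qed

lemma has_derivative_if_quadratic_bound:
  fixes \<phi> :: "'a::real_inner \<Rightarrow> real"
  assumes "\<And>y. \<bar>\<phi> y - \<phi> x - p \<bullet> (y - x)\<bar> \<le> C * (norm (y - x))\<^sup>2"
  shows "(\<phi> has_derivative (\<lambda>h. p \<bullet> h)) (at x)"
  unfolding has_derivative_at_alt
proof (intro conjI allI impI)
  show "bounded_linear (\<lambda>h. p \<bullet> h)" by (rule bounded_linear_inner_right)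
  fix e :: real assume e: "e > 0"
  show "\<exists>d>0. \<forall>y. norm (y - x) < d \<longrightarrow> norm (\<phi> y - \<phi> x - p \<bullet> (y - x)) \<le> e * norm (y - x)"
  proof (intro exI[of _ "e / (\<bar>C\<bar> + 1)"] conjI allI impI)
    show "e / (\<bar>C\<bar> + 1) > 0" using e by simp
    fix y assume y: "norm (y - x) < e / (\<bar>C\<bar> + 1)"
    have "C * norm (y - x) \<le> \<bar>C\<bar> * norm (y - x)" by (intro mult_right_mono) auto
    also have "\<dots> \<le> (\<bar>C\<bar> + 1) * norm (y - x)" by (intro mult_right_mono) auto
    also have "\<dots> \<le> e" using y by (simp add: field_simps)
    finally have "C * norm (y - x) * norm (y - x) \<le> e * norm (y - x)" by (intro mult_right_mono) auto
    then show "norm (\<phi> y - \<phi> x - p \<bullet> (y - x)) \<le> e * norm (y - x)"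
      using assms[of y] by (simp add: power2_eq_square mult.assoc)
  qed
qed

text \<open>The derivative \<open>A\<close> of \<open>G\<close> is replaced by its symmetric part,
  which has the same quadratic form. The mean value theorem on the segment from x to x + h, after
  subtraction of the quadratic candidate, makes differentiability of \<open>G\<close> at the single
  point \<open>x\<close> enough.\<close>

lemma second_order_expansion:
  fixes \<phi> :: "'a::euclidean_space \<Rightarrow> real" and G :: "'a \<Rightarrow> 'a"
  assumes d: "\<And>y. (\<phi> has_derivative (\<lambda>h. G y \<bullet> h)) (at y)" and G: "G differentiable (at x)"
  obtains T where "linear T" "\<And>h k. T h \<bullet> k = h \<bullet> T k"
    "\<And>e. e > 0 \<Longrightarrow> \<exists>\<rho>>0. \<forall>h. norm h < \<rho> \<longrightarrow> \<bar>\<phi> (x + h) - \<phi> x - G x \<bullet> h - (T h \<bullet> h) / 2\<bar> \<le> e * (norm h)\<^sup>2"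
proof -
  obtain A where A: "(G has_derivative A) (at x)" using G by (auto simp: differentiable_def)
  have linA: "linear A" using has_derivative_linear[OF A] .
  define T where "T h = (1/2) *\<^sub>R (A h + adjoint A h)" for h
  have "linear T" unfolding T_def
    by (intro linear_compose_scale_right linear_compose_add linA adjoint_linear)
  moreover have "T h \<bullet> k = h \<bullet> T k" for h k
    by (simp add: T_def inner_add adjoint_works[OF linA] adjoint_clauses[OF linA])
  moreover have Th: "T h \<bullet> h = A h \<bullet> h" for h
    by (simp add: T_def inner_add_left adjoint_works[OF linA] inner_commute[of "adjoint A h" h])
  have "\<exists>\<rho>>0. \<forall>h. norm h < \<rho> \<longrightarrow> \<bar>\<phi> (x + h) - \<phi> x - G x \<bullet> h - (T h \<bullet> h) / 2\<bar> \<le> e * (norm h)\<^sup>2" if "e > 0" for e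
  proof -
    obtain \<rho> where \<rho>: "\<rho> > 0" "\<And>y. norm (y - x) < \<rho> \<Longrightarrow> norm (G y - G x - A (y - x)) \<le> e * norm (y - x)"
      using A \<open>e > 0\<close> unfolding has_derivative_at_alt by blast
    have "\<bar>\<phi> (x + h) - \<phi> x - G x \<bullet> h - (T h \<bullet> h) / 2\<bar> \<le> e * (norm h)\<^sup>2" if h: "norm h < \<rho>" for h
    proof -
      define \<psi> where "\<psi> t = \<phi> (x + t *\<^sub>R h) - t * (G x \<bullet> h) - t\<^sup>2 * (A h \<bullet> h) / 2" for t :: real
      define \<psi>' where "\<psi>' t = (G (x + t *\<^sub>R h) - G x - A (t *\<^sub>R h)) \<bullet> h" for t :: real
      have der: "(\<psi> has_derivative (\<lambda>s. s * \<psi>' t)) (at t within {0..1})" for t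
      proof -
        have "((\<lambda>t. \<phi> (x + t *\<^sub>R h)) has_derivative (\<lambda>s. G (x + t *\<^sub>R h) \<bullet> (s *\<^sub>R h))) (at t within {0..1})"
          by (rule has_derivative_compose[where g = \<phi>, OF _ d]) (auto intro!: derivative_eq_intros)
        then show ?thesis unfolding \<psi>_def[abs_def] \<psi>'_def
          by - ((rule derivative_eq_intros refl | assumption | simp)+,
              auto simp: fun_eq_iff linear_cmul[OF linA] inner_diff_left algebra_simps)
      qed
      have bound: "\<bar>\<psi>' t\<bar> \<le> e * (norm h)\<^sup>2" if "t \<in> {0..1}" for t
      proof -
        have nt: "norm (t *\<^sub>R h) \<le> norm h" using that by (simp add: mult_left_le_one_le)
        have "\<bar>\<psi>' t\<bar> \<le> norm (G (x + t *\<^sub>R h) - G x - A (t *\<^sub>R h)) * norm h"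
          unfolding \<psi>'_def by (rule Cauchy_Schwarz_ineq2)
        also have "\<dots> \<le> (e * norm (t *\<^sub>R h)) * norm h"
          using \<rho>(2)[of "x + t *\<^sub>R h"] nt h by (intro mult_right_mono) auto
        also have "\<dots> \<le> (e * norm h) * norm h"
          using nt \<open>e > 0\<close> by (intro mult_right_mono mult_left_mono) auto
        finally show ?thesis by (simp add: power2_eq_square mult.assoc)
      qed
      have "\<exists>t\<in>{0<..<1}. \<psi> 1 - \<psi> 0 = (1 - 0) * \<psi>' t"
        by (rule mvt_simple[where f' = "\<lambda>t s. s * \<psi>' t"]) (use der in auto)
      then obtain t where "t \<in> {0<..<1}" "\<psi> 1 - \<psi> 0 = \<psi>' t" by auto
      with bound[of t] have "\<bar>\<psi> 1 - \<psi> 0\<bar> \<le> e * (norm h)\<^sup>2" by auto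
      then show ?thesis by (simp add: \<psi>_def Th algebra_simps)
    qed
    with \<rho>(1) show ?thesis by blast
  qed
  ultimately show thesis using that by blast
qed

section \<open>Sup-convolutions\<close>

definition sup_conv :: "'a::real_inner set \<Rightarrow> real \<Rightarrow> ('a \<Rightarrow> real) \<Rightarrow> 'a \<Rightarrow> real" where
  "sup_conv K c g y = (SUP z\<in>K. g z - c * (norm (y - z))\<^sup>2)"

lemma sup_conv_attained:
  assumes "compact K" "K \<noteq> {}" "usc_on K g"
  obtains z where "z \<in> K" "sup_conv K c g y = g z - c * (norm (y - z))\<^sup>2"
    "\<And>w. w \<in> K \<Longrightarrow> g w - c * (norm (y - w))\<^sup>2 \<le> sup_conv K c g y"
proof -
  have "usc_on K (\<lambda>z. g z + - (c * (norm (y - z))\<^sup>2))"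
    by (intro usc_on_add_continuous assms continuous_intros)
  from usc_on_attains_sup[OF assms(1,2) this]
  obtain z where z: "z \<in> K" "\<And>w. w \<in> K \<Longrightarrow> g w - c * (norm (y - w))\<^sup>2 \<le> g z - c * (norm (y - z))\<^sup>2"
    by auto
  then have "sup_conv K c g y = g z - c * (norm (y - z))\<^sup>2"
    unfolding sup_conv_def by (intro cSup_eq_maximum) auto
  with z that show thesis by simp
qed

lemma sup_conv_ge:
  assumes "compact K" "usc_on K g" "w \<in> K"
  shows "g w - c * (norm (y - w))\<^sup>2 \<le> sup_conv K c g y"
  using sup_conv_attained[of K g c y] assms by blast

text \<open>Adding c |y|^2 makes every competitor affine in \<open>y\<close>, and a supremum of
  affine functions is convex. Continuity is a consequence, the dimension being finite.\<close>

lemma convex_on_sup_conv: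
  fixes K :: "'a::real_inner set"
  assumes "compact K" "K \<noteq> {}" "usc_on K g"
  shows "convex_on UNIV (\<lambda>y. sup_conv K c g y + c * (norm y)\<^sup>2)"
proof (rule convex_onI)
  fix t :: real and x y :: 'a assume t: "0 < t" "t < 1"
  define m where "m = (1 - t) *\<^sub>R x + t *\<^sub>R y"
  obtain z where z: "z \<in> K" "sup_conv K c g m = g z - c * (norm (m - z))\<^sup>2"
    using sup_conv_attained[OF assms] by blast
  have aff: "g z - c * (norm (v - z))\<^sup>2 + c * (norm v)\<^sup>2 = g z - c * (norm z)\<^sup>2 + 2 * c * (v \<bullet> z)" for v
    by (simp add: power2_norm_eq_inner inner_diff_left inner_diff_right inner_commute algebra_simps)
  have "sup_conv K c g m + c * (norm m)\<^sup>2 = g z - c * (norm z)\<^sup>2 + 2 * c * (m \<bullet> z)"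
    using z aff[of m] by simp
  also have "\<dots> = (1 - t) * (g z - c * (norm z)\<^sup>2 + 2 * c * (x \<bullet> z)) + t * (g z - c * (norm z)\<^sup>2 + 2 * c * (y \<bullet> z))"
    by (simp add: m_def inner_add_left algebra_simps)
  also have "\<dots> \<le> (1 - t) * (sup_conv K c g x + c * (norm x)\<^sup>2) + t * (sup_conv K c g y + c * (norm y)\<^sup>2)"
    unfolding aff[symmetric] using t sup_conv_ge[OF assms(1,3) z(1), where c = c]
    by (intro add_mono[OF mult_left_mono mult_left_mono]) auto
  finally show "sup_conv K c g ((1 - t) *\<^sub>R x + t *\<^sub>R y) + c * (norm ((1 - t) *\<^sub>R x + t *\<^sub>R y))\<^sup>2 \<le>
      (1 - t) * (sup_conv K c g x + c * (norm x)\<^sup>2) + t * (sup_conv K c g y + c * (norm y)\<^sup>2)"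
    unfolding m_def .
qed simp

lemma continuous_on_sup_conv:
  fixes K :: "'a::euclidean_space set"
  assumes "compact K" "K \<noteq> {}" "usc_on K g"
  shows "continuous_on UNIV (sup_conv K c g)"
proof -
  have "continuous_on UNIV (\<lambda>y. (sup_conv K c g y + c * (norm y)\<^sup>2) - c * (norm y)\<^sup>2)"
    by (intro continuous_on_diff convex_on_continuous convex_on_sup_conv assms continuous_intros) auto
  then show ?thesis by simp
qed

section \<open>Regularisation and contact points\<close>

text \<open>An inf-convolution applied to a sup-convolution. The opening 3 \<alpha> exceeds the
  opening \<alpha> at which the latter can fall off, so the infimum is finite and attained.\<close>

definition lasry_lions :: "'a::real_inner set \<Rightarrow> real \<Rightarrow> ('a \<Rightarrow> real) \<Rightarrow> 'a \<Rightarrow> real" where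
  "lasry_lions K \<alpha> g x = (INF y. sup_conv K \<alpha> g y + 3 * \<alpha> * (norm (x - y))\<^sup>2)"

locale regularisation =
  fixes K :: "'a::euclidean_space set" and g :: "'a \<Rightarrow> real" and \<alpha> :: real
  assumes compact: "compact K" and nonempty: "K \<noteq> {}" and usc: "usc_on K g" and \<alpha>: "\<alpha> > 0"
begin

abbreviation "S \<equiv> sup_conv K \<alpha> g"
abbreviation "V \<equiv> lasry_lions K \<alpha> g"

lemma S_ge: "z \<in> K \<Longrightarrow> g z - \<alpha> * (norm (y - z))\<^sup>2 \<le> S y"
  by (rule sup_conv_ge[OF compact usc])

lemma S_attained: obtains z where "z \<in> K" "S y = g z - \<alpha> * (norm (y - z))\<^sup>2"
  using sup_conv_attained[OF compact nonempty usc, of \<alpha> y] by blast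

lemma V_attained:
  obtains y where "V x = S y + 3 * \<alpha> * (norm (x - y))\<^sup>2" "\<And>w. V x \<le> S w + 3 * \<alpha> * (norm (x - w))\<^sup>2"
proof -
  define h where "h y = S y + 3 * \<alpha> * (norm (x - y))\<^sup>2" for y
  obtain z where z: "z \<in> K" using nonempty by blast
  \<comment> \<open>The parallelogram identity bounds the fall of \<open>S\<close> by 2 \<alpha> |x
    - y|^2 up to a constant, and the penalty 3 \<alpha> |x - y|^2 leaves a surplus of \<alpha> |x -
    y|^2.\<close>
  have "h y \<ge> (g z - 2 * \<alpha> * (norm (x - z))\<^sup>2) + \<alpha> * (norm (y - x))\<^sup>2" for y
  proof -
    have "(norm (y - z))\<^sup>2 + (norm ((x - y) + (x - z)))\<^sup>2 = 2 * (norm (x - y))\<^sup>2 + 2 * (norm (x - z))\<^sup>2"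
      by (simp add: power2_norm_eq_inner inner_diff_left inner_diff_right inner_add_left inner_add_right inner_commute algebra_simps)
    then have "(norm (y - z))\<^sup>2 \<le> 2 * (norm (x - y))\<^sup>2 + 2 * (norm (x - z))\<^sup>2"
      using zero_le_power2[of "norm ((x - y) + (x - z))"] by linarith
    then have "\<alpha> * (norm (y - z))\<^sup>2 \<le> \<alpha> * (2 * (norm (x - y))\<^sup>2 + 2 * (norm (x - z))\<^sup>2)"
      using \<alpha> by (intro mult_left_mono) auto
    then show ?thesis using S_ge[OF z, of y] unfolding h_def by (simp add: norm_minus_commute algebra_simps)
  qed
  moreover have "continuous_on UNIV h"
    unfolding h_def by (intro continuous_intros continuous_on_sup_conv compact nonempty usc)
  ultimately have "\<exists>y. \<forall>w. h y \<le> h w" using coercive_attains_inf[of h \<alpha>] \<alpha> by blast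
  then obtain y where y: "\<And>w. h y \<le> h w" by blast
  then have "V x = h y"
    unfolding lasry_lions_def h_def[symmetric] by (intro cInf_eq_minimum) auto
  with y show thesis using that unfolding h_def by auto
qed

lemma V_le: "V x \<le> S w + 3 * \<alpha> * (norm (x - w))\<^sup>2"
  using V_attained[of x] by blast

text \<open>3/2 is the least factor for which the square can be completed. Equality in this step
  means x = (2 y + z) / 3, the point that reappears in \<open>V_contact\<close>.\<close>

lemma V_ge: "z \<in> K \<Longrightarrow> g z - 3 / 2 * \<alpha> * (norm (x - z))\<^sup>2 \<le> V x"
proof -
  assume z: "z \<in> K"
  obtain y where y: "V x = S y + 3 * \<alpha> * (norm (x - y))\<^sup>2" using V_attained by blast
  have "3 * (norm (x - y))\<^sup>2 + 3 / 2 * (norm (x - z))\<^sup>2 - (norm (y - z))\<^sup>2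
      = 2 * (norm ((x - y) + (1/2) *\<^sub>R (x - z)))\<^sup>2"
    by (simp add: power2_norm_eq_inner inner_diff_left inner_diff_right inner_add_left inner_add_right inner_commute algebra_simps add_divide_distrib)
  then have "(norm (y - z))\<^sup>2 \<le> 3 * (norm (x - y))\<^sup>2 + 3 / 2 * (norm (x - z))\<^sup>2"
    using zero_le_power2[of "norm ((x - y) + (1/2) *\<^sub>R (x - z))"] by linarith
  then have "\<alpha> * (norm (y - z))\<^sup>2 \<le> \<alpha> * (3 * (norm (x - y))\<^sup>2 + 3 / 2 * (norm (x - z))\<^sup>2)"
    using \<alpha> by (intro mult_left_mono) auto
  then show ?thesis using y S_ge[OF z, of y] by (simp add: algebra_simps)
qed

text \<open>With 3/2 \<alpha> |x|^2 added, the function under the infimum becomes \<open>k y\<close>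
  + 2 \<alpha> |y - 3/2 x|^2 with \<open>k\<close> convex. This is jointly convex in x and y, and
  partial minimisation preserves convexity.\<close>

lemma convex_V: "convex_on UNIV (\<lambda>x. V x + 3 / 2 * \<alpha> * (norm x)\<^sup>2)"
proof (rule convex_onI)
  fix t :: real and a b :: 'a assume t: "0 < t" "t < 1"
  define k where "k = (\<lambda>y. S y + \<alpha> * (norm y)\<^sup>2)"
  have sq: "S y + 3 * \<alpha> * (norm (x - y))\<^sup>2 + 3 / 2 * \<alpha> * (norm x)\<^sup>2 = k y + 2 * \<alpha> * (norm (y - (3/2) *\<^sub>R x))\<^sup>2" for x y
    by (simp add: k_def power2_norm_eq_inner inner_diff_left inner_diff_right inner_commute algebra_simps)
  have cq: "convex_on UNIV (\<lambda>x::'a. (norm x)\<^sup>2)"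
  proof (rule convex_onI)
    fix t :: real and x y :: 'a assume t: "0 < t" "t < 1"
    have "(1 - t) * (norm x)\<^sup>2 + t * (norm y)\<^sup>2 - (norm ((1 - t) *\<^sub>R x + t *\<^sub>R y))\<^sup>2 = t * (1 - t) * (norm (x - y))\<^sup>2"
      by (simp add: power2_norm_eq_inner inner_diff_left inner_diff_right inner_add_left inner_add_right inner_commute algebra_simps)
    moreover have "0 \<le> t * (1 - t) * (norm (x - y))\<^sup>2" using t by simp
    ultimately show "(norm ((1 - t) *\<^sub>R x + t *\<^sub>R y))\<^sup>2 \<le> (1 - t) * (norm x)\<^sup>2 + t * (norm y)\<^sup>2" by linarith
  qed simp
  define c where "c = (1 - t) *\<^sub>R a + t *\<^sub>R b"
  obtain ya where ya: "V a = S ya + 3 * \<alpha> * (norm (a - ya))\<^sup>2" using V_attained by blast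
  obtain yb where yb: "V b = S yb + 3 * \<alpha> * (norm (b - yb))\<^sup>2" using V_attained by blast
  define y where "y = (1 - t) *\<^sub>R ya + t *\<^sub>R yb"
  have 1: "k y \<le> (1 - t) * k ya + t * k yb"
    unfolding y_def using convex_onD[OF convex_on_sup_conv[OF compact nonempty usc, of \<alpha>], of t ya yb] t
    by (simp add: k_def)
  have "y - r *\<^sub>R c = (1 - t) *\<^sub>R (ya - r *\<^sub>R a) + t *\<^sub>R (yb - r *\<^sub>R b)" for r
    by (simp add: y_def c_def algebra_simps)
  from this[of "3/2"] have "(norm (y - (3/2) *\<^sub>R c))\<^sup>2 \<le> (1 - t) * (norm (ya - (3/2) *\<^sub>R a))\<^sup>2 + t * (norm (yb - (3/2) *\<^sub>R b))\<^sup>2"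
    using convex_onD[OF cq, of t "ya - (3/2) *\<^sub>R a" "yb - (3/2) *\<^sub>R b"] t by simp
  then have 2: "2 * \<alpha> * (norm (y - (3/2) *\<^sub>R c))\<^sup>2 \<le>
      2 * \<alpha> * ((1 - t) * (norm (ya - (3/2) *\<^sub>R a))\<^sup>2 + t * (norm (yb - (3/2) *\<^sub>R b))\<^sup>2)"
    using \<alpha> by (intro mult_left_mono) auto
  have "V c + 3 / 2 * \<alpha> * (norm c)\<^sup>2 \<le> k y + 2 * \<alpha> * (norm (y - (3/2) *\<^sub>R c))\<^sup>2"
    using V_le[of c y] sq[of y c] by linarith
  also have "\<dots> \<le> (1 - t) * (k ya + 2 * \<alpha> * (norm (ya - (3/2) *\<^sub>R a))\<^sup>2) + t * (k yb + 2 * \<alpha> * (norm (yb - (3/2) *\<^sub>R b))\<^sup>2)"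
    using 1 2 by (simp add: algebra_simps)
  also have "\<dots> = (1 - t) * (V a + 3 / 2 * \<alpha> * (norm a)\<^sup>2) + t * (V b + 3 / 2 * \<alpha> * (norm b)\<^sup>2)"
    unfolding ya yb sq ..
  finally show "V ((1 - t) *\<^sub>R a + t *\<^sub>R b) + 3 / 2 * \<alpha> * (norm ((1 - t) *\<^sub>R a + t *\<^sub>R b))\<^sup>2
      \<le> (1 - t) * (V a + 3 / 2 * \<alpha> * (norm a)\<^sup>2) + t * (V b + 3 / 2 * \<alpha> * (norm b)\<^sup>2)"
    unfolding c_def .
qed simp

definition Y :: "'a \<Rightarrow> 'a" where
  "Y x = (SOME y. V x = S y + 3 * \<alpha> * (norm (x - y))\<^sup>2)"

text \<open>The gradient at \<open>x\<close> of the paraboloid centred at \<open>Y x\<close> that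
  touches \<open>V\<close> from above. By \<open>V_has_derivative\<close> it is the gradient of
  \<open>V\<close>, hence independent of the choice made in \<open>Y\<close>.\<close>

definition G :: "'a \<Rightarrow> 'a" where
  "G x = (6 * \<alpha>) *\<^sub>R (x - Y x)"

lemma V_eq_Y: "V x = S (Y x) + 3 * \<alpha> * (norm (x - Y x))\<^sup>2"
  unfolding Y_def by (rule someI_ex) (use V_attained in blast)

lemma V_upper: "V x' \<le> V x + G x \<bullet> (x' - x) + 3 * \<alpha> * (norm (x' - x))\<^sup>2"
proof -
  have "(norm (x' - Y x))\<^sup>2 = (norm (x - Y x))\<^sup>2 + 2 * ((x - Y x) \<bullet> (x' - x)) + (norm (x' - x))\<^sup>2"
    by (simp add: power2_norm_eq_inner inner_diff_left inner_diff_right inner_commute)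
  then show ?thesis using V_le[of x' "Y x"] unfolding V_eq_Y[of x]
    by (simp add: G_def distrib_left mult.assoc)
qed

text \<open>Convexity of V + 3/2 \<alpha> |x|^2 provides a supporting slope; the touching from above
  in \<open>V_upper\<close> identifies it. The constant 9/2 is 3 + 3/2.\<close>

lemma V_lower: "V x' \<ge> V x + G x \<bullet> (x' - x) - 3 / 2 * \<alpha> * (norm (x' - x))\<^sup>2"
proof -
  define k where "k = (\<lambda>x. V x + 3 / 2 * \<alpha> * (norm x)\<^sup>2)"
  have sq: "(norm (x + h))\<^sup>2 = (norm x)\<^sup>2 + 2 * (x \<bullet> h) + (norm h)\<^sup>2" for h
    by (rule norm_add_sq)
  have "k x + (G x + (3 * \<alpha>) *\<^sub>R x) \<bullet> (x' - x) \<le> k (x + (x' - x))"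
  proof (rule convex_on_lower_tangent)
    show "convex_on UNIV k" unfolding k_def by (rule convex_V)
    show "k (x + h) \<le> k x + (G x + (3 * \<alpha>) *\<^sub>R x) \<bullet> h + (9 / 2 * \<alpha>) * (norm h)\<^sup>2" for h
      using V_upper[of "x + h" x] unfolding k_def sq by (simp add: inner_add_left ring_distribs)
  qed
  then have "V x + 3 / 2 * \<alpha> * (norm x)\<^sup>2 + (G x \<bullet> (x' - x) + 3 * \<alpha> * (x \<bullet> (x' - x))) \<le> V x' + 3 / 2 * \<alpha> * (norm x')\<^sup>2"
    by (simp add: k_def inner_add_left)
  moreover have "(norm x')\<^sup>2 = (norm x)\<^sup>2 + 2 * (x \<bullet> (x' - x)) + (norm (x' - x))\<^sup>2"
    using sq[of "x' - x"] by simp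
  ultimately show ?thesis by (simp add: ring_distribs)
qed

lemma V_quadratic_bound: "\<bar>V y - V x - G x \<bullet> (y - x)\<bar> \<le> 3 * \<alpha> * (norm (y - x))\<^sup>2"
proof -
  have "0 \<le> \<alpha> * (norm (y - x))\<^sup>2" using \<alpha> by simp
  then show ?thesis using V_upper[of y x] V_lower[of x y] by (simp add: abs_le_iff)
qed

lemma V_has_derivative: "(V has_derivative (\<lambda>h. G x \<bullet> h)) (at x)"
  by (rule has_derivative_if_quadratic_bound[OF V_quadratic_bound])

lemma G_lipschitz: "norm (G x - G y) \<le> 18 * \<alpha> * norm (x - y)"
  using touching_slope_lipschitz[OF V_quadratic_bound V_quadratic_bound, of x y] by simp

lemma continuous_V: "continuous_on UNIV V"
  using V_has_derivative by (meson has_derivative_continuous_on has_derivative_at_withinI)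

text \<open>The maximiser \<open>x\<close> of \<open>V - 3 \<alpha> |\<cdot> - y|\<^sup>2\<close> is unique, because \<open>V\<close> lies below a paraboloid of
  smaller opening, and the point dividing the segment from \<open>y\<close> to \<open>z\<close> in the ratio 1:2 is also a
  maximiser.\<close>
lemma V_contact:
  assumes up: "\<And>x'. V x' \<le> V x + P \<bullet> (x' - x) + 3 / 2 * \<alpha> * (norm (x' - x))\<^sup>2"
  shows "G x = P" "\<exists>z\<in>K. V x = g z - 3 / 2 * \<alpha> * (norm (x - z))\<^sup>2"
proof -
  have "P = G x"
  proof (rule touching_slope_unique)
    show "V y \<le> V x + P \<bullet> (y - x) + 3 / 2 * \<alpha> * (norm (y - x))\<^sup>2" for y by (rule up)
    show "V y \<ge> V x + G x \<bullet> (y - x) - 3 / 2 * \<alpha> * (norm (y - x))\<^sup>2" for y by (rule V_lower)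
  qed
  then show GP: "G x = P" ..
  define y where "y = Y x"
  obtain z where z: "z \<in> K" "S y = g z - \<alpha> * (norm (y - z))\<^sup>2" using S_attained by blast
  define D where "D = (norm (y - z))\<^sup>2"
  \<comment> \<open>The displacement from \<open>x\<close> to (2 y + z) / 3. Comparing
    \<open>V_ge\<close> with the assumed upper paraboloid at \<open>x + e\<close> leaves \<alpha>
    |e|^2 \<le> 0.\<close>
  define e where "e = (1/3) *\<^sub>R (2 *\<^sub>R y + z) - x"
  have Vx: "V x = g z - \<alpha> * D + 3 * \<alpha> * (norm (x - y))\<^sup>2"
    using V_eq_Y[of x] z by (simp add: y_def D_def)
  have "x + e - z = (2/3) *\<^sub>R (y - z)"
    by (simp add: e_def scaleR_right_diff_distrib scaleR_add_right) (simp add: algebra_simps flip: scaleR_add_left scaleR_diff_left)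
  then have n1: "(norm (x + e - z))\<^sup>2 = 4 / 9 * D"
    by (simp add: D_def power_mult_distrib power2_eq_square)
  have "(x - y) + e = (1/3) *\<^sub>R (z - y)"
    by (simp add: e_def scaleR_right_diff_distrib scaleR_add_right) (simp add: algebra_simps flip: scaleR_add_left scaleR_diff_left)
  then have "(norm ((x - y) + e))\<^sup>2 = (norm ((1/3) *\<^sub>R (z - y)))\<^sup>2" by simp
  also have "\<dots> = 1 / 9 * D" by (simp add: D_def power_mult_distrib power2_eq_square norm_minus_commute)
  finally have n2: "(norm (x - y))\<^sup>2 + 2 * ((x - y) \<bullet> e) + (norm e)\<^sup>2 = 1 / 9 * D"
    unfolding norm_add_sq .
  have "g z - 3 / 2 * \<alpha> * (4 / 9 * D) \<le> V (x + e)" using V_ge[OF z(1), of "x + e"] n1 by simp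
  also have "\<dots> \<le> V x + 6 * \<alpha> * ((x - y) \<bullet> e) + 3 / 2 * \<alpha> * (norm e)\<^sup>2"
    using up[of "x + e"] GP[symmetric] by (simp add: G_def y_def)
  finally have "g z - 3 / 2 * \<alpha> * (4 / 9 * D) \<le>
      g z - \<alpha> * D + 3 * \<alpha> * (norm (x - y))\<^sup>2 + 6 * \<alpha> * ((x - y) \<bullet> e) + 3 / 2 * \<alpha> * (norm e)\<^sup>2"
    unfolding Vx .
  also have "\<dots> = g z - \<alpha> * D + 3 * \<alpha> * ((norm (x - y))\<^sup>2 + 2 * ((x - y) \<bullet> e) + (norm e)\<^sup>2) - 3 / 2 * \<alpha> * (norm e)\<^sup>2"
    by (simp add: algebra_simps)
  finally have "\<alpha> * (norm e)\<^sup>2 \<le> 0" unfolding n2 by (simp add: algebra_simps)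
  then have "e = 0" using \<alpha> by (simp add: mult_le_0_iff)
  then have n: "(norm (x - z))\<^sup>2 = 4 / 9 * D" "(norm (x - y))\<^sup>2 = 1 / 9 * D" using n1 n2 by simp_all
  have "V x = g z - 3 / 2 * \<alpha> * (norm (x - z))\<^sup>2"
    using Vx unfolding n by (simp add: algebra_simps)
  then show "\<exists>z\<in>K. V x = g z - 3 / 2 * \<alpha> * (norm (x - z))\<^sup>2" using z(1) by blast
qed

end

section \<open>Contact points of the two regularisations\<close>

locale contact = regularisation K g \<alpha> for K :: "'a::euclidean_space set" and g \<alpha> +
  fixes w :: "'a \<Rightarrow> real"
  assumes usc_w: "usc_on K w"
begin

abbreviation "W \<equiv> sup_conv K (3 / 2 * \<alpha>) w"

text \<open>Here \<open>w\<close> stands for -u, so \<open>W\<close> is minus the inf-convolution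
  \<open>U\<close> and the maximised function is V - U - p x.\<close>

definition contact_point :: "'a \<Rightarrow> 'a \<Rightarrow> bool" where
  "contact_point p x \<longleftrightarrow> (\<forall>x'. V x' + W x' - p \<bullet> x' \<le> V x + W x - p \<bullet> x)"

text \<open>\<open>V\<close> lies below \<open>S\<close>, which falls off at rate \<alpha> / 2 |x|^2
  because \<open>K\<close> is bounded, while \<open>W\<close> is bounded above. Half of the rate
  absorbs the linear term at the cost |p|^2 / \<alpha>; the other half is coercivity.\<close>

lemma contact_point_exists: "\<exists>x. contact_point p x"
proof -
  define h where "h x = p \<bullet> x - V x - W x" for x
  obtain R where R: "\<And>z. z \<in> K \<Longrightarrow> norm z \<le> R" "R > 0"
    using compact_imp_bounded[OF compact] unfolding bounded_pos by blast
  obtain z1 where z1: "\<And>z. z \<in> K \<Longrightarrow> g z \<le> g z1" using usc_on_attains_sup[OF compact nonempty usc] by blast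
  obtain z2 where z2: "\<And>z. z \<in> K \<Longrightarrow> w z \<le> w z2" using usc_on_attains_sup[OF compact nonempty usc_w] by blast
  define d where "d = - g z1 - w z2 - \<alpha> * R\<^sup>2 - (norm p)\<^sup>2 / \<alpha>"
  have "h x \<ge> d + \<alpha> / 4 * (norm (x - 0))\<^sup>2" for x
  proof -
    obtain z where z: "z \<in> K" "S x = g z - \<alpha> * (norm (x - z))\<^sup>2" using S_attained by blast
    obtain z' where z': "z' \<in> K" "W x = w z' - 3 / 2 * \<alpha> * (norm (x - z'))\<^sup>2"
      using sup_conv_attained[OF compact nonempty usc_w] by blast
    have "0 \<le> 3 / 2 * \<alpha> * (norm (x - z'))\<^sup>2" using \<alpha> by simp
    then have W: "W x \<le> w z2" using z' z2[OF z'(1)] by linarith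
    have "(norm x)\<^sup>2 \<le> 2 * (norm (x - z))\<^sup>2 + 2 * (norm z)\<^sup>2"
    proof -
      have "(norm x)\<^sup>2 + (norm ((x - z) - z))\<^sup>2 = 2 * (norm (x - z))\<^sup>2 + 2 * (norm z)\<^sup>2"
        by (simp add: power2_norm_eq_inner inner_diff_left inner_diff_right inner_commute algebra_simps)
      then show ?thesis using zero_le_power2[of "norm ((x - z) - z)"] by linarith
    qed
    moreover have "(norm z)\<^sup>2 \<le> R\<^sup>2" using R(1)[OF z(1)] by (intro power_mono) auto
    ultimately have "(norm x)\<^sup>2 / 2 - R\<^sup>2 \<le> (norm (x - z))\<^sup>2" by linarith
    then have "\<alpha> * ((norm x)\<^sup>2 / 2 - R\<^sup>2) \<le> \<alpha> * (norm (x - z))\<^sup>2" using \<alpha> by (intro mult_left_mono) auto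
    then have V: "V x \<le> g z1 - \<alpha> * ((norm x)\<^sup>2 / 2 - R\<^sup>2)"
      using V_le[of x x] z z1[OF z(1)] by simp
    have "0 \<le> (norm ((\<alpha> / 2) *\<^sub>R x + p))\<^sup>2" by simp
    also have "\<dots> = \<alpha> * (\<alpha> / 4 * (norm x)\<^sup>2 + p \<bullet> x + (norm p)\<^sup>2 / \<alpha>)"
      unfolding norm_add_sq using \<alpha> by (simp add: power_mult_distrib power2_eq_square field_simps inner_commute)
    finally have "0 \<le> \<alpha> / 4 * (norm x)\<^sup>2 + p \<bullet> x + (norm p)\<^sup>2 / \<alpha>" using \<alpha> by (simp add: zero_le_mult_iff)
    then show ?thesis using V W unfolding h_def d_def by (simp add: algebra_simps)
  qed
  moreover have "continuous_on UNIV h"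
    unfolding h_def by (intro continuous_intros continuous_V continuous_on_sup_conv compact nonempty usc_w)
  ultimately obtain x where "\<And>x'. h x \<le> h x'"
    using coercive_attains_inf[of h "\<alpha> / 4" d 0] \<alpha> by auto
  then show ?thesis unfolding contact_point_def h_def by (intro exI[of _ x]) (simp add: algebra_simps)
qed

lemma contact_pointD: "contact_point p x \<Longrightarrow> V x' + W x' - p \<bullet> x' \<le> V x + W x - p \<bullet> x"
  by (simp add: contact_point_def)

lemma W_ge: "z \<in> K \<Longrightarrow> w z - 3 / 2 * \<alpha> * (norm (x - z))\<^sup>2 \<le> W x"
  by (rule sup_conv_ge[OF compact usc_w])

lemma W_attained: obtains z where "z \<in> K" "W x = w z - 3 / 2 * \<alpha> * (norm (x - z))\<^sup>2"
  using sup_conv_attained[OF compact nonempty usc_w] by blast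

lemma W_lower:
  assumes z: "z \<in> K" "W x = w z - 3 / 2 * \<alpha> * (norm (x - z))\<^sup>2"
  shows "W x' \<ge> W x - (3 * \<alpha>) *\<^sub>R (x - z) \<bullet> (x' - x) - 3 / 2 * \<alpha> * (norm (x' - x))\<^sup>2"
proof -
  have "(norm (x' - z))\<^sup>2 = (norm (x - z))\<^sup>2 + 2 * ((x - z) \<bullet> (x' - x)) + (norm (x' - x))\<^sup>2"
    by (simp add: power2_norm_eq_inner inner_diff_left inner_diff_right inner_commute)
  then show ?thesis using W_ge[OF z(1), of x'] unfolding z(2)
    by (simp add: distrib_left mult.assoc)
qed

text \<open>At a maximum the paraboloid below \<open>W\<close> turns into one above
  \<open>V\<close>, with opening 3/2 \<alpha> instead of the 3 \<alpha> of \<open>V_upper\<close>.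
  This is the hypothesis of \<open>V_contact\<close>, and the reason for the opening chosen in
  \<open>W\<close>.\<close>

lemma contact_point_V:
  assumes c: "contact_point p x" and z: "z \<in> K" "W x = w z - 3 / 2 * \<alpha> * (norm (x - z))\<^sup>2"
  shows "V x' \<le> V x + G x \<bullet> (x' - x) + 3 / 2 * \<alpha> * (norm (x' - x))\<^sup>2"
    "G x = p + (3 * \<alpha>) *\<^sub>R (x - z)"
    "\<exists>z\<in>K. V x = g z - 3 / 2 * \<alpha> * (norm (x - z))\<^sup>2"
proof -
  define P where "P = p + (3 * \<alpha>) *\<^sub>R (x - z)"
  have up: "V x' \<le> V x + P \<bullet> (x' - x) + 3 / 2 * \<alpha> * (norm (x' - x))\<^sup>2" for x'
    using contact_pointD[OF c, of x'] W_lower[OF z, of x']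
    by (simp add: P_def inner_add_left inner_diff_right[of p])
  from V_contact[OF this]
  show eq: "G x = p + (3 * \<alpha>) *\<^sub>R (x - z)" "\<exists>z\<in>K. V x = g z - 3 / 2 * \<alpha> * (norm (x - z))\<^sup>2"
    by (auto simp: P_def)
  show "V x' \<le> V x + G x \<bullet> (x' - x) + 3 / 2 * \<alpha> * (norm (x' - x))\<^sup>2"
    using up unfolding eq(1) P_def .
qed

text \<open>\<open>W\<close> is bounded below by its own paraboloid and above by
  \<open>V_lower\<close> through maximality. At contact points it thus satisfies a two-sided
  quadratic bound, though in general it is only semiconvex.\<close>

lemma contact_point_W:
  assumes c: "contact_point p x"
  shows "\<bar>W x' - W x - (p - G x) \<bullet> (x' - x)\<bar> \<le> 3 / 2 * \<alpha> * (norm (x' - x))\<^sup>2"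
proof -
  obtain z where z: "z \<in> K" "W x = w z - 3 / 2 * \<alpha> * (norm (x - z))\<^sup>2" using W_attained by blast
  have eq: "p - G x = - ((3 * \<alpha>) *\<^sub>R (x - z))" using contact_point_V(2)[OF c z] by simp
  have "W x' \<ge> W x + (p - G x) \<bullet> (x' - x) - 3 / 2 * \<alpha> * (norm (x' - x))\<^sup>2"
    using W_lower[OF z, of x'] unfolding eq by simp
  moreover have "W x' \<le> W x + (p - G x) \<bullet> (x' - x) + 3 / 2 * \<alpha> * (norm (x' - x))\<^sup>2"
    using contact_pointD[OF c, of x'] V_lower[of x x']
    by (simp add: inner_diff_left inner_diff_right[of p])
  ultimately show ?thesis unfolding abs_le_iff by linarith
qed

text \<open>Split p = (p - G x) + G x. The first part is the slope of \<open>W\<close>, with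
  constant 6 * 3/2 = 9; the second is that of \<open>V\<close>, with constant 18.\<close>

lemma contact_slope_lipschitz:
  assumes "contact_point p1 x1" "contact_point p2 x2"
  shows "norm (p1 - p2) \<le> 27 * \<alpha> * norm (x1 - x2)"
proof -
  have "norm ((p1 - G x1) - (p2 - G x2)) \<le> 6 * (3 / 2 * \<alpha>) * norm (x1 - x2)"
    by (rule touching_slope_lipschitz[OF contact_point_W contact_point_W]) fact+
  moreover have "norm (p1 - p2) \<le> norm ((p1 - G x1) - (p2 - G x2)) + norm (G x1 - G x2)"
    using norm_triangle_ineq[of "(p1 - G x1) - (p2 - G x2)" "G x1 - G x2"] by simp
  ultimately show ?thesis using G_lipschitz[of x1 x2] by (simp add: algebra_simps)
qed

text \<open>The slope is a Lipschitz function of the contact point, so contact points for a ball of slopes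
  cannot all lie in the null set where \<open>G\<close> is not differentiable.\<close>
lemma differentiable_contact_point_exists:
  assumes "\<delta> > 0"
  shows "\<exists>p x. norm p < \<delta> \<and> contact_point p x \<and> G differentiable (at x)"
proof (rule ccontr)
  assume contr: "\<not> ?thesis"
  obtain X where X: "\<And>p. contact_point p (X p)" using contact_point_exists by metis
  define N where "N = {x. \<not> G differentiable (at x)}"
  have "(18 * \<alpha>)-lipschitz_on UNIV G"
    using G_lipschitz \<alpha> by (intro lipschitz_onI) (auto simp: dist_norm)
  then have N: "negligible N" unfolding N_def by (rule Rademacher)
  have sub: "X ` ball 0 \<delta> \<subseteq> N" using contr X by (auto simp: N_def)
  have lip: "norm (p - p') \<le> 27 * \<alpha> * norm (X p - X p')" for p p'
    by (rule contact_slope_lipschitz[OF X X])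
  have "inj X"
  proof (rule injI)
    fix p p' assume "X p = X p'"
    then show "p = p'" using lip[of p p'] by simp
  qed
  have "negligible (inv X ` (X ` ball 0 \<delta>))"
  proof (rule negligible_locally_Lipschitz_image)
    show "negligible (X ` ball 0 \<delta>)" by (rule negligible_subset[OF N sub])
    show "\<exists>T B. open T \<and> x \<in> T \<and> (\<forall>y\<in>X ` ball 0 \<delta> \<inter> T. norm (inv X y - inv X x) \<le> B * norm (y - x))"
      if "x \<in> X ` ball 0 \<delta>" for x
      by (rule exI[of _ UNIV], rule exI[of _ "27 * \<alpha>"])
        (use that lip \<open>inj X\<close> in \<open>auto simp: inv_f_f\<close>)
  qed simp
  moreover have "inv X ` (X ` ball 0 \<delta>) = ball 0 \<delta>" by (simp add: image_image inv_f_f[OF \<open>inj X\<close>])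
  ultimately have "negligible (ball (0::'a) \<delta>)" by simp
  then show False using \<open>\<delta> > 0\<close> by (metis open_ball centre_in_ball empty_iff open_not_negligible)
qed

end

section \<open>Test functions at a contact point\<close>

lemma frame_quadratic_shift:
  "frame_quadratic c l b d z (z + h) = c + l \<bullet> h + (\<Sum>i\<in>UNIV. d i * (h \<bullet> b i)\<^sup>2) / 2"
  by (simp add: frame_quadratic_def)

text \<open>In an eigendirection, moving \<open>V\<close> by m h while \<open>g\<close> moves by h
  costs s m^2 / 2 from the expansion and 3/2 \<alpha> (m - 1)^2 from the penalty. The exact
  minimiser m = 1 / (1 + s / (3 \<alpha>)) degenerates at s = -3 \<alpha>. The affine choice stays
  bounded and still gains: with \<sigma> = s / (6 \<alpha>), the cubic term is absorbed because
  \<sigma> \<le> 1/2.\<close>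

lemma eigenvalue_gain:
  fixes s \<alpha> :: real
  assumes "\<alpha> > 0" "\<bar>s\<bar> \<le> 3 * \<alpha>"
  defines "m \<equiv> 1 - s / (6 * \<alpha>)"
  shows "s * m\<^sup>2 / 2 + 3 / 2 * \<alpha> * (m - 1)\<^sup>2 \<le> (s - s\<^sup>2 / (6 * \<alpha>)) / 2" "m\<^sup>2 \<le> 9 / 4"
proof -
  define \<sigma> where "\<sigma> = s / (6 * \<alpha>)"
  have s: "s = 6 * \<alpha> * \<sigma>" using assms(1) by (simp add: \<sigma>_def)
  have \<sigma>: "\<bar>\<sigma>\<bar> \<le> 1 / 2" using assms(1,2) by (simp add: \<sigma>_def abs_divide field_simps)
  have m: "m = 1 - \<sigma>" by (simp add: m_def \<sigma>_def)
  have "\<sigma> * \<sigma>\<^sup>2 \<le> 1 / 2 * \<sigma>\<^sup>2" using \<sigma> by (intro mult_right_mono) auto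
  then have cub: "\<alpha> * (\<sigma> * \<sigma>\<^sup>2) \<le> \<alpha> * (1 / 2 * \<sigma>\<^sup>2)" using assms(1) by (intro mult_left_mono) auto
  have sq: "s\<^sup>2 / (6 * \<alpha>) = 6 * (\<alpha> * \<sigma>\<^sup>2)" using assms(1) by (simp add: s power2_eq_square)
  have lhs: "s * m\<^sup>2 / 2 + 3 / 2 * \<alpha> * (m - 1)\<^sup>2 = 3 * (\<alpha> * \<sigma>) - 9 / 2 * (\<alpha> * \<sigma>\<^sup>2) + 3 * (\<alpha> * (\<sigma> * \<sigma>\<^sup>2))"
    by (simp add: m s power2_eq_square algebra_simps add_divide_distrib diff_divide_distrib)
  show "s * m\<^sup>2 / 2 + 3 / 2 * \<alpha> * (m - 1)\<^sup>2 \<le> (s - s\<^sup>2 / (6 * \<alpha>)) / 2"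
    unfolding lhs sq using cub s by simp
  have "\<bar>m\<bar> \<le> 3 / 2" using \<sigma> by (simp add: m)
  then have "\<bar>m\<bar>\<^sup>2 \<le> (3 / 2)\<^sup>2" by (rule power_mono) auto
  then show "m\<^sup>2 \<le> 9 / 4" by (simp add: power2_eq_square)
qed

text \<open>Both test functions come from the second-order expansion of the regularisation \<open>V\<close> alone.
  For \<open>g\<close> the expansion is read off along \<open>x + M h\<close> with \<open>M = 1 - T / (6 \<alpha>)\<close> instead of
  \<open>x + h\<close>; this lowers the eigenvalue \<open>s\<close> by \<open>s\<^sup>2 / (6 \<alpha>)\<close>.\<close>
proposition contact_test_functions:
  fixes K :: "(real ^ 'n) set"
  assumes "contact K g \<alpha> w" "\<delta> > 0"
  shows "\<exists>x z z' p b s. z \<in> K \<and> z' \<in> K \<and> norm p < \<delta> \<and> orthonormal_frame b \<and> (\<forall>i. \<bar>s i\<bar> \<le> 3 * \<alpha>) \<and>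
    (\<forall>\<xi>\<in>K. g \<xi> + w \<xi> - p \<bullet> \<xi> \<le>
        g z + w z' - 3 / 2 * \<alpha> * (norm (x - z))\<^sup>2 - 3 / 2 * \<alpha> * (norm (x - z'))\<^sup>2 - p \<bullet> x) \<and>
    (\<forall>\<epsilon>>0. \<exists>l. \<exists>\<rho>>0. \<forall>h. norm h < \<rho> \<and> z + h \<in> K \<longrightarrow>
        g (z + h) \<le> g z + l \<bullet> h + (\<Sum>i\<in>UNIV. (s i - (s i)\<^sup>2 / (6 * \<alpha>) + \<epsilon>) * (h \<bullet> b i)\<^sup>2) / 2) \<and>
    (\<forall>\<epsilon>>0. \<exists>l. \<exists>\<rho>>0. \<forall>h. norm h < \<rho> \<and> z' + h \<in> K \<longrightarrow>
        w (z' + h) \<le> w z' + l \<bullet> h + (\<Sum>i\<in>UNIV. (\<epsilon> - s i) * (h \<bullet> b i)\<^sup>2) / 2)"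
proof -
  interpret contact K g \<alpha> w by fact
  obtain p x where p: "norm p < \<delta>" and c: "contact_point p x" and diff: "G differentiable (at x)"
    using differentiable_contact_point_exists[OF \<open>\<delta> > 0\<close>] by blast
  obtain z' where z': "z' \<in> K" "W x = w z' - 3 / 2 * \<alpha> * (norm (x - z'))\<^sup>2" using W_attained by blast
  obtain z where z: "z \<in> K" "V x = g z - 3 / 2 * \<alpha> * (norm (x - z))\<^sup>2"
    using contact_point_V(3)[OF c z'] by blast
  obtain T where T: "linear T" "\<And>h k. T h \<bullet> k = h \<bullet> T k"
    "\<And>e. e > 0 \<Longrightarrow> \<exists>\<rho>>0. \<forall>h. norm h < \<rho> \<longrightarrow> \<bar>V (x + h) - V x - G x \<bullet> h - (T h \<bullet> h) / 2\<bar> \<le> e * (norm h)\<^sup>2"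
    using second_order_expansion[OF V_has_derivative diff] by metis
  obtain b s where b: "orthonormal_frame b" and s: "\<And>i. T (b i) = s i *\<^sub>R b i"
    using selfadjoint_orthonormal_eigenframe[OF T(1,2)] by metis
  have Tb: "T h \<bullet> b i = s i * (h \<bullet> b i)" for h i by (simp add: T(2) s)
  have TT: "T h \<bullet> h = (\<Sum>i\<in>UNIV. s i * (h \<bullet> b i)\<^sup>2)" for h
    by (simp add: orthonormal_frame_inner[OF b, of "T h"] Tb power2_eq_square mult.assoc)
  have nn: "(norm h)\<^sup>2 = (\<Sum>i\<in>UNIV. (h \<bullet> b i)\<^sup>2)" for h
    unfolding power2_norm_eq_inner orthonormal_frame_inner[OF b, of h h] by (simp add: power2_eq_square)
  \<comment> \<open>At the contact point \<open>V\<close> lies between paraboloids of openings 3/2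
    \<alpha> and -3/2 \<alpha>, whose Hessians are 3 \<alpha> and -3 \<alpha> times the
    identity.\<close>
  have sb: "\<bar>s i\<bar> \<le> 3 * \<alpha>" for i
  proof (rule field_le_epsilon)
    fix e :: real assume "e > 0"
    then obtain \<rho> where \<rho>: "\<rho> > 0" "\<And>h. norm h < \<rho> \<Longrightarrow> \<bar>V (x + h) - V x - G x \<bullet> h - (T h \<bullet> h) / 2\<bar> \<le> e / 2 * (norm h)\<^sup>2"
      using T(3)[of "e / 2"] by auto
    define t where "t = \<rho> / 2"
    define h where "h = t *\<^sub>R b i"
    have bi: "b i \<bullet> b i = 1" using b by (simp add: orthonormal_frame_def)
    then have "norm (b i) = 1" by (simp add: norm_eq_1)
    then have nh: "norm h = t" using \<rho>(1) by (simp add: h_def t_def)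
    have Th: "T h \<bullet> h = t\<^sup>2 * s i" using bi by (simp add: h_def linear_cmul[OF T(1)] s power2_eq_square)
    have "V (x + h) \<le> V x + G x \<bullet> h + 3 / 2 * \<alpha> * t\<^sup>2"
      using contact_point_V(1)[OF c z', of "x + h"] nh by simp
    moreover have "V (x + h) \<ge> V x + G x \<bullet> h - 3 / 2 * \<alpha> * t\<^sup>2"
      using V_lower[of x "x + h"] nh by simp
    ultimately have "\<bar>V (x + h) - V x - G x \<bullet> h\<bar> \<le> 3 / 2 * \<alpha> * t\<^sup>2" by linarith
    moreover have "\<bar>V (x + h) - V x - G x \<bullet> h - (t\<^sup>2 * s i) / 2\<bar> \<le> e / 2 * t\<^sup>2"
      using \<rho>(2)[of h] nh \<rho>(1) Th by (simp add: t_def)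
    ultimately have "\<bar>t\<^sup>2 * s i / 2\<bar> \<le> 3 / 2 * \<alpha> * t\<^sup>2 + e / 2 * t\<^sup>2" by linarith
    then have "t\<^sup>2 * \<bar>s i\<bar> \<le> t\<^sup>2 * (3 * \<alpha> + e)" by (simp add: abs_mult algebra_simps)
    then show "\<bar>s i\<bar> \<le> 3 * \<alpha> + e" using \<rho>(1) by (simp add: t_def)
  qed
  \<comment> \<open>Maximality is tested at \<xi> itself, where V \<ge> g and W \<ge> w.\<close>
  have max: "g \<xi> + w \<xi> - p \<bullet> \<xi> \<le>
        g z + w z' - 3 / 2 * \<alpha> * (norm (x - z))\<^sup>2 - 3 / 2 * \<alpha> * (norm (x - z'))\<^sup>2 - p \<bullet> x" if "\<xi> \<in> K" for \<xi>
    using contact_pointD[OF c, of \<xi>] V_ge[OF that, of \<xi>] W_ge[OF that, of \<xi>] z(2) z'(2) by simp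
  \<comment> \<open>\<open>x\<close> and \<open>z'\<close> move by the same \<open>h\<close>, which
    leaves the penalty unchanged; maximality at \<open>x\<close> turns the lower expansion of
    \<open>V\<close> into an upper one for \<open>w\<close>.\<close>
  have test_w: "\<exists>l. \<exists>\<rho>>0. \<forall>h. norm h < \<rho> \<and> z' + h \<in> K \<longrightarrow>
        w (z' + h) \<le> w z' + l \<bullet> h + (\<Sum>i\<in>UNIV. (\<epsilon> - s i) * (h \<bullet> b i)\<^sup>2) / 2" if "\<epsilon> > 0" for \<epsilon>
  proof -
    obtain \<rho> where \<rho>: "\<rho> > 0" "\<And>h. norm h < \<rho> \<Longrightarrow> \<bar>V (x + h) - V x - G x \<bullet> h - (T h \<bullet> h) / 2\<bar> \<le> \<epsilon> / 2 * (norm h)\<^sup>2"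
      using T(3)[of "\<epsilon> / 2"] \<open>\<epsilon> > 0\<close> by auto
    have "w (z' + h) \<le> w z' + (p - G x) \<bullet> h + (\<Sum>i\<in>UNIV. (\<epsilon> - s i) * (h \<bullet> b i)\<^sup>2) / 2"
      if h: "norm h < \<rho>" "z' + h \<in> K" for h
    proof -
      have 1: "w (z' + h) - 3 / 2 * \<alpha> * (norm (x - z'))\<^sup>2 \<le> W (x + h)" using W_ge[OF h(2), of "x + h"] by simp
      have 2: "W (x + h) \<le> W x + V x - V (x + h) + p \<bullet> h"
        using contact_pointD[OF c, of "x + h"] by (simp add: inner_add_right)
      have 3: "V (x + h) \<ge> V x + G x \<bullet> h + (T h \<bullet> h) / 2 - \<epsilon> / 2 * (norm h)\<^sup>2" using \<rho>(2)[OF h(1)] by linarith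
      have 4: "(\<Sum>i\<in>UNIV. (\<epsilon> - s i) * (h \<bullet> b i)\<^sup>2) = \<epsilon> * (norm h)\<^sup>2 - T h \<bullet> h"
        by (simp add: TT nn left_diff_distrib sum_subtractf sum_distrib_left)
      show ?thesis using 1 2 3 z'(2) unfolding 4 inner_diff_left by (simp add: field_simps)
    qed
    with \<rho>(1) show ?thesis by blast
  qed
  have test_g: "\<exists>l. \<exists>\<rho>>0. \<forall>h. norm h < \<rho> \<and> z + h \<in> K \<longrightarrow>
        g (z + h) \<le> g z + l \<bullet> h + (\<Sum>i\<in>UNIV. (s i - (s i)\<^sup>2 / (6 * \<alpha>) + \<epsilon>) * (h \<bullet> b i)\<^sup>2) / 2" if "\<epsilon> > 0" for \<epsilon>
  proof -
    define M where "M h = h - (1 / (6 * \<alpha>)) *\<^sub>R T h" for h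
    define m where "m i = 1 - s i / (6 * \<alpha>)" for i
    have Mb: "M h \<bullet> b i = m i * (h \<bullet> b i)" for h i
      by (simp add: M_def m_def inner_diff_left Tb algebra_simps)
    have Mhb: "(M h - h) \<bullet> b i = (m i - 1) * (h \<bullet> b i)" for h i
      by (simp add: inner_diff_left Mb algebra_simps)
    have Msa: "a \<bullet> M h = M a \<bullet> h" for a h by (simp add: M_def inner_diff_left inner_diff_right T(2))
    have gain: "s i * (m i)\<^sup>2 / 2 + 3 / 2 * \<alpha> * (m i - 1)\<^sup>2 \<le> (s i - (s i)\<^sup>2 / (6 * \<alpha>)) / 2" and m2: "(m i)\<^sup>2 \<le> 9 / 4" for i
      using eigenvalue_gain[OF \<alpha> sb[of i]] unfolding m_def by auto
    \<comment> \<open>The error is multiplied by at most 9/4 under \<open>M\<close>, and 2/9 * 9/4 =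
      1/2. The radius \<rho> / 2 used below matches |M h| \<le> 2 |h|.\<close>
    obtain \<rho> where \<rho>: "\<rho> > 0" "\<And>h. norm h < \<rho> \<Longrightarrow> \<bar>V (x + h) - V x - G x \<bullet> h - (T h \<bullet> h) / 2\<bar> \<le> 2 * \<epsilon> / 9 * (norm h)\<^sup>2"
      using T(3)[of "2 * \<epsilon> / 9"] \<open>\<epsilon> > 0\<close> by auto
    define l where "l = M (G x) + (3 * \<alpha>) *\<^sub>R (M (x - z) - (x - z))"
    have "g (z + h) \<le> g z + l \<bullet> h + (\<Sum>i\<in>UNIV. (s i - (s i)\<^sup>2 / (6 * \<alpha>) + \<epsilon>) * (h \<bullet> b i)\<^sup>2) / 2"
      if h: "norm h < \<rho> / 2" "z + h \<in> K" for h
    proof -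
      have nM: "(norm (M h))\<^sup>2 = (\<Sum>i\<in>UNIV. (m i)\<^sup>2 * (h \<bullet> b i)\<^sup>2)"
        by (simp add: nn Mb power_mult_distrib)
      also have "\<dots> \<le> (\<Sum>i\<in>UNIV. 9 / 4 * (h \<bullet> b i)\<^sup>2)" by (intro sum_mono mult_right_mono m2) auto
      also have "\<dots> \<le> (2 * norm h)\<^sup>2" by (simp add: nn power_mult_distrib sum_distrib_left sum_mono)
      finally have "norm (M h) \<le> 2 * norm h" by (rule power2_le_imp_le) auto
      then have "norm (M h) < \<rho>" using h(1) by simp
      from \<rho>(2)[OF this] have 1: "V (x + M h) \<le> V x + G x \<bullet> M h + (T (M h) \<bullet> M h) / 2 + 2 * \<epsilon> / 9 * (norm (M h))\<^sup>2"
        by linarith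
      have "x + M h - (z + h) = (x - z) + (M h - h)" by simp
      then have "(norm (x + M h - (z + h)))\<^sup>2 = (norm ((x - z) + (M h - h)))\<^sup>2" by (simp only:)
      also have "\<dots> = (norm (x - z))\<^sup>2 + 2 * ((x - z) \<bullet> (M h - h)) + (norm (M h - h))\<^sup>2"
        by (rule norm_add_sq)
      finally have 2: "g (z + h) \<le> V (x + M h) + 3 / 2 * \<alpha> * ((norm (x - z))\<^sup>2 + 2 * ((x - z) \<bullet> (M h - h)) + (norm (M h - h))\<^sup>2)"
        using V_ge[OF h(2), of "x + M h"] by simp
      have lin: "l \<bullet> h = G x \<bullet> M h + 3 * \<alpha> * ((x - z) \<bullet> (M h - h))"
        by (simp add: l_def inner_add_left inner_diff_left inner_diff_right Msa algebra_simps)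
      have quad: "(T (M h) \<bullet> M h) / 2 + 2 * \<epsilon> / 9 * (norm (M h))\<^sup>2 + 3 / 2 * \<alpha> * (norm (M h - h))\<^sup>2
          = (\<Sum>i\<in>UNIV. (s i * (m i)\<^sup>2 / 2 + 3 / 2 * \<alpha> * (m i - 1)\<^sup>2 + 2 * \<epsilon> / 9 * (m i)\<^sup>2) * (h \<bullet> b i)\<^sup>2)"
        unfolding TT nn[of "M h"] nn[of "M h - h"] Mb Mhb
        by (simp add: power_mult_distrib sum_divide_distrib sum_distrib_left flip: sum.distrib)
          (rule sum.cong, auto simp: algebra_simps)
      also have "\<dots> \<le> (\<Sum>i\<in>UNIV. ((s i - (s i)\<^sup>2 / (6 * \<alpha>)) / 2 + \<epsilon> / 2) * (h \<bullet> b i)\<^sup>2)"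
      proof (intro sum_mono mult_right_mono add_mono gain)
        fix i
        have "2 * \<epsilon> / 9 * (m i)\<^sup>2 \<le> 2 * \<epsilon> / 9 * (9 / 4)" using \<open>\<epsilon> > 0\<close> by (intro mult_left_mono m2) auto
        then show "2 * \<epsilon> / 9 * (m i)\<^sup>2 \<le> \<epsilon> / 2" by simp
      qed auto
      also have "\<dots> = (\<Sum>i\<in>UNIV. (s i - (s i)\<^sup>2 / (6 * \<alpha>) + \<epsilon>) * (h \<bullet> b i)\<^sup>2) / 2"
        unfolding sum_divide_distrib
        by (rule sum.cong[OF refl]) (simp only: add_divide_distrib[symmetric] times_divide_eq_left)
      finally have quad': "(T (M h) \<bullet> M h) / 2 + 2 * \<epsilon> / 9 * (norm (M h))\<^sup>2 + 3 / 2 * \<alpha> * (norm (M h - h))\<^sup>2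
        \<le> (\<Sum>i\<in>UNIV. (s i - (s i)\<^sup>2 / (6 * \<alpha>) + \<epsilon>) * (h \<bullet> b i)\<^sup>2) / 2" .
      have "3 / 2 * \<alpha> * ((norm (x - z))\<^sup>2 + 2 * ((x - z) \<bullet> (M h - h)) + (norm (M h - h))\<^sup>2) =
          3 / 2 * \<alpha> * (norm (x - z))\<^sup>2 + 3 * \<alpha> * ((x - z) \<bullet> (M h - h)) + 3 / 2 * \<alpha> * (norm (M h - h))\<^sup>2"
        by (simp add: ring_distribs)
      then show ?thesis using 1 2 lin quad' z(2) by linarith
    qed
    moreover have "\<rho> / 2 > 0" using \<rho>(1) by simp
    ultimately show ?thesis by blast
  qed
  show ?thesis
    by (intro exI[of _ x] exI[of _ z] exI[of _ z'] exI[of _ p] exI[of _ b] exI[of _ s] conjI ballI allI impI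
        z(1) z'(1) p b sb max test_g test_w)
qed

section \<open>Comparison\<close>

lemma ln_ge_one_minus_inverse: "1 - 1 / x \<le> ln x" if "x > 0" for x :: real
  using ln_le_minus_one[of "1 / x"] that by (simp add: ln_div)

text \<open>On [s - d, s] the derivative 1 / (1 + |t|) is at least 1 / (1 + |s| + d). The closed
  form is used piecewise; an interval containing 0 in its interior is cut there and the two parts
  are added.\<close>

lemma a_fun_diff_ge:
  assumes "d \<ge> 0"
  shows "d / (1 + \<bar>s\<bar> + d) \<le> a_fun s - a_fun (s - d)"
proof -
  have pos: "1 + \<bar>s\<bar> + d > 0" using assms by linarith
  consider "0 \<le> s - d" | "s \<le> 0" | "s > 0" "s < d" by linarith
  then show ?thesis
  proof cases
    case 1
    then have "a_fun s - a_fun (s - d) = ln (1 + s) - ln (1 + s - d)"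
      using assms by (auto simp: a_fun_eq sgn_if)
    also have "\<dots> = ln ((1 + s) / (1 + s - d))" using 1 assms by (simp add: ln_div)
    also have "\<dots> \<ge> 1 - 1 / ((1 + s) / (1 + s - d))" using 1 assms by (intro ln_ge_one_minus_inverse) auto
    also have "1 - 1 / ((1 + s) / (1 + s - d)) = d / (1 + s)" using 1 assms by (simp add: field_simps)
    finally have "d / (1 + s) \<le> a_fun s - a_fun (s - d)" .
    moreover have "d / (1 + \<bar>s\<bar> + d) \<le> d / (1 + s)" using 1 assms by (intro divide_left_mono) auto
    ultimately show ?thesis by simp
  next
    case 2
    then have "a_fun s - a_fun (s - d) = ln (1 - s + d) - ln (1 - s)"
      using assms by (auto simp: a_fun_eq sgn_if algebra_simps)
    also have "\<dots> = ln ((1 - s + d) / (1 - s))" using 2 assms by (simp add: ln_div)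
    also have "\<dots> \<ge> 1 - 1 / ((1 - s + d) / (1 - s))" using 2 assms by (intro ln_ge_one_minus_inverse) auto
    also have "1 - 1 / ((1 - s + d) / (1 - s)) = d / (1 + \<bar>s\<bar> + d)" using 2 assms by (simp add: field_simps)
    finally show ?thesis .
  next
    case 3
    have eq: "a_fun s - a_fun (s - d) = ln (1 + s) + ln (1 + (d - s))" using 3 by (simp add: a_fun_eq sgn_if)
    have "s / (1 + \<bar>s\<bar> + d) \<le> s / (1 + s)" using 3 by (intro divide_left_mono) auto
    also have "\<dots> = 1 - 1 / (1 + s)" using 3 by (simp add: field_simps)
    also have "\<dots> \<le> ln (1 + s)" using 3 by (intro ln_ge_one_minus_inverse) auto
    finally have 1: "s / (1 + \<bar>s\<bar> + d) \<le> ln (1 + s)" .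
    have "(d - s) / (1 + \<bar>s\<bar> + d) \<le> (d - s) / (1 + (d - s))" using 3 by (intro divide_left_mono) auto
    also have "\<dots> = 1 - 1 / (1 + (d - s))" using 3 by (simp add: field_simps)
    also have "\<dots> \<le> ln (1 + (d - s))" using 3 by (intro ln_ge_one_minus_inverse) auto
    finally have "(d - s) / (1 + \<bar>s\<bar> + d) \<le> ln (1 + (d - s))" .
    with 1 have "s / (1 + \<bar>s\<bar> + d) + (d - s) / (1 + \<bar>s\<bar> + d) \<le> a_fun s - a_fun (s - d)" unfolding eq by linarith
    then show ?thesis by (simp flip: add_divide_distrib)
  qed
qed

lemma continuous_a_fun: "isCont a_fun s"
proof -
  have "a_fun = (\<lambda>l. ln (1 + max l 0) - ln (1 + max (- l) 0))"
    by (auto simp: fun_eq_iff a_fun_eq sgn_if max_def)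
  moreover have "isCont (\<lambda>l::real. ln (1 + max l 0) - ln (1 + max (- l) 0)) s"
  proof -
    have "1 + max l 0 \<noteq> 0" for l :: real by (simp add: max_def)
    then show ?thesis by (intro continuous_intros) auto
  qed
  ultimately show ?thesis by simp
qed

text \<open>The bound d / (1 + |s| + d) increases with d = s^2 / (6 \<alpha>) + \<eta>, so either
  summand can be kept alone. For |s| \<le> sqrt \<alpha> keep \<eta>, with denominator at most 3
  sqrt \<alpha>. Otherwise keep s^2 / (6 \<alpha>), with denominator at most 5/2 |s|, which gives
  |s| / (15 \<alpha>); thus 15 = 6 * 5/2.\<close>

lemma a_fun_gain:
  assumes "\<alpha> \<ge> 1" "\<bar>s\<bar> \<le> 3 * \<alpha>" "0 < \<eta>" "\<eta> \<le> 1"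
  shows "\<eta> / 15 / sqrt \<alpha> \<le> a_fun s - a_fun (s - s\<^sup>2 / (6 * \<alpha>) - \<eta>)"
proof -
  define d where "d = s\<^sup>2 / (6 * \<alpha>) + \<eta>"
  have sq: "sqrt \<alpha> \<ge> 1" "sqrt \<alpha> * sqrt \<alpha> = \<alpha>" using assms by auto
  have d0: "s\<^sup>2 / (6 * \<alpha>) \<ge> 0" using assms by simp
  have mono: "e / (1 + \<bar>s\<bar> + e) \<le> d / (1 + \<bar>s\<bar> + d)" if "0 \<le> e" "e \<le> d" for e
  proof -
    have "e * (1 + \<bar>s\<bar>) \<le> d * (1 + \<bar>s\<bar>)" using that by (intro mult_right_mono) auto
    moreover have "1 + \<bar>s\<bar> + e > 0" "1 + \<bar>s\<bar> + d > 0" using that by linarith+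
    ultimately show ?thesis by (simp add: divide_le_eq pos_le_divide_eq algebra_simps)
  qed
  have "\<eta> / 15 / sqrt \<alpha> \<le> d / (1 + \<bar>s\<bar> + d)"
  proof (cases "\<bar>s\<bar> \<le> sqrt \<alpha>")
    case True
    have "\<eta> / 15 / sqrt \<alpha> \<le> \<eta> / (3 * sqrt \<alpha>)" using assms sq by (simp add: field_simps)
    also have "\<dots> \<le> \<eta> / (1 + \<bar>s\<bar> + \<eta>)"
    proof (rule divide_left_mono)
      show "1 + \<bar>s\<bar> + \<eta> \<le> 3 * sqrt \<alpha>" using sq(1) True assms(4) by linarith
    qed (use assms sq in auto)
    also have "\<dots> \<le> d / (1 + \<bar>s\<bar> + d)" using assms d0 by (intro mono) (auto simp: d_def)
    finally show ?thesis .
  next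
    case False
    then have s: "sqrt \<alpha> < \<bar>s\<bar>" "1 < \<bar>s\<bar>" using sq by linarith+
    define e where "e = s\<^sup>2 / (6 * \<alpha>)"
    have ss: "s\<^sup>2 = \<bar>s\<bar> * \<bar>s\<bar>" by (simp add: power2_eq_square)
    have "\<bar>s\<bar> * \<bar>s\<bar> \<le> \<bar>s\<bar> * (3 * \<alpha>)" using assms by (intro mult_left_mono) auto
    then have e: "e \<le> \<bar>s\<bar> / 2" using assms s unfolding e_def ss by (simp add: divide_le_eq)
    have "s \<noteq> 0" using s by auto
    then have "0 < e" using assms by (simp add: e_def)
    note e = this e
    have "\<eta> / 15 / sqrt \<alpha> \<le> 1 / 15 / sqrt \<alpha>" using assms sq by (intro divide_right_mono) auto
    also have "\<dots> = sqrt \<alpha> / (15 * \<alpha>)" using sq assms by (simp add: field_simps)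
    also have "\<dots> \<le> \<bar>s\<bar> / (15 * \<alpha>)" using s assms by (intro divide_right_mono) auto
    also have "\<dots> = e / (5 / 2 * \<bar>s\<bar>)" using s assms by (simp add: e_def ss field_simps)
    also have "\<dots> \<le> e / (1 + \<bar>s\<bar> + e)" using e s by (intro divide_left_mono) auto
    also have "\<dots> \<le> d / (1 + \<bar>s\<bar> + d)" using e assms by (intro mono) (auto simp: d_def e_def)
    finally show ?thesis .
  qed
  also have "\<dots> \<le> a_fun s - a_fun (s - d)" using d0 assms by (intro a_fun_diff_ge) (auto simp: d_def)
  finally show ?thesis by (simp add: d_def algebra_simps)
qed

section \<open>The comparison argument\<close>

lemma usc_on_sequentially:
  assumes "usc_on K g" "z \<in> K" "\<And>n. y n \<in> K" "y \<longlonglongrightarrow> z" "g z < c"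
  shows "\<forall>\<^sub>F n in sequentially. g (y n) < c"
proof -
  have "\<forall>\<^sub>F x in at z within K. g x < c" using assms by (auto simp: usc_on_def)
  then obtain U where U: "open U" "z \<in> U" "\<And>x. x \<in> U \<Longrightarrow> x \<noteq> z \<Longrightarrow> x \<in> K \<Longrightarrow> g x < c"
    unfolding eventually_at_topological by blast
  have "\<forall>\<^sub>F n in sequentially. y n \<in> U" using topological_tendstoD[OF assms(4) U(1,2)] .
  then show ?thesis
    by eventually_elim (use U(3) assms(3,5) in metis)
qed

lemma eventually_nhds_shift:
  fixes z :: "'a::real_normed_vector"
  assumes "open U" "z \<in> U" "\<rho> > 0" "\<And>h. norm h < \<rho> \<Longrightarrow> z + h \<in> U \<Longrightarrow> P (z + h)"
  shows "\<forall>\<^sub>F x in nhds z. P x"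
  unfolding eventually_nhds
proof (intro exI[of _ "U \<inter> ball z \<rho>"] conjI ballI)
  fix x assume "x \<in> U \<inter> ball z \<rho>"
  then show "P x" using assms(4)[of "x - z"] by (simp add: dist_norm norm_minus_commute)
qed (use assms in auto)

text \<open>This is the argument for one fixed \<alpha>. The equation holds only inside
  \<open>\<Omega>\<close>, so the gap in \<open>f\<close> is conditional; whether both points are
  interior is decided later, in the limit of large \<alpha>. The constant \<open>c\<close> only
  shifts the perturbed subsolution.\<close>

lemma comparison_step:
  fixes \<Omega> :: "(real ^ 'n) set" and f v u :: "real ^ 'n \<Rightarrow> real"
  defines "K \<equiv> closure \<Omega>"
  assumes \<Omega>: "open \<Omega>"
    and sub: "viscosity_subsolution (F_eq f) \<Omega> v" and super: "viscosity_supersolution (F_eq f) \<Omega> u"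
    and \<eta>: "0 < \<eta>" "\<eta> \<le> 1" and \<alpha>: "\<alpha> \<ge> 1"
    and c: "contact K (\<lambda>z. v z + \<eta> / 2 * ((norm z)\<^sup>2 - c)) \<alpha> (\<lambda>z. - u z)" and \<delta>: "\<delta> > 0"
  shows "\<exists>x z z' p. z \<in> K \<and> z' \<in> K \<and> norm p < \<delta> \<and>
    (\<forall>\<xi>\<in>K. v \<xi> + \<eta> / 2 * ((norm \<xi>)\<^sup>2 - c) - u \<xi> - p \<bullet> \<xi> \<le>
        v z + \<eta> / 2 * ((norm z)\<^sup>2 - c) - u z' - 3 / 2 * \<alpha> * (norm (x - z))\<^sup>2 - 3 / 2 * \<alpha> * (norm (x - z'))\<^sup>2 - p \<bullet> x) \<and>
    (z \<in> \<Omega> \<and> z' \<in> \<Omega> \<longrightarrow> \<eta> / 15 / sqrt \<alpha> \<le> f z' - f z)"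
proof -
  define g where "g z = v z + \<eta> / 2 * ((norm z)\<^sup>2 - c)" for z
  have \<Omega>K: "\<Omega> \<subseteq> K" unfolding K_def by (rule closure_subset)
  have c': "contact K g \<alpha> (\<lambda>z. - u z)" using c unfolding g_def[abs_def] .
  obtain x z z' p b s where zK: "z \<in> K" "z' \<in> K" and p: "norm p < \<delta>" and b: "orthonormal_frame b" and s: "\<forall>i. \<bar>s i\<bar> \<le> 3 * \<alpha>"
    and max: "\<forall>\<xi>\<in>K. g \<xi> + - u \<xi> - p \<bullet> \<xi> \<le>
        g z + - u z' - 3 / 2 * \<alpha> * (norm (x - z))\<^sup>2 - 3 / 2 * \<alpha> * (norm (x - z'))\<^sup>2 - p \<bullet> x"
    and tg: "\<forall>\<epsilon>>0. \<exists>l. \<exists>\<rho>>0. \<forall>h. norm h < \<rho> \<and> z + h \<in> K \<longrightarrow>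
        g (z + h) \<le> g z + l \<bullet> h + (\<Sum>i\<in>UNIV. (s i - (s i)\<^sup>2 / (6 * \<alpha>) + \<epsilon>) * (h \<bullet> b i)\<^sup>2) / 2"
    and tu: "\<forall>\<epsilon>>0. \<exists>l. \<exists>\<rho>>0. \<forall>h. norm h < \<rho> \<and> z' + h \<in> K \<longrightarrow>
        - u (z' + h) \<le> - u z' + l \<bullet> h + (\<Sum>i\<in>UNIV. (\<epsilon> - s i) * (h \<bullet> b i)\<^sup>2) / 2"
    using contact_test_functions[OF c' \<delta>] by (elim exE conjE) (rule that; assumption)
  have "\<eta> / 15 / sqrt \<alpha> \<le> f z' - f z" if z: "z \<in> \<Omega>" "z' \<in> \<Omega>"
  proof -
    have 1: "f z \<le> (\<Sum>i\<in>UNIV. a_fun (s i - (s i)\<^sup>2 / (6 * \<alpha>) - \<eta> + \<epsilon>))" if "\<epsilon> > 0" for \<epsilon>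
    proof -
      obtain l \<rho> where \<rho>: "\<rho> > 0" and le: "\<And>h. norm h < \<rho> \<Longrightarrow> z + h \<in> K \<Longrightarrow>
        g (z + h) \<le> g z + l \<bullet> h + (\<Sum>i\<in>UNIV. (s i - (s i)\<^sup>2 / (6 * \<alpha>) + \<epsilon>) * (h \<bullet> b i)\<^sup>2) / 2"
        using tg[rule_format, OF \<open>\<epsilon> > 0\<close>] by blast
      \<comment> \<open>Passing from the perturbed function back to \<open>v\<close> subtracts
        \<eta> / 2 |y|^2: the gradient changes by \<eta> z and every eigenvalue drops by
        \<eta>.\<close>
      define \<phi> where "\<phi> = frame_quadratic (v z) (l - \<eta> *\<^sub>R z) b (\<lambda>i. s i - (s i)\<^sup>2 / (6 * \<alpha>) - \<eta> + \<epsilon>) z"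
      have "v (z + h) \<le> \<phi> (z + h)" if h: "norm h < \<rho>" "z + h \<in> \<Omega>" for h
      proof -
        have nn: "(norm h)\<^sup>2 = (\<Sum>i\<in>UNIV. (h \<bullet> b i)\<^sup>2)"
          unfolding power2_norm_eq_inner orthonormal_frame_inner[OF b, of h h] by (simp add: power2_eq_square)
        have split: "(\<Sum>i\<in>UNIV. (s i - (s i)\<^sup>2 / (6 * \<alpha>) - \<eta> + \<epsilon>) * (h \<bullet> b i)\<^sup>2) =
          (\<Sum>i\<in>UNIV. (s i - (s i)\<^sup>2 / (6 * \<alpha>) + \<epsilon>) * (h \<bullet> b i)\<^sup>2) - \<eta> * (norm h)\<^sup>2"
          by (simp add: nn sum_distrib_left algebra_simps flip: sum_subtractf)
        have 1: "g (z + h) = v (z + h) + \<eta> / 2 * ((norm z)\<^sup>2 - c) + \<eta> * (z \<bullet> h) + \<eta> / 2 * (norm h)\<^sup>2"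
          by (simp add: g_def norm_add_sq inner_commute algebra_simps add_divide_distrib)
        have 2: "g z = v z + \<eta> / 2 * ((norm z)\<^sup>2 - c)" by (simp add: g_def)
        have 3: "(l - \<eta> *\<^sub>R z) \<bullet> h = l \<bullet> h - \<eta> * (z \<bullet> h)" by (simp add: inner_diff_left)
        have "z + h \<in> K" using h(2) \<Omega>K by blast
        from le[OF h(1) this] show ?thesis
          unfolding \<phi>_def frame_quadratic_shift split 1 2 3 by (simp add: diff_divide_distrib)
      qed
      then have "\<forall>\<^sub>F y in nhds z. v y \<le> \<phi> y" by (intro eventually_nhds_shift[OF \<Omega> z(1) \<rho>])
      moreover have "\<phi> z = v z" by (simp add: \<phi>_def frame_quadratic_def)
      moreover have "C2_near z \<phi>" unfolding \<phi>_def by (rule C2_near_frame_quadratic)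
      ultimately have "F_eq f (hessian \<phi> z) z \<ge> 0" using sub z(1) unfolding viscosity_subsolution_def by blast
      then show ?thesis unfolding \<phi>_def F_eq_frame_quadratic[OF b] by simp
    qed
    have 2: "(\<Sum>i\<in>UNIV. a_fun (s i - \<epsilon>)) \<le> f z'" if "\<epsilon> > 0" for \<epsilon>
    proof -
      obtain l \<rho> where \<rho>: "\<rho> > 0" and le: "\<And>h. norm h < \<rho> \<Longrightarrow> z' + h \<in> K \<Longrightarrow>
        - u (z' + h) \<le> - u z' + l \<bullet> h + (\<Sum>i\<in>UNIV. (\<epsilon> - s i) * (h \<bullet> b i)\<^sup>2) / 2"
        using tu[rule_format, OF \<open>\<epsilon> > 0\<close>] by blast
      define \<phi> where "\<phi> = frame_quadratic (u z') (- l) b (\<lambda>i. s i - \<epsilon>) z'"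
      have "\<phi> (z' + h) \<le> u (z' + h)" if h: "norm h < \<rho>" "z' + h \<in> \<Omega>" for h
      proof -
        have "(\<Sum>i\<in>UNIV. (s i - \<epsilon>) * (h \<bullet> b i)\<^sup>2) = - (\<Sum>i\<in>UNIV. (\<epsilon> - s i) * (h \<bullet> b i)\<^sup>2)"
          by (simp add: algebra_simps flip: sum_negf)
        then show ?thesis using le[OF h(1)] h(2) \<Omega>K unfolding \<phi>_def frame_quadratic_shift by auto
      qed
      then have "\<forall>\<^sub>F y in nhds z'. \<phi> y \<le> u y" by (intro eventually_nhds_shift[OF \<Omega> z(2) \<rho>])
      moreover have "\<phi> z' = u z'" by (simp add: \<phi>_def frame_quadratic_def)
      moreover have "C2_near z' \<phi>" unfolding \<phi>_def by (rule C2_near_frame_quadratic)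
      ultimately have "F_eq f (hessian \<phi> z') z' \<le> 0" using super z(2) unfolding viscosity_supersolution_def by blast
      then show ?thesis unfolding \<phi>_def F_eq_frame_quadratic[OF b] by simp
    qed
    \<comment> \<open>The slack \<epsilon> of the expansions is removed by continuity of
      \<open>a_fun\<close> before the two inequalities are subtracted.\<close>
    have ev: "\<forall>\<^sub>F \<epsilon> in at_right 0. (0::real) < \<epsilon>" by (simp add: eventually_at_right_less)
    have "((\<lambda>\<epsilon>. \<Sum>i\<in>UNIV. a_fun (s i - (s i)\<^sup>2 / (6 * \<alpha>) - \<eta> + \<epsilon>)) \<longlongrightarrow>
        (\<Sum>i\<in>UNIV. a_fun (s i - (s i)\<^sup>2 / (6 * \<alpha>) - \<eta> + 0))) (at_right 0)"
      by (intro tendsto_sum isCont_tendsto_compose[OF continuous_a_fun] tendsto_intros)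
    then have 3: "f z \<le> (\<Sum>i\<in>UNIV. a_fun (s i - (s i)\<^sup>2 / (6 * \<alpha>) - \<eta> + 0))"
      by (rule tendsto_lowerbound) (use ev 1 in \<open>auto elim: eventually_mono\<close>)
    have "((\<lambda>\<epsilon>. \<Sum>i\<in>UNIV. a_fun (s i - \<epsilon>)) \<longlongrightarrow> (\<Sum>i\<in>UNIV. a_fun (s i - 0))) (at_right 0)"
      by (intro tendsto_sum isCont_tendsto_compose[OF continuous_a_fun] tendsto_intros)
    then have 4: "(\<Sum>i\<in>UNIV. a_fun (s i - 0)) \<le> f z'"
      by (rule tendsto_upperbound) (use ev 2 in \<open>auto elim: eventually_mono\<close>)
    define D where "D i = a_fun (s i) - a_fun (s i - (s i)\<^sup>2 / (6 * \<alpha>) - \<eta>)" for i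
    have D: "\<eta> / 15 / sqrt \<alpha> \<le> D i" for i unfolding D_def by (rule a_fun_gain[OF \<alpha> s[rule_format] \<eta>])
    have "0 \<le> \<eta> / 15 / sqrt \<alpha>" using \<eta> \<alpha> by simp
    then have "0 \<le> D i" for i using D[of i] by linarith
    \<comment> \<open>All terms are nonnegative, so one of them suffices; \<open>undefined\<close>
      serves as some index of type \<open>'n\<close>.\<close>
    then have "D undefined \<le> (\<Sum>i\<in>UNIV. D i)" by (intro member_le_sum) auto
    also have "\<dots> \<le> f z' - f z" using 3 4 by (simp add: D_def sum_subtractf)
    finally show ?thesis using D[of undefined] by linarith
  qed
  then show ?thesis using zK p max unfolding g_def
    by (intro exI[of _ x] exI[of _ z] exI[of _ z'] exI[of _ p]) simp
qed

theorem proposition2p8: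
  fixes \<Omega> :: "(real ^ 'n) set" and f :: "real ^ 'n \<Rightarrow> real"
  assumes "open \<Omega>" and "bounded \<Omega>" and "locally_lipschitz \<Omega> f"
  shows "comparison_principle (F_eq f) \<Omega>"
  unfolding comparison_principle_def
proof (intro allI impI ballI, elim conjE, rule ccontr)
  fix v u :: "real ^ 'n \<Rightarrow> real" and x0
  assume sub: "viscosity_subsolution (F_eq f) \<Omega> v" and super: "viscosity_supersolution (F_eq f) \<Omega> u"
    and bdry: "\<forall>x\<in>frontier \<Omega>. v x \<le> u x" and x0: "x0 \<in> \<Omega>" and "\<not> v x0 \<le> u x0"
  then have m: "v x0 - u x0 > 0" by simp
  define K where "K = closure \<Omega>"
  have K: "compact K" unfolding K_def using assms(2) by simp
  have x0K: "x0 \<in> K" unfolding K_def using x0 closure_subset by blast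
  obtain R where R: "R > 0" "\<And>z. z \<in> K \<Longrightarrow> norm z \<le> R"
    using compact_imp_bounded[OF K] unfolding bounded_pos by blast
  \<comment> \<open>The perturbation costs at most \<eta> R^2 / 2 at \<open>x0\<close>, so at least
    half of \<open>v x0 - u x0\<close> remains.\<close>
  define \<eta> where "\<eta> = min 1 ((v x0 - u x0) / R\<^sup>2)"
  have \<eta>: "0 < \<eta>" "\<eta> \<le> 1" using m R by (auto simp: \<eta>_def)
  have "\<eta> * R\<^sup>2 \<le> (v x0 - u x0) / R\<^sup>2 * R\<^sup>2" by (rule mult_right_mono) (auto simp: \<eta>_def)
  then have \<eta>R: "\<eta> * R\<^sup>2 \<le> v x0 - u x0" using R by simp
  \<comment> \<open>Subtracting R^2 keeps \<open>g\<close> \<le> \<open>v\<close> on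
    \<open>K\<close>, which preserves the boundary inequality; the Hessian of the added term makes
    the subsolution strict.\<close>
  define g where "g z = v z + \<eta> / 2 * ((norm z)\<^sup>2 - R\<^sup>2)" for z
  define w where "w z = - u z" for z
  have usc_g: "usc_on K g"
    unfolding g_def by (intro usc_on_add_continuous continuous_intros)
      (use sub in \<open>auto simp: viscosity_subsolution_def K_def\<close>)
  have usc_w: "usc_on K w"
    unfolding usc_on_def w_def
  proof (intro ballI allI impI)
    fix x c assume "x \<in> K" "- u x < c"
    then have "\<forall>\<^sub>F y in at x within K. - c < u y"
      using super unfolding viscosity_supersolution_def lsc_on_def K_def by auto
    then show "\<forall>\<^sub>F y in at x within K. - u y < c" by eventually_elim simp
  qed
  have g_le: "g z \<le> v z" if "z \<in> K" for z
  proof -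
    have "(norm z)\<^sup>2 \<le> R\<^sup>2" using R(2)[OF that] by (intro power_mono) auto
    then have "\<eta> / 2 * ((norm z)\<^sup>2 - R\<^sup>2) \<le> 0" using \<eta> by (intro mult_nonneg_nonpos) auto
    then show ?thesis by (simp add: g_def)
  qed
  obtain \<xi> where \<xi>: "\<xi> \<in> K" "\<And>z. z \<in> K \<Longrightarrow> g z + w z \<le> g \<xi> + w \<xi>"
    using usc_on_attains_sup[OF K _ usc_on_add[OF usc_g usc_w]] x0K by blast
  define M where "M = g \<xi> + w \<xi>"
  have M: "M > 0"
  proof -
    have "g x0 \<ge> v x0 - \<eta> * R\<^sup>2 / 2" using \<eta> by (simp add: g_def algebra_simps)
    then have "g x0 + w x0 > 0" using \<eta>R m by (simp add: w_def)
    then show ?thesis using \<xi>(2)[OF x0K] by (simp add: M_def)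
  qed
  obtain zg where zg: "\<And>z. z \<in> K \<Longrightarrow> g z \<le> g zg" using usc_on_attains_sup[OF K _ usc_g] x0K by blast
  obtain zw where zw: "\<And>z. z \<in> K \<Longrightarrow> w z \<le> w zw" using usc_on_attains_sup[OF K _ usc_w] x0K by blast

  define \<alpha> where "\<alpha> n = real (Suc n)" for n
  have \<alpha>: "\<alpha> n \<ge> 1" for n by (simp add: \<alpha>_def)
  \<comment> \<open>Slopes below 1 / \<open>\<alpha> n\<close> make the contribution of the tilt
    vanish in the limit.\<close>
  have "\<exists>x z z' p. z \<in> K \<and> z' \<in> K \<and> norm p < 1 / \<alpha> n \<and>
      M - p \<bullet> \<xi> \<le> g z + w z' - 3 / 2 * \<alpha> n * (norm (x - z))\<^sup>2 - 3 / 2 * \<alpha> n * (norm (x - z'))\<^sup>2 - p \<bullet> x \<and>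
      (z \<in> \<Omega> \<and> z' \<in> \<Omega> \<longrightarrow> \<eta> / 15 / sqrt (\<alpha> n) \<le> f z' - f z)" for n
  proof -
    have "contact K g (\<alpha> n) w"
      by unfold_locales (use K x0K usc_g usc_w \<alpha>[of n] in auto)
    then have c: "contact (closure \<Omega>) (\<lambda>z. v z + \<eta> / 2 * ((norm z)\<^sup>2 - R\<^sup>2)) (\<alpha> n) (\<lambda>z. - u z)"
      unfolding g_def[abs_def] w_def[abs_def] K_def .
    have "1 / \<alpha> n > 0" using \<alpha>[of n] by simp
    from comparison_step[OF assms(1) sub super \<eta> \<alpha> c this]
    obtain x z z' p where *: "z \<in> K" "z' \<in> K" "norm p < 1 / \<alpha> n"
      "\<forall>\<xi>\<in>K. v \<xi> + \<eta> / 2 * ((norm \<xi>)\<^sup>2 - R\<^sup>2) - u \<xi> - p \<bullet> \<xi> \<le>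
        v z + \<eta> / 2 * ((norm z)\<^sup>2 - R\<^sup>2) - u z' - 3 / 2 * \<alpha> n * (norm (x - z))\<^sup>2 - 3 / 2 * \<alpha> n * (norm (x - z'))\<^sup>2 - p \<bullet> x"
      "z \<in> \<Omega> \<and> z' \<in> \<Omega> \<longrightarrow> \<eta> / 15 / sqrt (\<alpha> n) \<le> f z' - f z"
      unfolding K_def by blast
    have "M - p \<bullet> \<xi> \<le> g z + w z' - 3 / 2 * \<alpha> n * (norm (x - z))\<^sup>2 - 3 / 2 * \<alpha> n * (norm (x - z'))\<^sup>2 - p \<bullet> x"
      using bspec[OF *(4) \<xi>(1)] by (simp add: M_def g_def w_def)
    with * show ?thesis by blast
  qed
  then obtain x z z' p where zK: "\<And>n. z n \<in> K" "\<And>n. z' n \<in> K" and p: "\<And>n. norm (p n) < 1 / \<alpha> n"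
    and ineq: "\<And>n. M - p n \<bullet> \<xi> \<le> g (z n) + w (z' n) - 3 / 2 * \<alpha> n * (norm (x n - z n))\<^sup>2
        - 3 / 2 * \<alpha> n * (norm (x n - z' n))\<^sup>2 - p n \<bullet> x n"
    and gap: "\<And>n. z n \<in> \<Omega> \<Longrightarrow> z' n \<in> \<Omega> \<Longrightarrow> \<eta> / 15 / sqrt (\<alpha> n) \<le> f (z' n) - f (z n)"
    by metis
  define d where "d n = norm (x n - z n)" for n
  define d' where "d' n = norm (x n - z' n)" for n
  define e where "e n = \<alpha> n * ((d n)\<^sup>2 + (d' n)\<^sup>2)" for n

  have xb: "norm (x n) \<le> R + d n" for n
    using norm_triangle_ineq[of "x n - z n" "z n"] R(2)[OF zK(1)[of n]] by (simp add: d_def)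
  have pb: "p n \<bullet> \<xi> - p n \<bullet> x n \<le> (2 * R + d n) / \<alpha> n" for n
  proof -
    have "p n \<bullet> \<xi> - p n \<bullet> x n = p n \<bullet> (\<xi> - x n)" by (simp add: inner_diff_right)
    also have "\<dots> \<le> norm (p n) * norm (\<xi> - x n)" by (rule norm_cauchy_schwarz)
    also have "\<dots> \<le> 1 / \<alpha> n * (2 * R + d n)"
      using p[of n] \<alpha>[of n] xb[of n] R(2)[OF \<xi>(1)] norm_triangle_ineq4[of \<xi> "x n"]
      by (intro mult_mono) auto
    finally show ?thesis by simp
  qed
  have main: "3 / 2 * e n \<le> g (z n) + w (z' n) - M + (2 * R + d n) / \<alpha> n" for n
    using ineq[of n] pb[of n] by (simp add: e_def d_def d'_def algebra_simps)
  \<comment> \<open>The tilt error contains \<open>d n\<close>, not yet known to be bounded. Since d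
    \<le> d^2 / 2 + 1/2 \<le> e / 2 + 1/2, it is absorbed by the factor 3/2 in front of
    \<open>e n\<close>.\<close>
  define B where "B = g zg + w zw - M + 2 * R + 1"
  have eB: "e n \<le> B" for n
  proof -
    have "0 \<le> 2 * R + d n" using R(1) by (simp add: d_def)
    then have "(2 * R + d n) / \<alpha> n \<le> (2 * R + d n) / 1"
      using \<alpha>[of n] by (intro divide_left_mono) auto
    then have "(2 * R + d n) / \<alpha> n \<le> 2 * R + d n" by simp
    from order_trans[OF main add_left_mono[OF this]]
    have "3 / 2 * e n \<le> g (z n) + w (z' n) - M + (2 * R + d n)" .
    moreover have "d n \<le> (d n)\<^sup>2 / 2 + 1 / 2"
      using zero_le_power2[of "d n - 1"] by (simp add: power2_diff)
    moreover have "(d n)\<^sup>2 \<le> e n"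
    proof -
      have "1 * ((d n)\<^sup>2 + (d' n)\<^sup>2) \<le> e n" unfolding e_def using \<alpha>[of n] by (intro mult_right_mono) auto
      then have "(d n)\<^sup>2 + (d' n)\<^sup>2 \<le> e n" by simp
      then show ?thesis using zero_le_power2[of "d' n"] by linarith
    qed
    ultimately show ?thesis using zg[OF zK(1)[of n]] zw[OF zK(2)[of n]] unfolding B_def by linarith
  qed
  have inv0: "(\<lambda>n. 1 / \<alpha> n) \<longlonglongrightarrow> 0"
    unfolding \<alpha>_def using LIMSEQ_inverse_real_of_nat by (simp add: inverse_eq_divide)
  have d0: "d \<longlonglongrightarrow> 0" "d' \<longlonglongrightarrow> 0"
  proof -
    have lim: "(\<lambda>n. sqrt (B * (1 / \<alpha> n))) \<longlonglongrightarrow> sqrt (B * 0)"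
      by (intro tendsto_intros inv0)
    have sqle: "(d n)\<^sup>2 \<le> B * (1 / \<alpha> n)" "(d' n)\<^sup>2 \<le> B * (1 / \<alpha> n)" for n
    proof -
      have "(d n)\<^sup>2 + (d' n)\<^sup>2 \<le> B * (1 / \<alpha> n)"
        using eB[of n] \<alpha>[of n] by (simp add: e_def field_simps)
      then show "(d n)\<^sup>2 \<le> B * (1 / \<alpha> n)" "(d' n)\<^sup>2 \<le> B * (1 / \<alpha> n)"
        using zero_le_power2[of "d n"] zero_le_power2[of "d' n"] by linarith+
    qed
    have dle: "d n \<le> sqrt (B * (1 / \<alpha> n))" "d' n \<le> sqrt (B * (1 / \<alpha> n))" for n
      using real_le_rsqrt[OF sqle(1)] real_le_rsqrt[OF sqle(2)] by blast+
    show "d \<longlonglongrightarrow> 0"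
      by (rule tendsto_sandwich[of "\<lambda>_. 0" d _ "\<lambda>n. sqrt (B * (1 / \<alpha> n))"])
        (use lim dle(1) in \<open>auto simp: d_def intro!: always_eventually\<close>)
    show "d' \<longlonglongrightarrow> 0"
      by (rule tendsto_sandwich[of "\<lambda>_. 0" d' _ "\<lambda>n. sqrt (B * (1 / \<alpha> n))"])
        (use lim dle(2) in \<open>auto simp: d'_def intro!: always_eventually\<close>)
  qed
  obtain zs r where zs: "zs \<in> K" and r: "strict_mono (r :: nat \<Rightarrow> nat)" and zr: "(\<lambda>n. z (r n)) \<longlonglongrightarrow> zs"
    using K zK(1) unfolding compact_def o_def by metis
  note sub_lim = LIMSEQ_subseq_LIMSEQ[OF _ r, unfolded o_def]
  have zr': "(\<lambda>n. z' (r n)) \<longlonglongrightarrow> zs"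
  proof -
    have "(\<lambda>n. d (r n) + d' (r n)) \<longlonglongrightarrow> 0 + 0" by (intro tendsto_add sub_lim d0)
    then have lim: "(\<lambda>n. d (r n) + d' (r n)) \<longlonglongrightarrow> 0" by simp
    have "norm (z' (r n) - z (r n)) \<le> d (r n) + d' (r n)" for n
      using norm_triangle_ineq4[of "x (r n) - z (r n)" "x (r n) - z' (r n)"] by (simp add: d_def d'_def)
    then have "\<forall>\<^sub>F n in sequentially. norm (z' (r n) - z (r n)) \<le> d (r n) + d' (r n)"
      by (intro always_eventually allI)
    from Lim_null_comparison[OF this lim]
    have "(\<lambda>n. z' (r n) - z (r n)) \<longlonglongrightarrow> 0" .
    from tendsto_add[OF this zr] show ?thesis by simp
  qed
  have small: "(\<lambda>n. (2 * R + d (r n)) / \<alpha> (r n)) \<longlonglongrightarrow> 0"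
  proof -
    have "(\<lambda>n. (2 * R + d (r n)) * (1 / \<alpha> (r n))) \<longlonglongrightarrow> (2 * R + 0) * 0"
      by (intro tendsto_intros sub_lim[OF d0(1)] sub_lim[OF inv0])
    then show ?thesis by simp
  qed
  \<comment> \<open>By semicontinuity at the common limit. As \<open>M\<close> is the maximum of
    \<open>g + w\<close>, this forces the penalties to 0; and a limit on the frontier, where
    \<open>g + w\<close> \<le> 0, would make them negative.\<close>
  have near: "\<forall>\<^sub>F n in sequentially. 3 / 2 * e (r n) < g zs + w zs - M + 3 * t" if "t > 0" for t
  proof -
    have "\<forall>\<^sub>F n in sequentially. g (z (r n)) < g zs + t"
      by (rule usc_on_sequentially[OF usc_g zs zK(1) zr]) (use that in simp)
    moreover have "\<forall>\<^sub>F n in sequentially. w (z' (r n)) < w zs + t"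
      by (rule usc_on_sequentially[OF usc_w zs zK(2) zr']) (use that in simp)
    moreover have "\<forall>\<^sub>F n in sequentially. (2 * R + d (r n)) / \<alpha> (r n) < t"
      using order_tendstoD(2)[OF small that] .
    ultimately show ?thesis
    proof eventually_elim
      case (elim n)
      then show ?case using main[of "r n"] by linarith
    qed
  qed
  have e0: "0 \<le> e n" for n using \<alpha>[of n] by (simp add: e_def)
  have "zs \<in> \<Omega>"
  proof (rule ccontr)
    assume "zs \<notin> \<Omega>"
    then have "zs \<in> frontier \<Omega>" using zs assms(1) by (simp add: K_def frontier_def interior_open)
    then have "g zs + w zs \<le> 0" using bdry g_le[OF zs] by (auto simp: w_def)
    moreover obtain n where "3 / 2 * e (r n) < g zs + w zs - M + 3 * (M / 3)"
      using eventually_happens[OF near[of "M / 3"]] M by auto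
    ultimately have "3 / 2 * e (r n) < 0" by simp
    then show False using e0[of "r n"] by simp
  qed
  then obtain \<rho> L where \<rho>: "\<rho> > 0" and L: "L-lipschitz_on (cball zs \<rho> \<inter> \<Omega>) f"
    using assms(3) unfolding locally_lipschitz_iff by blast
  have L0: "L \<ge> 0" by (rule lipschitz_on_nonneg[OF L])
  \<comment> \<open>Penalties below 2 t will give (\<eta> / 15)^2 \<le> 4 L^2 t, against 6 (L^2 + 1)
    t = (\<eta> / 15)^2. The added 1 covers L = 0.\<close>
  define t where "t = (\<eta> / 15)\<^sup>2 / (6 * (L\<^sup>2 + 1))"
  have L1: "L\<^sup>2 + 1 > 0" by (rule add_nonneg_pos) auto
  have t: "t > 0" using \<eta> L1 by (simp add: t_def)
  have op: "open (ball zs \<rho> \<inter> \<Omega>)" "zs \<in> ball zs \<rho> \<inter> \<Omega>" using assms(1) \<rho> \<open>zs \<in> \<Omega>\<close> by auto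
  have "\<forall>\<^sub>F n in sequentially. False"
    using near[OF t] topological_tendstoD[OF zr op] topological_tendstoD[OF zr' op]
  proof eventually_elim
    case (elim n)
    let ?n = "r n"
    have "3 / 2 * e ?n < 3 * t" using elim(1) \<xi>(2)[OF zs] by (simp add: M_def)
    then have et: "e ?n < 2 * t" by simp
    have "\<eta> / 15 / sqrt (\<alpha> ?n) \<le> f (z' ?n) - f (z ?n)" using elim by (intro gap) auto
    also have "\<dots> \<le> L * norm (z' ?n - z ?n)"
      using lipschitz_onD[OF L, of "z' ?n" "z ?n"] elim(2,3) by (auto simp: dist_norm)
    also have "\<dots> \<le> L * (d ?n + d' ?n)"
      using norm_triangle_ineq4[of "x ?n - z ?n" "x ?n - z' ?n"] L0 by (intro mult_left_mono) (auto simp: d_def d'_def)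
    finally have "\<eta> / 15 \<le> sqrt (\<alpha> ?n) * (L * (d ?n + d' ?n))"
      using \<alpha>[of ?n] by (simp add: divide_le_eq mult_ac)
    then have "(\<eta> / 15)\<^sup>2 \<le> (sqrt (\<alpha> ?n) * (L * (d ?n + d' ?n)))\<^sup>2"
      using \<eta> by (intro power_mono) auto
    also have "\<dots> = L\<^sup>2 * (\<alpha> ?n * (d ?n + d' ?n)\<^sup>2)" using \<alpha>[of ?n] by (simp add: power_mult_distrib)
    also have "\<dots> \<le> L\<^sup>2 * (2 * e ?n)"
    proof (rule mult_left_mono)
      have "(d ?n + d' ?n)\<^sup>2 \<le> 2 * ((d ?n)\<^sup>2 + (d' ?n)\<^sup>2)"
        using zero_le_power2[of "d ?n - d' ?n"] by (simp add: power2_diff power2_sum)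
      then have "\<alpha> ?n * (d ?n + d' ?n)\<^sup>2 \<le> \<alpha> ?n * (2 * ((d ?n)\<^sup>2 + (d' ?n)\<^sup>2))"
        using \<alpha>[of ?n] by (intro mult_left_mono) auto
      then show "\<alpha> ?n * (d ?n + d' ?n)\<^sup>2 \<le> 2 * e ?n" by (simp add: e_def algebra_simps)
    qed simp
    also have "\<dots> \<le> L\<^sup>2 * (4 * t)" using et by (intro mult_left_mono) auto
    also have "\<dots> \<le> (L\<^sup>2 + 1) * (4 * t)" using t by (intro mult_right_mono) auto
    also have "\<dots> < (L\<^sup>2 + 1) * (6 * t)" using t L1 by (intro mult_strict_left_mono) auto
    also have "\<dots> = (\<eta> / 15)\<^sup>2"
    proof -
      have "q * (6 * (s / (6 * q))) = s" if "q > 0" for q s :: real using that by simp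
      then show ?thesis unfolding t_def using L1 .
    qed
    finally show False by simp
  qed
  then show False by simp
qed

end
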